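(* Let $\mathcal{V}_p$ be the finite partition model. Then in $\mathcal{V}_p$: (1) each of Form 3, $\mathsf{ISAE}$, and $\mathsf{EPWFP}$ fails; (2) $\mathsf{AC_n}$ fails for every integer $n\ge 2$; (3) $\mathsf{MA(\aleph_0)}$ fails; (4) each of $\mathsf{MC}$ and $\mathsf{\le\aleph_0}$-$\mathsf{MC}$ fails.
   Context: Permutation (Fraenkel–Mostowski) models: start with a model $M$ of $\mathsf{ZFA}+\mathsf{AC}$ with a set $A$ of atoms, a group $\mathcal{G}$ of permutations of $A$ (acting on all sets by $\in$-recursion), and a normal filter $\mathcal{F}$ of subgroups of $\mathcal{G}$; a set $x$ is symmetric if $\{g\in\mathcal{G}: g(x)=x\}\in\mathcal{F}$, and the permutation model is the class of hereditarily symmetric sets, a model of $\mathsf{ZFA}$. For a set $x$, $\mathrm{fix}_{\mathcal{G}}(x)=\{\phi\in\mathcal{G}:\forall y\in x\ \phi(y)=y\}$. The finite partition model $\mathcal{V}_p$: $A$ is countably infinite, $\mathcal{G}$ is the group of all permutations of $A$, and $\mathcal{F}$ is the set of subgroups $H$ of $\mathcal{G}$ such that $H\supseteq\mathrm{fix}_{\mathcal{G}}(P)$ for some finite partition $P$ of $A$. Form 3: for every infinite set $X$, $X$ and $X\times\{0,1\}$ are equipotent. $\mathsf{ISAE}$: for every infinite set $X$ there is a permutation $f$ of $X$ without fixed points with $f^2=\mathrm{id}_X$. $\mathsf{EPWFP}$: every infinite set has a permutation without fixed points. $\mathsf{AC_n}$: every family of $n$-element sets has a choice function. $\mathsf{MA(\aleph_0)}$: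 if $(P,<)$ is a non-empty c.c.c. quasi order and $\mathcal{D}$ is a family of at most $\aleph_0$ dense subsets of $P$, then there is a filter $\mathcal{F}'$ of $P$ meeting every $D\in\mathcal{D}$. $\mathsf{MC}$: every family $\mathcal{A}$ of non-empty sets has a function $f$ with domain $\mathcal{A}$ such that $f(A)$ is a non-empty finite subset of $A$ for all $A\in\mathcal{A}$. $\mathsf{\le\aleph_0}$-$\mathsf{MC}$: for every family $\{A_i:i\in I\}$ of non-empty sets there is a function $F$ on $I$ such that $F(i)$ is a non-empty countable (finite or countably infinite) subset of $A_i$ for all $i$. *)

theory Defs
  imports Main
begin

section \<open>Structures for the language of set theory with atoms\<close>

text \<open>
  A structure has a universe, a membership relation and a predicate singling out the atoms.
  Neither the universe nor its membership relation is assumed to be standard: all set-theoretic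
  notions below (ordered pair, function, finite, countable, \<open>\<omega>\<close>, ...) are those of the structure,
  so that they can be evaluated both in the ground model and in the permutation model.
\<close>

record 'a set_structure =
  univ :: "'a set"
  mem :: "'a \<Rightarrow> 'a \<Rightarrow> bool"
  atom :: "'a \<Rightarrow> bool"

definition is_set :: "'a set_structure \<Rightarrow> 'a \<Rightarrow> bool" where
  "is_set S x \<longleftrightarrow> x \<in> univ S \<and> \<not> atom S x"

definition elems :: "'a set_structure \<Rightarrow> 'a \<Rightarrow> 'a set" where
  "elems S x = {y \<in> univ S. mem S y x}"


subsection \<open>Basic notions of a structure\<close>

definition is_empty :: "'a set_structure \<Rightarrow> 'a \<Rightarrow> bool" where
  "is_empty S z \<longleftrightarrow> is_set S z \<and> elems S z = {}"

definition is_upair :: "'a set_structure \<Rightarrow> 'a \<Rightarrow> 'a \<Rightarrow> 'a \<Rightarrow> bool" where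
  "is_upair S x y z \<longleftrightarrow> is_set S z \<and> elems S z = {x, y}"

text \<open>\<open>z\<close> is the Kuratowski pair of \<open>x\<close> and \<open>y\<close>.\<close>

definition is_opair :: "'a set_structure \<Rightarrow> 'a \<Rightarrow> 'a \<Rightarrow> 'a \<Rightarrow> bool" where
  "is_opair S x y z \<longleftrightarrow> (\<exists>u v. is_upair S x x u \<and> is_upair S x y v \<and> is_upair S u v z)"

definition is_succ :: "'a set_structure \<Rightarrow> 'a \<Rightarrow> 'a \<Rightarrow> bool" where
  "is_succ S x y \<longleftrightarrow> is_set S y \<and> elems S y = insert x (elems S x)"

definition is_inductive :: "'a set_structure \<Rightarrow> 'a \<Rightarrow> bool" where
  "is_inductive S x \<longleftrightarrow> is_set S x \<and> (\<exists>e \<in> elems S x. is_empty S e) \<and>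
     (\<forall>y \<in> elems S x. \<exists>z \<in> elems S x. is_succ S y z)"

definition is_omega :: "'a set_structure \<Rightarrow> 'a \<Rightarrow> bool" where
  "is_omega S w \<longleftrightarrow> is_inductive S w \<and> (\<forall>x. is_inductive S x \<longrightarrow> elems S w \<subseteq> elems S x)"

definition is_natural :: "'a set_structure \<Rightarrow> 'a \<Rightarrow> bool" where
  "is_natural S n \<longleftrightarrow> (\<exists>w. is_omega S w \<and> n \<in> elems S w)"

text \<open>\<open>z = {0, 1}\<close>, which is also the von Neumann numeral \<open>2\<close>.\<close>

definition is_two :: "'a set_structure \<Rightarrow> 'a \<Rightarrow> bool" where
  "is_two S z \<longleftrightarrow> (\<exists>e i. is_empty S e \<and> is_succ S e i \<and> is_upair S e i z)"

definition at_least_two :: "'a set_structure \<Rightarrow> 'a \<Rightarrow> bool" where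
  "at_least_two S n \<longleftrightarrow> (\<exists>t. is_two S t \<and> (n = t \<or> t \<in> elems S n))"

definition is_transitive :: "'a set_structure \<Rightarrow> 'a \<Rightarrow> bool" where
  "is_transitive S t \<longleftrightarrow> is_set S t \<and> (\<forall>u \<in> elems S t. elems S u \<subseteq> elems S t)"

definition is_product :: "'a set_structure \<Rightarrow> 'a \<Rightarrow> 'a \<Rightarrow> 'a \<Rightarrow> bool" where
  "is_product S X Y Z \<longleftrightarrow> is_set S Z \<and>
     elems S Z = {p \<in> univ S. \<exists>x \<in> elems S X. \<exists>y \<in> elems S Y. is_opair S x y p}"

definition is_nonempty_set :: "'a set_structure \<Rightarrow> 'a \<Rightarrow> bool" where
  "is_nonempty_set S x \<longleftrightarrow> is_set S x \<and> elems S x \<noteq> {}"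


subsection \<open>Relations, functions and cardinality in a structure\<close>

definition rel_of :: "'a set_structure \<Rightarrow> 'a \<Rightarrow> ('a \<times> 'a) set" where
  "rel_of S f = {(x, y). x \<in> univ S \<and> y \<in> univ S \<and> (\<exists>p \<in> elems S f. is_opair S x y p)}"

definition is_relation_on :: "'a set_structure \<Rightarrow> 'a \<Rightarrow> 'a \<Rightarrow> bool" where
  "is_relation_on S r X \<longleftrightarrow> is_set S r \<and>
     (\<forall>p \<in> elems S r. \<exists>x \<in> elems S X. \<exists>y \<in> elems S X. is_opair S x y p)"

definition is_function_on :: "'a set_structure \<Rightarrow> 'a \<Rightarrow> 'a \<Rightarrow> bool" where
  "is_function_on S f X \<longleftrightarrow> is_set S f \<and>
     (\<forall>p \<in> elems S f. \<exists>x \<in> elems S X. \<exists>y \<in> univ S. is_opair S x y p) \<and>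
     (\<forall>x \<in> elems S X. \<exists>!y. (x, y) \<in> rel_of S f)"

definition is_bijection :: "'a set_structure \<Rightarrow> 'a \<Rightarrow> 'a \<Rightarrow> 'a \<Rightarrow> bool" where
  "is_bijection S f X Y \<longleftrightarrow> is_function_on S f X \<and>
     (\<forall>x y. (x, y) \<in> rel_of S f \<longrightarrow> y \<in> elems S Y) \<and>
     (\<forall>y \<in> elems S Y. \<exists>!x. (x, y) \<in> rel_of S f)"

definition equipotent :: "'a set_structure \<Rightarrow> 'a \<Rightarrow> 'a \<Rightarrow> bool" where
  "equipotent S X Y \<longleftrightarrow> (\<exists>f. is_bijection S f X Y)"

definition finite_in :: "'a set_structure \<Rightarrow> 'a \<Rightarrow> bool" where
  "finite_in S X \<longleftrightarrow> is_set S X \<and> (\<exists>n. is_natural S n \<and> equipotent S X n)"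

definition infinite_in :: "'a set_structure \<Rightarrow> 'a \<Rightarrow> bool" where
  "infinite_in S X \<longleftrightarrow> is_set S X \<and> \<not> finite_in S X"

definition countably_infinite_in :: "'a set_structure \<Rightarrow> 'a \<Rightarrow> bool" where
  "countably_infinite_in S X \<longleftrightarrow> is_set S X \<and> (\<exists>w. is_omega S w \<and> equipotent S X w)"

definition countable_in :: "'a set_structure \<Rightarrow> 'a \<Rightarrow> bool" where
  "countable_in S X \<longleftrightarrow> finite_in S X \<or> countably_infinite_in S X"


section \<open>Models of ZFA\<close>

text \<open>First-order formulas, needed for the schemas of separation and replacement.\<close>

datatype form =
    Mem nat nat
  | Eq nat nat
  | Atom nat
  | Neg form
  | Conj form form
  | All nat form

primrec sat :: "'a set_structure \<Rightarrow> (nat \<Rightarrow> 'a) \<Rightarrow> form \<Rightarrow> bool" where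
  "sat S e (Mem i j) \<longleftrightarrow> mem S (e i) (e j)"
| "sat S e (Eq i j) \<longleftrightarrow> e i = e j"
| "sat S e (Atom i) \<longleftrightarrow> atom S (e i)"
| "sat S e (Neg p) \<longleftrightarrow> \<not> sat S e p"
| "sat S e (Conj p q) \<longleftrightarrow> sat S e p \<and> sat S e q"
| "sat S e (All i p) \<longleftrightarrow> (\<forall>x \<in> univ S. sat S (e(i := x)) p)"

definition is_set_of_atoms :: "'a set_structure \<Rightarrow> 'a \<Rightarrow> bool" where
  "is_set_of_atoms S A \<longleftrightarrow> is_set S A \<and> elems S A = {a \<in> univ S. atom S a}"

definition extensionality :: "'a set_structure \<Rightarrow> bool" where
  "extensionality S \<longleftrightarrow>
     (\<forall>x y. is_set S x \<and> is_set S y \<and> elems S x = elems S y \<longrightarrow> x = y)"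

definition atoms_axiom :: "'a set_structure \<Rightarrow> bool" where
  "atoms_axiom S \<longleftrightarrow> (\<forall>a \<in> univ S. atom S a \<longrightarrow> elems S a = {}) \<and> (\<exists>A. is_set_of_atoms S A)"

definition empty_set_axiom :: "'a set_structure \<Rightarrow> bool" where
  "empty_set_axiom S \<longleftrightarrow> (\<exists>z. is_empty S z)"

definition pairing :: "'a set_structure \<Rightarrow> bool" where
  "pairing S \<longleftrightarrow> (\<forall>x \<in> univ S. \<forall>y \<in> univ S. \<exists>z. is_upair S x y z)"

definition union_axiom :: "'a set_structure \<Rightarrow> bool" where
  "union_axiom S \<longleftrightarrow>
     (\<forall>x. is_set S x \<longrightarrow> (\<exists>y. is_set S y \<and> elems S y = (\<Union>u \<in> elems S x. elems S u)))"

definition power_set_axiom :: "'a set_structure \<Rightarrow> bool" where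
  "power_set_axiom S \<longleftrightarrow>
     (\<forall>x. is_set S x \<longrightarrow>
        (\<exists>y. is_set S y \<and> elems S y = {z. is_set S z \<and> elems S z \<subseteq> elems S x}))"

definition infinity_axiom :: "'a set_structure \<Rightarrow> bool" where
  "infinity_axiom S \<longleftrightarrow> (\<exists>x. is_inductive S x)"

definition foundation :: "'a set_structure \<Rightarrow> bool" where
  "foundation S \<longleftrightarrow>
     (\<forall>x. is_nonempty_set S x \<longrightarrow> (\<exists>y \<in> elems S x. elems S y \<inter> elems S x = {}))"

text \<open>In both schemas the environment \<open>e\<close> supplies the parameters.\<close>

definition separation :: "'a set_structure \<Rightarrow> bool" where
  "separation S \<longleftrightarrow>
     (\<forall>p e x. range e \<subseteq> univ S \<and> is_set S x \<longrightarrow>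
        (\<exists>y. is_set S y \<and> elems S y = {z \<in> elems S x. sat S (e(0 := z)) p}))"

definition replacement :: "'a set_structure \<Rightarrow> bool" where
  "replacement S \<longleftrightarrow>
     (\<forall>p e x. range e \<subseteq> univ S \<and> is_set S x \<and>
        (\<forall>u \<in> elems S x. \<forall>v \<in> univ S. \<forall>v' \<in> univ S.
           sat S (e(0 := u, 1 := v)) p \<and> sat S (e(0 := u, 1 := v')) p \<longrightarrow> v = v') \<longrightarrow>
        (\<exists>y. is_set S y \<and>
           elems S y = {v \<in> univ S. \<exists>u \<in> elems S x. sat S (e(0 := u, 1 := v)) p}))"

definition zfa_model :: "'a set_structure \<Rightarrow> bool" where
  "zfa_model S \<longleftrightarrow>
     extensionality S \<and> atoms_axiom S \<and> empty_set_axiom S \<and> pairing S \<and> union_axiom S \<and>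
     power_set_axiom S \<and> infinity_axiom S \<and> foundation S \<and> separation S \<and> replacement S"


section \<open>Choice principles in a structure\<close>

definition is_choice_function :: "'a set_structure \<Rightarrow> 'a \<Rightarrow> 'a \<Rightarrow> bool" where
  "is_choice_function S f F \<longleftrightarrow> is_function_on S f F \<and>
     (\<forall>x y. (x, y) \<in> rel_of S f \<longrightarrow> y \<in> elems S x)"

definition AC :: "'a set_structure \<Rightarrow> bool" where
  "AC S \<longleftrightarrow>
     (\<forall>F. is_set S F \<and> (\<forall>x \<in> elems S F. is_nonempty_set S x) \<longrightarrow>
        (\<exists>f. is_choice_function S f F))"

text \<open>Here \<open>n\<close> is a natural number in the sense of the structure.\<close>

definition AC_n :: "'a set_structure \<Rightarrow> 'a \<Rightarrow> bool" where
  "AC_n S n \<longleftrightarrow>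
     (\<forall>F. is_set S F \<and> (\<forall>x \<in> elems S F. is_set S x \<and> equipotent S x n) \<longrightarrow>
        (\<exists>f. is_choice_function S f F))"

definition Form3 :: "'a set_structure \<Rightarrow> bool" where
  "Form3 S \<longleftrightarrow>
     (\<forall>X t Z. infinite_in S X \<and> is_two S t \<and> is_product S X t Z \<longrightarrow> equipotent S X Z)"

definition fixed_point_free :: "'a set_structure \<Rightarrow> 'a \<Rightarrow> bool" where
  "fixed_point_free S f \<longleftrightarrow> (\<forall>x. (x, x) \<notin> rel_of S f)"

definition ISAE :: "'a set_structure \<Rightarrow> bool" where
  "ISAE S \<longleftrightarrow>
     (\<forall>X. infinite_in S X \<longrightarrow>
        (\<exists>f. is_bijection S f X X \<and> fixed_point_free S f \<and>
             rel_of S f O rel_of S f = Id_on (elems S X)))"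

definition EPWFP :: "'a set_structure \<Rightarrow> bool" where
  "EPWFP S \<longleftrightarrow>
     (\<forall>X. infinite_in S X \<longrightarrow> (\<exists>f. is_bijection S f X X \<and> fixed_point_free S f))"

definition MC :: "'a set_structure \<Rightarrow> bool" where
  "MC S \<longleftrightarrow>
     (\<forall>F. is_set S F \<and> (\<forall>x \<in> elems S F. is_nonempty_set S x) \<longrightarrow>
        (\<exists>f. is_function_on S f F \<and>
           (\<forall>x y. (x, y) \<in> rel_of S f \<longrightarrow>
              is_nonempty_set S y \<and> finite_in S y \<and> elems S y \<subseteq> elems S x)))"

text \<open>The family \<open>{A\<^sub>i : i \<in> I}\<close> is the function \<open>a\<close> with domain \<open>I\<close>.\<close>

definition countable_MC :: "'a set_structure \<Rightarrow> bool" where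
  "countable_MC S \<longleftrightarrow>
     (\<forall>I a. is_set S I \<and> is_function_on S a I \<and>
        (\<forall>i x. (i, x) \<in> rel_of S a \<longrightarrow> is_nonempty_set S x) \<longrightarrow>
        (\<exists>F. is_function_on S F I \<and>
           (\<forall>i x y. (i, x) \<in> rel_of S a \<and> (i, y) \<in> rel_of S F \<longrightarrow>
              is_nonempty_set S y \<and> countable_in S y \<and> elems S y \<subseteq> elems S x)))"


subsection \<open>Martin's axiom for countably many dense sets\<close>

text \<open>\<open>(p, q) \<in> rel_of S r\<close> reads \<open>p \<le> q\<close>, i.e. \<open>p\<close> is the stronger condition.\<close>

definition is_quasi_order :: "'a set_structure \<Rightarrow> 'a \<Rightarrow> 'a \<Rightarrow> bool" where
  "is_quasi_order S P r \<longleftrightarrow> is_set S P \<and> is_relation_on S r P \<and>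
     (\<forall>p \<in> elems S P. (p, p) \<in> rel_of S r) \<and> trans (rel_of S r)"

definition compatible :: "'a set_structure \<Rightarrow> 'a \<Rightarrow> 'a \<Rightarrow> 'a \<Rightarrow> 'a \<Rightarrow> bool" where
  "compatible S P r p q \<longleftrightarrow> (\<exists>s \<in> elems S P. (s, p) \<in> rel_of S r \<and> (s, q) \<in> rel_of S r)"

definition is_antichain :: "'a set_structure \<Rightarrow> 'a \<Rightarrow> 'a \<Rightarrow> 'a \<Rightarrow> bool" where
  "is_antichain S P r C \<longleftrightarrow> is_set S C \<and> elems S C \<subseteq> elems S P \<and>
     (\<forall>p \<in> elems S C. \<forall>q \<in> elems S C. p \<noteq> q \<longrightarrow> \<not> compatible S P r p q)"

definition is_ccc :: "'a set_structure \<Rightarrow> 'a \<Rightarrow> 'a \<Rightarrow> bool" where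
  "is_ccc S P r \<longleftrightarrow> (\<forall>C. is_antichain S P r C \<longrightarrow> countable_in S C)"

definition is_dense :: "'a set_structure \<Rightarrow> 'a \<Rightarrow> 'a \<Rightarrow> 'a \<Rightarrow> bool" where
  "is_dense S P r D \<longleftrightarrow> is_set S D \<and> elems S D \<subseteq> elems S P \<and>
     (\<forall>p \<in> elems S P. \<exists>d \<in> elems S D. (d, p) \<in> rel_of S r)"

definition is_filter :: "'a set_structure \<Rightarrow> 'a \<Rightarrow> 'a \<Rightarrow> 'a \<Rightarrow> bool" where
  "is_filter S P r G \<longleftrightarrow> is_nonempty_set S G \<and> elems S G \<subseteq> elems S P \<and>
     (\<forall>p \<in> elems S G. \<forall>q \<in> elems S P. (p, q) \<in> rel_of S r \<longrightarrow> q \<in> elems S G) \<and>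
     (\<forall>p \<in> elems S G. \<forall>q \<in> elems S G.
        \<exists>s \<in> elems S G. (s, p) \<in> rel_of S r \<and> (s, q) \<in> rel_of S r)"

definition MA_aleph0 :: "'a set_structure \<Rightarrow> bool" where
  "MA_aleph0 S \<longleftrightarrow>
     (\<forall>P r DD. is_nonempty_set S P \<and> is_quasi_order S P r \<and> is_ccc S P r \<and>
        is_set S DD \<and> countable_in S DD \<and> (\<forall>D \<in> elems S DD. is_dense S P r D) \<longrightarrow>
        (\<exists>G. is_filter S P r G \<and> (\<forall>D \<in> elems S DD. elems S G \<inter> elems S D \<noteq> {})))"


section \<open>Permutation models\<close>

text \<open>
  \<open>acts M g x y\<close> says \<open>g(x) = y\<close> for the extension of a permutation \<open>g\<close> of the atoms to all of
  \<open>M\<close> by \<open>\<in>\<close>-recursion, \<open>g(x) = {g(u) : u \<in> x}\<close> for sets \<open>x\<close>. As \<open>M\<close> need not be well-founded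
  from outside, the recursion is the one carried out in \<open>M\<close>: \<open>h\<close> is a set of \<open>M\<close> that obeys the
  recursion equations on a transitive set containing \<open>x\<close>.
\<close>

definition acts :: "'a set_structure \<Rightarrow> 'a \<Rightarrow> 'a \<Rightarrow> 'a \<Rightarrow> bool" where
  "acts M g x y \<longleftrightarrow>
     (\<exists>t h. is_transitive M t \<and> x \<in> elems M t \<and> is_function_on M h t \<and>
        (\<forall>u v. (u, v) \<in> rel_of M h \<longrightarrow>
           (if atom M u then (u, v) \<in> rel_of M g
            else is_set M v \<and> elems M v = rel_of M h `` elems M u)) \<and>
        (x, y) \<in> rel_of M h)"

definition permutations :: "'a set_structure \<Rightarrow> 'a \<Rightarrow> 'a set" where
  "permutations M A = {g. is_bijection M g A A}"

definition is_subgroup :: "'a set_structure \<Rightarrow> 'a \<Rightarrow> 'a set \<Rightarrow> 'a \<Rightarrow> bool" where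
  "is_subgroup M A G H \<longleftrightarrow> is_set M H \<and> elems M H \<subseteq> G \<and>
     (\<exists>i \<in> elems M H. rel_of M i = Id_on (elems M A)) \<and>
     (\<forall>g \<in> elems M H. \<forall>h \<in> elems M H. \<exists>k \<in> elems M H. rel_of M k = rel_of M h O rel_of M g) \<and>
     (\<forall>g \<in> elems M H. \<exists>k \<in> elems M H. rel_of M k = (rel_of M g)\<inverse>)"

text \<open>The pointwise stabilizer of the elements of \<open>x\<close>.\<close>

definition fix_pointwise :: "'a set_structure \<Rightarrow> 'a set \<Rightarrow> 'a \<Rightarrow> 'a set" where
  "fix_pointwise M G x = {g \<in> G. \<forall>y \<in> elems M x. acts M g y y}"

definition symmetric :: "'a set_structure \<Rightarrow> 'a set \<Rightarrow> 'a set \<Rightarrow> 'a \<Rightarrow> bool" where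
  "symmetric M G \<F> x \<longleftrightarrow> (\<exists>H \<in> \<F>. elems M H = {g \<in> G. acts M g x x})"

text \<open>
  \<open>y\<close> belongs to the transitive closure of \<open>{x}\<close>; hereditary symmetry asks for the symmetry of \<open>x\<close>
  and of all elements of its transitive closure.
\<close>

definition in_closure :: "'a set_structure \<Rightarrow> 'a \<Rightarrow> 'a \<Rightarrow> bool" where
  "in_closure M x y \<longleftrightarrow>
     y \<in> univ M \<and> (\<forall>t. is_transitive M t \<and> x \<in> elems M t \<longrightarrow> y \<in> elems M t)"

definition permutation_model ::
    "'a set_structure \<Rightarrow> 'a set \<Rightarrow> 'a set \<Rightarrow> 'a set_structure" where
  "permutation_model M G \<F> =
     M\<lparr>univ := {x \<in> univ M. \<forall>y. in_closure M x y \<longrightarrow> symmetric M G \<F> y}\<rparr>"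

definition is_partition :: "'a set_structure \<Rightarrow> 'a \<Rightarrow> 'a \<Rightarrow> bool" where
  "is_partition M A P \<longleftrightarrow> is_set M P \<and> (\<forall>B \<in> elems M P. is_nonempty_set M B) \<and>
     (\<Union>B \<in> elems M P. elems M B) = elems M A \<and>
     (\<forall>B \<in> elems M P. \<forall>C \<in> elems M P. B \<noteq> C \<longrightarrow> elems M B \<inter> elems M C = {})"

definition finite_partition_filter :: "'a set_structure \<Rightarrow> 'a \<Rightarrow> 'a set" where
  "finite_partition_filter M A =
     {H. is_subgroup M A (permutations M A) H \<and>
         (\<exists>P. is_partition M A P \<and> finite_in M P \<and>
              fix_pointwise M (permutations M A) P \<subseteq> elems M H)}"

definition finite_partition_model :: "'a set_structure \<Rightarrow> 'a \<Rightarrow> 'a set_structure" where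
  "finite_partition_model M A =
     permutation_model M (permutations M A) (finite_partition_filter M A)"

end

theory Submission
  imports Defs
begin

text \<open>
  As \<open>M\<close> need not be well-founded, all recursions and inductions are carried out inside \<open>M\<close> on
  definable predicates. A definable predicate is moreover invariant under every automorphism of \<open>M\<close>
  that fixes its parameters, so that objects defined from symmetric parameters are symmetric.

  Let \<open>Q\<close> be a finite partition that supports an object of the model. A transposition of two atoms of
  the same block of \<open>Q\<close> fixes that object, and some block \<open>B\<close> is infinite. This refutes all
  the principles. A permutation \<open>f\<close> of \<open>A\<close> without fixed points has \<open>f a = b \<noteq> a\<close> for some
  \<open>a \<in> B\<close>, and the transposition of a third atom of \<open>B\<close> with \<open>b\<close> or with \<open>a\<close> makes \<open>f\<close>
  multi-valued or not injective; a bijection of \<open>A\<close> with \<open>A \<times> 2\<close> is treated in the same way.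
  A choice function on the \<open>n\<close>-element sets of atoms cannot select an element of a subset of
  \<open>B\<close>. A multiple choice on the cofinite sets of atoms selects from the union of the infinite blocks
  a set that contains an infinite block, and such a set is not countable in the model.

  Martin's axiom fails for the finite reflexive tournaments on sets of atoms, ordered by extension.
  In the model the elements of an antichain live on the finite blocks of a supporting partition, so that
  antichains are finite. A filter contains no tournament on two points of one block, for it would also
  contain the image under their transposition; hence it cannot meet, for every \<open>n\<close>, the dense set
  of the tournaments on at least \<open>n\<close> points.
\<close>

section \<open>Renaming of variables\<close>

text \<open>Separation and replacement of \<open>M\<close> are schemas over formulas, so a set of
  \<open>M\<close> may be formed only from a predicate already shown to be definable.
  \<open>Df\<close> turns this into a closure calculus; the chains of \<open>rule\<close> over
  \<open>Df_logic\<close> are proofs in it. Numbers and finiteness are those of \<open>M\<close> and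
  may be nonstandard, so their theory is rebuilt from separation and the minimality of
  \<open>om\<close>. Objects of the model occur in two roles. Those assumed to exist there
  (functions, filters, antichains) are known only to have a finite partition as support. Those to be
  exhibited there (families, orders, bijections) come from invariant parameters or have a finite set
  of atoms as support. The obstacle is that equipotence, hence finiteness and countability, depends
  on which bijections the model contains: passing from the model to \<open>M\<close> is free, but
  the converse requires a supported bijection. Natural numbers link the two sides, since every
  permutation fixes each of them.\<close>

primrec rename_form :: "(nat \<Rightarrow> nat) \<Rightarrow> form \<Rightarrow> form" where
  "rename_form f (Mem i j) = Mem (f i) (f j)"
| "rename_form f (Eq i j) = Eq (f i) (f j)"
| "rename_form f (Atom i) = Atom (f i)"
| "rename_form f (Neg p) = Neg (rename_form f p)"
| "rename_form f (Conj p q) = Conj (rename_form f p) (rename_form f q)"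
| "rename_form f (All i p) = All (f i) (rename_form f p)"

text \<open>Bound variables are renamed along with the free ones, so injectivity of \<open>f\<close>
  alone rules out capture.\<close>

lemma sat_rename_form:
  assumes "inj f"
  shows "sat S e (rename_form f p) \<longleftrightarrow> sat S (e \<circ> f) p"
proof (induction p arbitrary: e)
  case (All i p)
  have "e(f i := x) \<circ> f = (e \<circ> f)(i := x)" for x
    using assms by (auto simp: fun_eq_iff inj_eq)
  then show ?case by (simp only: rename_form.simps sat.simps All)
qed auto

text \<open>Bound variables are counted too, so every index from the bound upwards is fresh for the
  whole formula.\<close>

primrec var_bound :: "form \<Rightarrow> nat" where
  "var_bound (Mem i j) = Suc (max i j)"
| "var_bound (Eq i j) = Suc (max i j)"
| "var_bound (Atom i) = Suc i"
| "var_bound (Neg p) = var_bound p"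
| "var_bound (Conj p q) = max (var_bound p) (var_bound q)"
| "var_bound (All i p) = max (Suc i) (var_bound p)"

lemma sat_cong_var_bound:
  "(\<And>i. i < var_bound p \<Longrightarrow> e i = e' i) \<Longrightarrow> sat S e p \<longleftrightarrow> sat S e' p"
proof (induction p arbitrary: e e')
  case (Conj p q)
  have "sat S e p \<longleftrightarrow> sat S e' p" "sat S e q \<longleftrightarrow> sat S e' q"
    by (rule Conj.IH; use Conj.prems in simp)+
  then show ?case by simp
next
  case (All i p)
  have "sat S (e(i := x)) p \<longleftrightarrow> sat S (e'(i := x)) p" for x
    by (rule All.IH) (use All.prems in auto)
  then show ?case by simp
next
  case (Neg p)
  have "sat S e p \<longleftrightarrow> sat S e' p"
    by (rule Neg.IH) (use Neg.prems in auto)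
  then show ?case by simp
qed simp_all


section \<open>Definability with parameters\<close>

definition interleave :: "(nat \<Rightarrow> 'a) \<Rightarrow> (nat \<Rightarrow> 'a) \<Rightarrow> nat \<Rightarrow> 'a" where
  "interleave e c i = (if even i then e (i div 2) else c (i div 2))"

definition push :: "'a \<Rightarrow> (nat \<Rightarrow> 'a) \<Rightarrow> nat \<Rightarrow> 'a" where
  "push x e i = (case i of 0 \<Rightarrow> x | Suc j \<Rightarrow> e j)"

lemma push_simps [simp]: "push x e 0 = x" "push x e (Suc i) = e i"
  by (simp_all add: push_def)

locale zfa =
  fixes M :: "'a set_structure"
  assumes zfa_model: "zfa_model M"
begin

abbreviation "U \<equiv> univ M"
abbreviation "el \<equiv> elems M"

lemma el_subset_U: "el x \<subseteq> U"
  by (auto simp: elems_def)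

lemma el_in_U: "y \<in> el x \<Longrightarrow> y \<in> U"
  by (auto simp: elems_def)

lemma is_set_in_U: "is_set M x \<Longrightarrow> x \<in> U"
  by (simp add: is_set_def)

lemma is_empty_ex: "\<exists>z. is_empty M z"
  using zfa_model by (simp add: zfa_model_def empty_set_axiom_def)

lemma ext_set: "is_set M x \<Longrightarrow> is_set M y \<Longrightarrow> el x = el y \<Longrightarrow> x = y"
  using zfa_model by (simp add: zfa_model_def extensionality_def)

lemma el_atom: "x \<in> U \<Longrightarrow> atom M x \<Longrightarrow> el x = {}"
  using zfa_model by (simp add: zfa_model_def atoms_axiom_def)

text \<open>
  \<open>Df K P\<close>: the predicate \<open>P\<close> of environments is defined by a formula with parameters from \<open>K\<close>.
  The odd variables hold the parameters; the empty set is always admitted as one,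
  so that parameter sequences exist even for \<open>K = {}\<close>.
\<close>

definition Df :: "'a set \<Rightarrow> ((nat \<Rightarrow> 'a) \<Rightarrow> bool) \<Rightarrow> bool" where
  "Df K P \<longleftrightarrow> (\<exists>p c. range c \<subseteq> U \<inter> (K \<union> {z. is_empty M z}) \<and>
     (\<forall>e. range e \<subseteq> U \<longrightarrow> P e = sat M (interleave e c) p))"

text \<open>The language has no function symbols, so terms are only variables and parameters.
  Operations such as \<open>Pr\<close> or \<open>sc\<close> enter through their graphs, as in
  \<open>Df_Pr_eq\<close> and \<open>Df_eq_sc\<close>.\<close>

definition Dt :: "'a set \<Rightarrow> ((nat \<Rightarrow> 'a) \<Rightarrow> 'a) \<Rightarrow> bool" where
  "Dt K t \<longleftrightarrow> (\<exists>i. t = (\<lambda>e. e i)) \<or> (\<exists>c \<in> U \<inter> K. t = (\<lambda>e. c))"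

lemma Dt_var: "Dt K (\<lambda>e. e i)"
  by (auto simp: Dt_def)

lemma Dt_const: "c \<in> K \<Longrightarrow> c \<in> U \<Longrightarrow> Dt K (\<lambda>e. c)"
  by (auto simp: Dt_def)

lemma Dt_shift: "Dt K t \<Longrightarrow> Dt K (\<lambda>e. t (\<lambda>i. e (Suc i)))"
  by (auto simp: Dt_def)

lemma env_in_U: "range e \<subseteq> U \<Longrightarrow> e i \<in> U"
  by auto

lemma Dt_in_U: "Dt K t \<Longrightarrow> range e \<subseteq> U \<Longrightarrow> t e \<in> U"
  by (auto simp: Dt_def)

lemma Df_cong: "Df K Q \<Longrightarrow> (\<And>e. range e \<subseteq> U \<Longrightarrow> P e = Q e) \<Longrightarrow> Df K P"
  unfolding Df_def by metis

text \<open>Two parameter sequences are merged into one, which occupies the odd positions.\<close>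

lemma Df_merge:
  assumes "Df K P" "Df K Q"
  obtains p q c where "range c \<subseteq> U \<inter> (K \<union> {z. is_empty M z})"
    "\<And>e. range e \<subseteq> U \<Longrightarrow> P e = sat M (interleave e c) p"
    "\<And>e. range e \<subseteq> U \<Longrightarrow> Q e = sat M (interleave e c) q"
proof -
  obtain p c where p: "range c \<subseteq> U \<inter> (K \<union> {z. is_empty M z})"
    "\<And>e. range e \<subseteq> U \<Longrightarrow> P e = sat M (interleave e c) p"
    using assms(1) unfolding Df_def by metis
  obtain q d where q: "range d \<subseteq> U \<inter> (K \<union> {z. is_empty M z})"
    "\<And>e. range e \<subseteq> U \<Longrightarrow> Q e = sat M (interleave e d) q"
    using assms(2) unfolding Df_def by metis
  \<comment> \<open>In the merged assignment \<open>c j\<close> is the value of variable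
    \<open>4 * j + 1\<close> and \<open>d j\<close> that of variable \<open>4 * j + 3\<close>;
    \<open>f\<close> and \<open>g\<close> send variable \<open>2 * j + 1\<close> there and keep the
    even ones.\<close>
  define f where "f i = (if even i then i else 2 * (i - 1) + 1)" for i :: nat
  define g where "g i = (if even i then i else 2 * (i - 1) + 3)" for i :: nat
  have inj: "inj f" "inj g"
    by (auto simp: inj_def f_def g_def elim!: oddE split: if_splits)
  have "interleave e (interleave c d) \<circ> f = interleave e c" for e
    by (auto simp: interleave_def fun_eq_iff f_def elim!: oddE)
  moreover have "interleave e (interleave c d) \<circ> g = interleave e d" for e
    by (auto simp: interleave_def fun_eq_iff g_def elim!: oddE)
  moreover have "range (interleave c d) \<subseteq> U \<inter> (K \<union> {z. is_empty M z})"
    using p(1) q(1) by (simp add: interleave_def image_subset_iff)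
  ultimately show thesis
    using p(2) q(2) inj
    by (intro that[of "interleave c d" "rename_form f p" "rename_form g q"])
      (simp_all add: sat_rename_form)
qed

lemma Df_atomic:
  assumes t: "Dt K t" and u: "Dt K u"
  obtains i j c where "range c \<subseteq> U \<inter> (K \<union> {z. is_empty M z})"
    "\<And>e. t e = interleave e c i" "\<And>e. u e = interleave e c j"
proof -
  obtain z where z: "is_empty M z" "z \<in> U"
    using is_empty_ex is_set_in_U by (auto simp: is_empty_def)
  \<comment> \<open>A constant term has the same value in every environment, so it is read off at
    \<open>\<lambda>_. z\<close>. The constant of \<open>t\<close> is stored in slot 0 (variable 1),
    that of \<open>u\<close> in slot 1 (variable 3); the empty set fills all other slots.\<close>
  define c where "c i = (if i = 0 \<and> range t \<subseteq> {t (\<lambda>_. z)} \<and> t (\<lambda>_. z) \<in> U \<inter> K then t (\<lambda>_. z)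
     else if i = Suc 0 \<and> range u \<subseteq> {u (\<lambda>_. z)} \<and> u (\<lambda>_. z) \<in> U \<inter> K then u (\<lambda>_. z) else z)" for i :: nat
  have c: "range c \<subseteq> U \<inter> (K \<union> {z. is_empty M z})"
    using z by (auto simp: c_def)
  have "\<exists>i. \<forall>e. t e = interleave e c i"
    using t unfolding Dt_def
  proof (elim disjE exE bexE)
    fix i assume "t = (\<lambda>e. e i)"
    then show ?thesis by (intro exI[of _ "2 * i"]) (simp add: interleave_def)
  next
    fix k assume "k \<in> U \<inter> K" "t = (\<lambda>e. k)"
    then show ?thesis by (intro exI[of _ 1]) (simp add: interleave_def c_def)
  qed
  moreover have "\<exists>i. \<forall>e. u e = interleave e c i"
    using u unfolding Dt_def
  proof (elim disjE exE bexE)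
    fix i assume "u = (\<lambda>e. e i)"
    then show ?thesis by (intro exI[of _ "2 * i"]) (simp add: interleave_def)
  next
    fix k assume "k \<in> U \<inter> K" "u = (\<lambda>e. k)"
    then show ?thesis by (intro exI[of _ 3]) (simp add: interleave_def c_def)
  qed
  ultimately show thesis using that c by metis
qed

lemma Df_mem:
  assumes "Dt K t" "Dt K u" shows "Df K (\<lambda>e. mem M (t e) (u e))"
proof -
  obtain i j c where "range c \<subseteq> U \<inter> (K \<union> {z. is_empty M z})"
    "\<And>e. t e = interleave e c i" "\<And>e. u e = interleave e c j"
    by (rule Df_atomic[OF assms]) auto
  then show ?thesis
    unfolding Df_def by (intro exI[of _ "Mem i j"] exI[of _ c]) simp
qed

lemma Df_eq:
  assumes "Dt K t" "Dt K u" shows "Df K (\<lambda>e. t e = u e)"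
proof -
  obtain i j c where "range c \<subseteq> U \<inter> (K \<union> {z. is_empty M z})"
    "\<And>e. t e = interleave e c i" "\<And>e. u e = interleave e c j"
    by (rule Df_atomic[OF assms]) auto
  then show ?thesis
    unfolding Df_def by (intro exI[of _ "Eq i j"] exI[of _ c]) simp
qed

lemma Df_atom:
  assumes "Dt K t" shows "Df K (\<lambda>e. atom M (t e))"
proof -
  obtain i j c where "range c \<subseteq> U \<inter> (K \<union> {z. is_empty M z})"
    "\<And>e. t e = interleave e c i" "\<And>e. t e = interleave e c j"
    by (rule Df_atomic[OF assms assms]) auto
  then show ?thesis
    unfolding Df_def by (intro exI[of _ "Atom i"] exI[of _ c]) simp
qed

lemma Df_not: "Df K P \<Longrightarrow> Df K (\<lambda>e. \<not> P e)"
  unfolding Df_def by (metis sat.simps(4))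

lemma Df_conj:
  assumes "Df K P" "Df K Q" shows "Df K (\<lambda>e. P e \<and> Q e)"
proof -
  obtain p q c where "range c \<subseteq> U \<inter> (K \<union> {z. is_empty M z})"
    "\<And>e. range e \<subseteq> U \<Longrightarrow> P e = sat M (interleave e c) p"
    "\<And>e. range e \<subseteq> U \<Longrightarrow> Q e = sat M (interleave e c) q"
    by (rule Df_merge[OF assms]) auto
  then show ?thesis
    unfolding Df_def by (intro exI[of _ "Conj p q"] exI[of _ c]) simp
qed

lemma Df_disj: "Df K P \<Longrightarrow> Df K Q \<Longrightarrow> Df K (\<lambda>e. P e \<or> Q e)"
  using Df_not[OF Df_conj[OF Df_not Df_not]] by simp

lemma Df_imp: "Df K P \<Longrightarrow> Df K Q \<Longrightarrow> Df K (\<lambda>e. P e \<longrightarrow> Q e)"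
  using Df_not[OF Df_conj[OF _ Df_not]] by simp

lemma Df_iff: "Df K P \<Longrightarrow> Df K Q \<Longrightarrow> Df K (\<lambda>e. P e \<longleftrightarrow> Q e)"
  using Df_conj[OF Df_imp Df_imp] by (simp add: iff_conv_conj_imp)

lemma Df_if: "Df K P \<Longrightarrow> Df K Q \<Longrightarrow> Df K R \<Longrightarrow> Df K (\<lambda>e. if P e then Q e else R e)"
  using Df_conj[OF Df_imp Df_imp[OF Df_not]] by (simp add: if_bool_eq_conj)

text \<open>
  Bound variables are handled as de Bruijn indices: below a quantifier the bound variable is \<open>e 0\<close>
  and the outer ones are shifted. In the formula the bound variable is a fresh one, \<open>N\<close>.
\<close>

lemma Df_all_U:
  assumes "Df K (\<lambda>e. Q (\<lambda>i. e (Suc i)) (e 0))"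
  shows "Df K (\<lambda>e. \<forall>x \<in> U. Q e x)"
proof -
  obtain p c where c: "range c \<subseteq> U \<inter> (K \<union> {z. is_empty M z})"
    and p: "\<And>e. range e \<subseteq> U \<Longrightarrow> Q (\<lambda>i. e (Suc i)) (e 0) = sat M (interleave e c) p"
    using assms unfolding Df_def by metis
  \<comment> \<open>In the hypothesis the bound variable is variable 0 and the outer ones start at
    variable 2. \<open>f\<close> rotates the even indices up to \<open>N\<close>: 0 goes to
    \<open>N\<close>, the others drop by 2. Keeping the larger indices makes \<open>f\<close>
    injective, and \<open>p\<close> does not see them because its variables lie below
    \<open>N\<close>.\<close>
  define N where "N = 2 * var_bound p"
  define f where "f i = (if i = 0 then N else if even i \<and> i \<le> N then i - 2 else i)" for i
  have "inj f"
    unfolding inj_def f_def N_def by (auto split: if_splits elim!: evenE oddE; presburger)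
  have "Q e x = sat M ((interleave e c)(N := x)) (rename_form f p)"
    if e: "range e \<subseteq> U" and x: "x \<in> U" for e x
  proof -
    have eq: "((interleave e c)(N := x) \<circ> f) i = interleave (push x e) c i" if "i < var_bound p" for i
      using that
      by (auto simp: interleave_def f_def N_def push_def elim!: evenE split: nat.split)
    have "range (push x e) \<subseteq> U"
      using e x by (auto simp: push_def env_in_U split: nat.split)
    then have "Q e x \<longleftrightarrow> sat M (interleave (push x e) c) p"
      using p[of "push x e"] by simp
    also have "\<dots> \<longleftrightarrow> sat M ((interleave e c)(N := x) \<circ> f) p"
      by (rule sat_cong_var_bound) (simp only: eq)
    finally show ?thesis
      by (simp only: sat_rename_form[OF \<open>inj f\<close>])
  qed
  then show ?thesis
    unfolding Df_def using c by (intro exI[of _ "All N (rename_form f p)"] exI[of _ c]) auto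
qed

lemma Df_ex_U:
  assumes "Df K (\<lambda>e. Q (\<lambda>i. e (Suc i)) (e 0))"
  shows "Df K (\<lambda>e. \<exists>x \<in> U. Q e x)"
proof (rule Df_cong)
  show "Df K (\<lambda>e. \<not> (\<forall>x \<in> U. \<not> Q e x))"
    by (intro Df_not Df_all_U assms)
qed blast

lemma Df_in_el:
  assumes "Dt K t" "Dt K u" shows "Df K (\<lambda>e. t e \<in> el (u e))"
proof (rule Df_cong)
  show "Df K (\<lambda>e. mem M (t e) (u e))"
    by (rule Df_mem assms)+
  show "(t e \<in> el (u e)) = mem M (t e) (u e)" if "range e \<subseteq> U" for e
    using Dt_in_U[OF assms(1) that] by (simp add: elems_def)
qed

lemma Df_all_el:
  assumes "Dt K t" "Df K (\<lambda>e. Q (\<lambda>i. e (Suc i)) (e 0))"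
  shows "Df K (\<lambda>e. \<forall>x \<in> el (t e). Q e x)"
proof (rule Df_cong)
  show "Df K (\<lambda>e. \<forall>x \<in> U. x \<in> el (t e) \<longrightarrow> Q e x)"
    by (rule Df_all_U Df_imp Df_in_el Dt_var Dt_shift assms)+
qed (use el_in_U in blast)

lemma Df_ex_el:
  assumes "Dt K t" "Df K (\<lambda>e. Q (\<lambda>i. e (Suc i)) (e 0))"
  shows "Df K (\<lambda>e. \<exists>x \<in> el (t e). Q e x)"
proof (rule Df_cong)
  show "Df K (\<lambda>e. \<exists>x \<in> U. x \<in> el (t e) \<and> Q e x)"
    by (rule Df_ex_U Df_conj Df_in_el Dt_var Dt_shift assms)+
qed (use el_in_U in blast)

lemma Df_is_set: "Dt K t \<Longrightarrow> Df K (\<lambda>e. is_set M (t e))"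
  by (rule Df_cong[OF Df_not[OF Df_atom]]) (auto simp: is_set_def Dt_in_U)

lemma Df_subset: 
  assumes "Dt K t" "Dt K u" shows "Df K (\<lambda>e. el (t e) \<subseteq> el (u e))"
proof (rule Df_cong)
  show "Df K (\<lambda>e. \<forall>x \<in> el (t e). x \<in> el (u e))"
    by (rule Df_all_el Df_in_el Dt_var Dt_shift assms)+
qed auto

lemmas Df_logic = Df_conj Df_disj Df_not Df_imp Df_iff Df_if Df_all_U Df_ex_U Df_all_el Df_ex_el
  Df_eq Df_in_el Df_atom Df_is_set Df_subset

lemma separation_Df:
  assumes "Df K (\<lambda>e. P (e 0))" "is_set M x"
  shows "\<exists>y. is_set M y \<and> el y = {z \<in> el x. P z}"
proof -
  obtain p c where c: "range c \<subseteq> U \<inter> (K \<union> {z. is_empty M z})"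
    and p: "\<And>e. range e \<subseteq> U \<Longrightarrow> P (e 0) = sat M (interleave e c) p"
    using assms(1) unfolding Df_def by metis
  define e where "e = interleave (\<lambda>_. x) c"
  have "e(0 := z) = interleave (push z (\<lambda>_. x)) c" for z
    by (auto simp: fun_eq_iff e_def interleave_def push_def split: nat.split elim!: evenE)
  moreover have "range (push z (\<lambda>_. x)) \<subseteq> U" if "z \<in> U" for z
    using that is_set_in_U[OF assms(2)] by (auto simp: push_def split: nat.split)
  ultimately have "P z = sat M (e(0 := z)) p" if "z \<in> U" for z
    using p[of "push z (\<lambda>_. x)"] that by simp
  moreover have "range e \<subseteq> U"
    using c is_set_in_U[OF assms(2)] by (auto simp: e_def interleave_def)
  then have "\<exists>y. is_set M y \<and> el y = {z \<in> el x. sat M (e(0 := z)) p}"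
    using zfa_model assms(2) unfolding zfa_model_def separation_def by blast
  moreover have "{z \<in> el x. sat M (e(0 := z)) p} = {z \<in> el x. P z}"
    using calculation(1) el_in_U by blast
  ultimately show ?thesis by simp
qed

lemma replacement_Df:
  assumes "Df K (\<lambda>e. R (e 0) (e 1))" "is_set M x"
    and "\<And>u v v'. u \<in> el x \<Longrightarrow> v \<in> U \<Longrightarrow> v' \<in> U \<Longrightarrow> R u v \<Longrightarrow> R u v' \<Longrightarrow> v = v'"
  shows "\<exists>y. is_set M y \<and> el y = {v \<in> U. \<exists>u \<in> el x. R u v}"
proof -
  obtain p c where c: "range c \<subseteq> U \<inter> (K \<union> {z. is_empty M z})"
    and p: "\<And>e. range e \<subseteq> U \<Longrightarrow> R (e 0) (e 1) = sat M (interleave e c) p"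
    using assms(1) unfolding Df_def by metis
  \<comment> \<open>Replacement reads its two arguments at variables 0 and 1, whereas
    \<open>e 0\<close> and \<open>e 1\<close> sit at variables 0 and 2; \<open>f\<close> exchanges 1
    and 2.\<close>
  define f :: "nat \<Rightarrow> nat" where "f i = (if i = 1 then 2 else if i = 2 then 1 else i)" for i
  define e where "e = interleave (\<lambda>_. x) c \<circ> f"
  have "inj f" by (auto simp: inj_def f_def)
  have "e(0 := u, 1 := v) \<circ> f = interleave (push u (push v (\<lambda>_. x))) c" for u v
    by (auto simp: fun_eq_iff e_def interleave_def push_def f_def split: nat.split elim!: evenE)
  moreover have "range (push u (push v (\<lambda>_. x))) \<subseteq> U" if "u \<in> U" "v \<in> U" for u v
    using that is_set_in_U[OF assms(2)] by (auto simp: push_def split: nat.split)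
  ultimately have R: "R u v = sat M (e(0 := u, 1 := v)) (rename_form f p)" if "u \<in> U" "v \<in> U" for u v
    using p[of "push u (push v (\<lambda>_. x))"] that by (simp add: sat_rename_form[OF \<open>inj f\<close>])
  have e: "range e \<subseteq> U"
    using c is_set_in_U[OF assms(2)] by (auto simp: e_def interleave_def)
  have "\<exists>y. is_set M y \<and> el y = {v \<in> U. \<exists>u \<in> el x. sat M (e(0 := u, 1 := v)) (rename_form f p)}"
  proof -
    have "replacement M" using zfa_model unfolding zfa_model_def by blast
    moreover have "\<forall>u \<in> el x. \<forall>v \<in> U. \<forall>v' \<in> U.
           sat M (e(0 := u, 1 := v)) (rename_form f p) \<and> sat M (e(0 := u, 1 := v')) (rename_form f p) \<longrightarrow> v = v'"
      using assms(3) R el_in_U by blast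
    ultimately show ?thesis unfolding replacement_def using e assms(2) by blast
  qed
  moreover have "{v \<in> U. \<exists>u \<in> el x. sat M (e(0 := u, 1 := v)) (rename_form f p)} =
      {v \<in> U. \<exists>u \<in> el x. R u v}"
    using R el_in_U by blast
  ultimately show ?thesis by simp
qed

section \<open>Automorphisms of \<open>M\<close> and invariance of definable predicates\<close>

definition automorphism :: "('a \<Rightarrow> 'a) \<Rightarrow> bool" where
  "automorphism h \<longleftrightarrow> bij_betw h U U \<and> (\<forall>x \<in> U. \<forall>y \<in> U. mem M (h x) (h y) = mem M x y) \<and>
     (\<forall>x \<in> U. atom M (h x) = atom M x)"

lemma sat_automorphism:
  assumes h: "automorphism h"
  shows "range e \<subseteq> U \<Longrightarrow> sat M (h \<circ> e) p = sat M e p"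
proof (induction p arbitrary: e)
  case (Eq i j)
  then have "e i \<in> U" "e j \<in> U" by auto
  then show ?case using h by (auto simp: automorphism_def bij_betw_def inj_on_def)
next
  case (Mem i j)
  then have "e i \<in> U" "e j \<in> U" by auto
  then show ?case using h by (auto simp: automorphism_def)
next
  case (Atom i)
  then have "e i \<in> U" by auto
  then show ?case using h by (auto simp: automorphism_def)
next
  case (All i p)
  have U: "U = h ` U" using h by (auto simp: automorphism_def bij_betw_def)
  have "(\<forall>x\<in>U. sat M ((h \<circ> e)(i := x)) p) \<longleftrightarrow> (\<forall>x\<in>U. sat M ((h \<circ> e)(i := h x)) p)"
    by (subst U) simp
  also have "\<dots> \<longleftrightarrow> (\<forall>x\<in>U. sat M (h \<circ> e(i := x)) p)"
    by (simp only: fun_upd_comp)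
  also have "\<dots> \<longleftrightarrow> (\<forall>x\<in>U. sat M (e(i := x)) p)"
    using All by (intro ball_cong refl All.IH) auto
  finally show ?case by (simp only: sat.simps)
qed auto

lemma automorphism_in_U [simp]: "automorphism h \<Longrightarrow> x \<in> U \<Longrightarrow> h x \<in> U"
  by (auto simp: automorphism_def bij_betw_def)

lemma automorphism_inj: "automorphism h \<Longrightarrow> x \<in> U \<Longrightarrow> y \<in> U \<Longrightarrow> h x = h y \<longleftrightarrow> x = y"
  by (metis automorphism_def bij_betw_def inj_on_eq_iff)

lemma automorphism_el:
  assumes "automorphism h" "x \<in> U" shows "el (h x) = h ` el x"
proof -
  have mem: "mem M (h y) (h x) = mem M y x" if "y \<in> U" for y
    using assms that unfolding automorphism_def by blast
  have U: "h ` U = U"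
    using assms unfolding automorphism_def bij_betw_def by blast
  show ?thesis
  proof (intro Set.set_eqI iffI)
    fix y assume y: "y \<in> el (h x)"
    then obtain z where "z \<in> U" "y = h z"
      using U el_in_U[OF y] by blast
    then show "y \<in> h ` el x"
      using mem[of z] y unfolding elems_def by blast
  next
    fix y assume "y \<in> h ` el x"
    then show "y \<in> el (h x)"
      using mem U unfolding elems_def by blast
  qed
qed

lemma automorphism_is_set: "automorphism h \<Longrightarrow> x \<in> U \<Longrightarrow> is_set M (h x) \<longleftrightarrow> is_set M x"
  using automorphism_in_U[of h x] by (auto simp: is_set_def automorphism_def)

lemma automorphism_is_empty: "automorphism h \<Longrightarrow> is_empty M z \<Longrightarrow> h z = z"
  by (rule ext_set) (simp_all add: is_empty_def automorphism_is_set automorphism_el is_set_in_U)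

lemma automorphism_Df:
  assumes "Df K P" "automorphism h" "\<And>k. k \<in> K \<Longrightarrow> k \<in> U \<Longrightarrow> h k = k" "range e \<subseteq> U"
  shows "P (h \<circ> e) = P e"
proof -
  obtain p c where c: "range c \<subseteq> U \<inter> (K \<union> {z. is_empty M z})"
    and p: "\<And>e. range e \<subseteq> U \<Longrightarrow> P e = sat M (interleave e c) p"
    using assms(1) unfolding Df_def by metis
  have "h (c i) = c i" for i
    using c assms(2,3) automorphism_is_empty by blast
  then have "interleave (h \<circ> e) c = h \<circ> interleave e c"
    by (auto simp: fun_eq_iff interleave_def)
  moreover have "range (interleave e c) \<subseteq> U"
    using c assms(4) by (auto simp: interleave_def)
  moreover have "range (h \<circ> e) \<subseteq> U"
    using assms(2,4) by auto
  ultimately show ?thesis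
    using p[of e] p[of "h \<circ> e"] assms(2,4) by (simp add: sat_automorphism)
qed

lemma automorphism_Df1:
  assumes "Df K (\<lambda>e. P (e 0))" "automorphism h" "\<And>k. k \<in> K \<Longrightarrow> k \<in> U \<Longrightarrow> h k = k" "x \<in> U"
  shows "P (h x) = P x"
  using automorphism_Df[OF assms(1-3), of "\<lambda>_. x"] assms(4) by auto


declare el_in_U [simp] is_set_in_U [simp]

section \<open>Internal sets and relations\<close>

lemma Df_subst1:
  assumes "Df K (\<lambda>e. P (e 0))" "Dt K t"
  shows "Df K (\<lambda>e. P (t e))"
proof (rule Df_cong)
  show "Df K (\<lambda>e. \<exists>x \<in> U. x = t e \<and> P x)"
    by (rule assms Df_logic Dt_var Dt_shift)+
qed (use Dt_in_U[OF assms(2)] in blast)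

lemma Df_subst2:
  assumes "Df K (\<lambda>e. P (e 0) (e 1))" "Dt K t" "Dt K u"
  shows "Df K (\<lambda>e. P (t e) (u e))"
proof (rule Df_cong)
  \<comment> \<open>The quantifier over \<open>y\<close> is the outer one, so that under both
    binders \<open>x\<close> is \<open>e 0\<close> and \<open>y\<close> is \<open>e 1\<close>, as in
    the assumption.\<close>
  show "Df K (\<lambda>e. \<exists>y \<in> U. \<exists>x \<in> U. x = t e \<and> y = u e \<and> P x y)"
    by (rule assms assms(1)[simplified] Df_logic Dt_var Dt_shift)+
qed (use Dt_in_U[OF assms(2)] Dt_in_U[OF assms(3)] in blast)

text \<open>Extensions of sets of \<open>M\<close> are handled as HOL sets, where ordinary set
  reasoning applies; \<open>mk\<close> leads back to the unique set of \<open>M\<close> with the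
  given extension.\<close>

definition internal :: "'a set \<Rightarrow> bool" where
  "internal S \<longleftrightarrow> (\<exists>x. is_set M x \<and> el x = S)"

definition mk :: "'a set \<Rightarrow> 'a" where
  "mk S = (THE x. is_set M x \<and> el x = S)"

lemma mk:
  assumes "internal S"
  shows is_set_mk [simp]: "is_set M (mk S)" and el_mk [simp]: "el (mk S) = S"
proof -
  have "\<exists>!x. is_set M x \<and> el x = S"
    using assms ext_set unfolding internal_def by blast
  from theI'[OF this] show "is_set M (mk S)" "el (mk S) = S"
    unfolding mk_def by blast+
qed

lemma mk_in_U [simp]: "internal S \<Longrightarrow> mk S \<in> U"
  by simp

lemma mk_el [simp]: "is_set M x \<Longrightarrow> mk (el x) = x"
  using mk[of "el x"] ext_set[of "mk (el x)" x] unfolding internal_def by blast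

lemma mk_eqI: "is_set M x \<Longrightarrow> el x = S \<Longrightarrow> mk S = x"
  by auto

lemma mk_inj: "internal S \<Longrightarrow> internal T \<Longrightarrow> mk S = mk T \<longleftrightarrow> S = T"
  by (metis el_mk)

lemma internal_subset_U: "internal S \<Longrightarrow> S \<subseteq> U"
  by (auto simp: internal_def)

lemma internal_empty [simp]: "internal {}"
  using is_empty_ex by (auto simp: internal_def is_empty_def)

text \<open>This includes atoms, whose extension is empty. For an atom \<open>x\<close>, however,
  \<open>mk (el x)\<close> is the empty set and not \<open>x\<close>; hence \<open>is_set\<close> is
  assumed in \<open>mk_el\<close>.\<close>

lemma internal_el [simp]: "x \<in> U \<Longrightarrow> internal (el x)"
  using el_atom[of x] internal_empty is_set_def[of M x] unfolding internal_def by metis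

lemma internal_upair [simp]: "x \<in> U \<Longrightarrow> y \<in> U \<Longrightarrow> internal {x, y}"
  using zfa_model by (auto simp: zfa_model_def pairing_def is_upair_def internal_def)

lemma internal_singleton [simp]: "x \<in> U \<Longrightarrow> internal {x}"
  using internal_upair[of x x] by simp

lemma internal_UN:
  assumes "internal S" shows "internal (\<Union>x \<in> S. el x)"
proof -
  have "union_axiom M" using zfa_model by (simp add: zfa_model_def)
  then show ?thesis using assms unfolding union_axiom_def internal_def by blast
qed

lemma internal_Un [simp]:
  assumes "internal S" "internal T" shows "internal (S \<union> T)"
  using internal_UN[of "{mk S, mk T}"] assms by simp

lemma internal_insert [simp]: "internal S \<Longrightarrow> x \<in> U \<Longrightarrow> internal (insert x S)"
  using internal_Un[of "{x}" S] by simp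

lemma internal_Pow:
  assumes "internal S" shows "internal {z. is_set M z \<and> el z \<subseteq> S}"
proof -
  have "power_set_axiom M" using zfa_model by (simp add: zfa_model_def)
  then show ?thesis using assms unfolding power_set_axiom_def internal_def by blast
qed

lemma internal_sep:
  assumes "Df K (\<lambda>e. P (e 0))" "internal S"
  shows "internal {z \<in> S. P z}"
  using separation_Df[OF assms(1) is_set_mk[OF assms(2)]] assms(2)
  by (auto simp: internal_def)

lemma internal_sepI:
  assumes "Df K (\<lambda>e. e 0 \<in> T)" "internal S" "T \<subseteq> S"
  shows "internal T"
proof -
  have "T = {z \<in> S. z \<in> T}" using assms(3) by blast
  then show ?thesis using internal_sep[OF assms(1,2)] by simp
qed

lemma internal_repl:
  assumes "Df K (\<lambda>e. R (e 0) (e 1))" "internal S"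
    and "\<And>u v v'. u \<in> S \<Longrightarrow> v \<in> U \<Longrightarrow> v' \<in> U \<Longrightarrow> R u v \<Longrightarrow> R u v' \<Longrightarrow> v = v'"
  shows "internal {v \<in> U. \<exists>u \<in> S. R u v}"
  using replacement_Df[OF assms(1) is_set_mk[OF assms(2)]] assms(2,3)
  by (simp add: internal_def)

lemma Df_internal: "internal S \<Longrightarrow> Df U (\<lambda>e. e 0 \<in> S)"
  using Df_in_el[OF Dt_var Dt_const[of "mk S" U]] by simp

lemma Df_mono: "Df K P \<Longrightarrow> K \<inter> U \<subseteq> L \<Longrightarrow> Df L P"
proof -
  assume "Df K P" and K: "K \<inter> U \<subseteq> L"
  then obtain p c where "range c \<subseteq> U \<inter> (K \<union> {z. is_empty M z})"
    "\<forall>e. range e \<subseteq> U \<longrightarrow> P e = sat M (interleave e c) p"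
    unfolding Df_def by blast
  moreover from this(1) have "range c \<subseteq> U \<inter> (L \<union> {z. is_empty M z})" using K by blast
  ultimately show "Df L P" unfolding Df_def by blast
qed

text \<open>\<open>Df U\<close> allows arbitrary parameters, which suffices for separation,
  replacement and induction. A smaller parameter set is tracked only where invariance under
  permutations is to be concluded.\<close>

lemma Df_to_U: "Df K P \<Longrightarrow> Df U P"
  by (rule Df_mono) auto

lemma internal_Diff [simp]:
  assumes "internal S" "internal T" shows "internal (S - T)"
  using internal_sep[OF Df_not[OF Df_internal[OF assms(2)]] assms(1)]
  by (simp add: set_diff_eq)

lemma internal_Int [simp]:
  assumes "internal S" "internal T" shows "internal (S \<inter> T)"
  using internal_sep[OF Df_internal[OF assms(2)] assms(1)]
  by (simp add: Int_def)


section \<open>Kuratowski pairs and relations of \<open>M\<close>\<close>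

definition Pr :: "'a \<Rightarrow> 'a \<Rightarrow> 'a" where
  "Pr x y = mk {mk {x}, mk {x, y}}"

lemma Pr_is_set [simp]: "x \<in> U \<Longrightarrow> y \<in> U \<Longrightarrow> is_set M (Pr x y)"
  and Pr_in_U [simp]: "x \<in> U \<Longrightarrow> y \<in> U \<Longrightarrow> Pr x y \<in> U"
  and el_Pr: "x \<in> U \<Longrightarrow> y \<in> U \<Longrightarrow> el (Pr x y) = {mk {x}, mk {x, y}}"
  by (simp_all add: Pr_def)

lemma Pr_inj:
  assumes "x \<in> U" "y \<in> U" "x' \<in> U" "y' \<in> U"
  shows "Pr x y = Pr x' y' \<longleftrightarrow> x = x' \<and> y = y'"
proof
  assume "Pr x y = Pr x' y'"
  then have "{mk {x}, mk {x, y}} = {mk {x'}, mk {x', y'}}"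
    using assms by (metis el_Pr)
  then have "(mk {x} = mk {x'} \<and> mk {x, y} = mk {x', y'}) \<or> (mk {x} = mk {x', y'} \<and> mk {x, y} = mk {x'})"
    by (simp add: doubleton_eq_iff)
  moreover have "mk {x} = mk {x'} \<longleftrightarrow> {x} = {x'}" "mk {x, y} = mk {x', y'} \<longleftrightarrow> {x, y} = {x', y'}"
    "mk {x} = mk {x', y'} \<longleftrightarrow> {x} = {x', y'}" "mk {x, y} = mk {x'} \<longleftrightarrow> {x, y} = {x'}"
    using assms by (simp_all add: mk_inj)
  ultimately have "({x} = {x'} \<and> {x, y} = {x', y'}) \<or> ({x} = {x', y'} \<and> {x, y} = {x'})"
    by (simp only:)
  then show "x = x' \<and> y = y'"
  proof
    assume *: "{x} = {x'} \<and> {x, y} = {x', y'}"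
    then have "x = x'" by blast
    with * show ?thesis unfolding doubleton_eq_iff by blast
  next
    assume "{x} = {x', y'} \<and> {x, y} = {x'}"
    then have "x' \<in> {x}" "y' \<in> {x}" "y \<in> {x'}" by blast+
    then show ?thesis by blast
  qed
qed auto

lemma is_upair_iff: "is_upair M x y z \<longleftrightarrow> x \<in> U \<and> y \<in> U \<and> z = mk {x, y}"
proof
  assume z: "is_upair M x y z"
  then have "el z = {x, y}" by (simp add: is_upair_def)
  moreover from this have "x \<in> U" "y \<in> U" using el_subset_U[of z] by auto
  ultimately show "x \<in> U \<and> y \<in> U \<and> z = mk {x, y}"
    using z mk_el[of z] by (simp add: is_upair_def)
qed (simp add: is_upair_def)

lemma is_opair_iff: "is_opair M x y z \<longleftrightarrow> x \<in> U \<and> y \<in> U \<and> z = Pr x y"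
  by (auto simp: is_opair_def is_upair_iff Pr_def)

lemma rel_of_iff: "(x, y) \<in> rel_of M f \<longleftrightarrow> x \<in> U \<and> y \<in> U \<and> Pr x y \<in> el f"
  by (auto simp: rel_of_def is_opair_iff)

lemma rel_of_in_U: "(x, y) \<in> rel_of M f \<Longrightarrow> x \<in> U" "(x, y) \<in> rel_of M f \<Longrightarrow> y \<in> U"
  by (auto simp: rel_of_iff)

lemma Df_is_upair:
  assumes "Dt K t" "Dt K u" "Dt K v" shows "Df K (\<lambda>e. is_upair M (t e) (u e) (v e))"
proof (rule Df_cong)
  show "Df K (\<lambda>e. is_set M (v e) \<and> (\<forall>x \<in> U. x \<in> el (v e) \<longleftrightarrow> x = t e \<or> x = u e))"
    by (rule assms Df_logic Dt_var Dt_shift)+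
  fix e :: "nat \<Rightarrow> 'a" assume "range e \<subseteq> U"
  then have "t e \<in> U" "u e \<in> U" using assms Dt_in_U by blast+
  then show "is_upair M (t e) (u e) (v e) \<longleftrightarrow>
      is_set M (v e) \<and> (\<forall>x \<in> U. x \<in> el (v e) \<longleftrightarrow> x = t e \<or> x = u e)"
    by (auto simp: is_upair_def)
qed

lemma Df_is_opair:
  assumes "Dt K t" "Dt K u" "Dt K v" shows "Df K (\<lambda>e. is_opair M (t e) (u e) (v e))"
proof (rule Df_cong)
  show "Df K (\<lambda>e. \<exists>x \<in> U. \<exists>y \<in> U. is_upair M (t e) (t e) x \<and> is_upair M (t e) (u e) y \<and> is_upair M x y (v e))"
    by (rule assms Df_is_upair Df_logic Dt_var Dt_shift)+
qed (auto simp: is_opair_def is_upair_iff)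

lemma Df_Pr_eq:
  assumes "Dt K t" "Dt K u" "Dt K v" shows "Df K (\<lambda>e. v e = Pr (t e) (u e))"
  by (rule Df_cong[OF Df_is_opair[OF assms]]) (use assms Dt_in_U in \<open>simp add: is_opair_iff\<close>)

lemma Df_rel_of:
  assumes "Dt K t" "Dt K u" "Dt K v" shows "Df K (\<lambda>e. (t e, u e) \<in> rel_of M (v e))"
proof (rule Df_cong)
  show "Df K (\<lambda>e. \<exists>p \<in> el (v e). is_opair M (t e) (u e) p)"
    by (rule assms Df_is_opair Df_logic Dt_var Dt_shift)+
  fix e :: "nat \<Rightarrow> 'a" assume "range e \<subseteq> U"
  then have "t e \<in> U" "u e \<in> U" using assms Dt_in_U by blast+
  then show "((t e, u e) \<in> rel_of M (v e)) = (\<exists>p \<in> el (v e). is_opair M (t e) (u e) p)"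
    by (auto simp: rel_of_def)
qed

lemmas Df_pairs = Df_is_upair Df_is_opair Df_Pr_eq Df_rel_of


definition codes :: "('a \<times> 'a) set \<Rightarrow> 'a set" where
  "codes R = (\<lambda>(x, y). Pr x y) ` R"

definition irel :: "('a \<times> 'a) set \<Rightarrow> bool" where
  "irel R \<longleftrightarrow> R \<subseteq> U \<times> U \<and> internal (codes R)"

definition mkr :: "('a \<times> 'a) set \<Rightarrow> 'a" where
  "mkr R = mk (codes R)"

lemma codes_iff: "R \<subseteq> U \<times> U \<Longrightarrow> x \<in> U \<Longrightarrow> y \<in> U \<Longrightarrow> Pr x y \<in> codes R \<longleftrightarrow> (x, y) \<in> R"
  by (force simp: codes_def Pr_inj)

lemma rel_of_mkr [simp]: "irel R \<Longrightarrow> rel_of M (mkr R) = R"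
proof -
  assume "irel R"
  then have "el (mkr R) = codes R" "R \<subseteq> U \<times> U" by (simp_all add: irel_def mkr_def)
  then show ?thesis using codes_iff[of R] unfolding set_eq_iff rel_of_iff split_paired_All by blast
qed

lemma is_set_mkr [simp]: "irel R \<Longrightarrow> is_set M (mkr R)"
  and mkr_in_U [simp]: "irel R \<Longrightarrow> mkr R \<in> U"
  and el_mkr: "irel R \<Longrightarrow> el (mkr R) = codes R"
  by (simp_all add: irel_def mkr_def)

lemma irel_sep:
  assumes R: "Df K (\<lambda>e. (e 0, e 1) \<in> R)" and "internal S" "internal T" "R \<subseteq> S \<times> T"
  shows "irel R"
proof -
  have sub: "S \<subseteq> U" "T \<subseteq> U" using assms internal_subset_U by blast+
  \<comment> \<open>A Kuratowski pair over \<open>S\<close> and \<open>T\<close> is a set of subsets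
    of \<open>S \<union> T\<close>, so the codes are separated from a double power set.\<close>
  let ?B = "{z. is_set M z \<and> el z \<subseteq> {z. is_set M z \<and> el z \<subseteq> S \<union> T}}"
  have B: "internal ?B" using assms by (intro internal_Pow internal_Un)
  have D: "Df K (\<lambda>e. \<exists>x \<in> U. \<exists>y \<in> U. is_opair M x y (e 0) \<and> (x, y) \<in> R)"
    by (rule Df_subst2[of K "\<lambda>x y. (x, y) \<in> R", OF R] Df_pairs Df_logic Dt_var)+
  have "codes R = {z \<in> ?B. \<exists>x \<in> U. \<exists>y \<in> U. is_opair M x y z \<and> (x, y) \<in> R}"
  proof (intro Set.set_eqI iffI)
    fix z assume "z \<in> codes R"
    then obtain x y where "(x, y) \<in> R" "z = Pr x y" by (auto simp: codes_def)
    moreover from this have "x \<in> S" "y \<in> T" using assms(4) by auto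
    moreover from this have "x \<in> U" "y \<in> U" using sub by auto
    ultimately show "z \<in> {z \<in> ?B. \<exists>x \<in> U. \<exists>y \<in> U. is_opair M x y z \<and> (x, y) \<in> R}"
      by (auto simp: is_opair_iff el_Pr)
  next
    fix z assume "z \<in> {z \<in> ?B. \<exists>x \<in> U. \<exists>y \<in> U. is_opair M x y z \<and> (x, y) \<in> R}"
    then show "z \<in> codes R"
      by (auto simp: codes_def is_opair_iff)
  qed
  then show ?thesis
    using internal_sep[OF D B] sub assms(4) by (auto simp: irel_def)
qed

text \<open>\<open>rel_of M f\<close> forgets the elements of \<open>f\<close> that are not pairs;
  excluding such elements makes \<open>f\<close> recoverable from its relation.\<close>

definition is_rel :: "'a \<Rightarrow> bool" where
  "is_rel f \<longleftrightarrow> is_set M f \<and> (\<forall>p \<in> el f. \<exists>x \<in> U. \<exists>y \<in> U. p = Pr x y)"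

lemma is_rel_codes: "is_rel f \<Longrightarrow> codes (rel_of M f) = el f"
  by (force simp: is_rel_def codes_def rel_of_iff)

lemma irel_rel_of: "is_rel f \<Longrightarrow> irel (rel_of M f)"
  using is_rel_codes[of f] by (auto simp: irel_def rel_of_iff is_rel_def)

lemma is_rel_mkr [simp]: "irel R \<Longrightarrow> is_rel (mkr R)"
  by (force simp: is_rel_def el_mkr codes_def irel_def mkr_def)

lemma Df_irel: "irel R \<Longrightarrow> Df U (\<lambda>e. (e 0, e 1) \<in> R)"
  using Df_rel_of[OF Dt_var Dt_var Dt_const[of "mkr R" U], of 0 1] by simp

lemma internal_Domain_Range:
  assumes "irel R" shows "internal (Domain R)" "internal (Range R)"
proof -
  \<comment> \<open>Two unions reduce a set of Kuratowski pairs to the components of the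
    pairs.\<close>
  let ?S = "\<Union>y \<in> (\<Union>x \<in> codes R. el x). el y"
  have S: "internal ?S"
  proof -
    have "internal (codes R)" using assms unfolding irel_def by blast
    from internal_UN[OF internal_UN[OF this]] show ?thesis .
  qed
  have RU: "R \<subseteq> U \<times> U" using assms by (simp add: irel_def)
  then have *: "Domain R \<subseteq> ?S" "Range R \<subseteq> ?S"
    by (force simp: codes_def el_Pr)+
  have "Df U (\<lambda>e. \<exists>y \<in> U. (e 0, y) \<in> R)" "Df U (\<lambda>e. \<exists>y \<in> U. (y, e 0) \<in> R)"
    by (rule Df_subst2[of U "\<lambda>x y. (x, y) \<in> R", OF Df_irel] assms Df_logic Dt_var)+
  from this[THEN internal_sep[OF _ S]]
  have "internal {x \<in> ?S. \<exists>y \<in> U. (x, y) \<in> R}" "internal {x \<in> ?S. \<exists>y \<in> U. (y, x) \<in> R}" .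
  moreover have "{x \<in> ?S. \<exists>y \<in> U. (x, y) \<in> R} = Domain R" "{x \<in> ?S. \<exists>y \<in> U. (y, x) \<in> R} = Range R"
    using * RU by blast+
  ultimately show "internal (Domain R)" "internal (Range R)" by simp_all
qed

definition bijrel :: "('a \<times> 'a) set \<Rightarrow> 'a set \<Rightarrow> 'a set \<Rightarrow> bool" where
  "bijrel R S T \<longleftrightarrow> R \<subseteq> S \<times> T \<and> (\<forall>x \<in> S. \<exists>!y. (x, y) \<in> R) \<and> (\<forall>y \<in> T. \<exists>!x. (x, y) \<in> R)"

lemma is_function_on_iff:
  "is_function_on M f X \<longleftrightarrow> is_rel f \<and> Domain (rel_of M f) \<subseteq> el X \<and> (\<forall>x \<in> el X. \<exists>!y. (x, y) \<in> rel_of M f)"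
proof -
  have "(\<forall>p \<in> el f. \<exists>x \<in> el X. \<exists>y \<in> U. p = Pr x y) \<longleftrightarrow>
    (\<forall>p \<in> el f. \<exists>x \<in> U. \<exists>y \<in> U. p = Pr x y) \<and> Domain (rel_of M f) \<subseteq> el X" (is "?l = ?r")
  proof
    assume l: ?l
    then have "x \<in> el X" if "(x, y) \<in> rel_of M f" for x y
      using that Pr_inj by (metis el_in_U rel_of_iff)
    then show ?r using l by (blast intro: el_in_U)
  next
    assume ?r
    then show ?l by (metis DomainI rel_of_iff subsetD)
  qed
  moreover have "(\<exists>x \<in> el X. \<exists>y \<in> U. is_opair M x y p) \<longleftrightarrow> (\<exists>x \<in> el X. \<exists>y \<in> U. p = Pr x y)" for p
    unfolding is_opair_iff using el_in_U by blast
  ultimately show ?thesis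
    unfolding is_function_on_def is_rel_def by auto
qed

lemma is_bijection_iff:
  "is_bijection M f X Y \<longleftrightarrow> is_rel f \<and> bijrel (rel_of M f) (el X) (el Y)"
  unfolding is_bijection_def is_function_on_iff bijrel_def by auto

lemma Df_is_rel: 
  assumes "Dt K t" shows "Df K (\<lambda>e. is_rel (t e))"
  unfolding is_rel_def by (rule assms Df_pairs Df_logic Dt_var Dt_shift)+

text \<open>Quantifiers over the whole HOL type are replaced by quantifiers over \<open>U\<close>,
  which can be expressed in formulas; members of \<open>rel_of M f\<close> lie in \<open>U\<close>
  anyway.\<close>

lemma ex1_rel_of:
  "(\<exists>!y. (x, y) \<in> rel_of M f) \<longleftrightarrow> (\<exists>y \<in> U. (x, y) \<in> rel_of M f \<and> (\<forall>z \<in> U. (x, z) \<in> rel_of M f \<longrightarrow> z = y))"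
  "(\<exists>!x. (x, y) \<in> rel_of M f) \<longleftrightarrow> (\<exists>x \<in> U. (x, y) \<in> rel_of M f \<and> (\<forall>z \<in> U. (z, y) \<in> rel_of M f \<longrightarrow> z = x))"
  unfolding Ex1_def by (meson rel_of_in_U)+

lemma all_rel_of:
  "(\<forall>x y. (x, y) \<in> rel_of M f \<longrightarrow> P x y) \<longleftrightarrow> (\<forall>x \<in> U. \<forall>y \<in> U. (x, y) \<in> rel_of M f \<longrightarrow> P x y)"
  by (meson rel_of_in_U)

lemma Domain_rel_of:
  "Domain (rel_of M f) \<subseteq> S \<longleftrightarrow> (\<forall>x \<in> U. \<forall>y \<in> U. (x, y) \<in> rel_of M f \<longrightarrow> x \<in> S)"
  unfolding all_rel_of[symmetric] by blast

lemma Df_is_function_on: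
  assumes "Dt K t" "Dt K u" shows "Df K (\<lambda>e. is_function_on M (t e) (u e))"
proof (rule Df_cong)
  show "Df K (\<lambda>e. is_rel (t e) \<and> (\<forall>x \<in> U. \<forall>y \<in> U. (x, y) \<in> rel_of M (t e) \<longrightarrow> x \<in> el (u e)) \<and>
    (\<forall>x \<in> el (u e). \<exists>y \<in> U. (x, y) \<in> rel_of M (t e) \<and> (\<forall>z \<in> U. (x, z) \<in> rel_of M (t e) \<longrightarrow> z = y)))"
    by (rule assms Df_pairs Df_is_rel Df_logic Dt_var Dt_shift)+
qed (simp only: is_function_on_iff Domain_rel_of ex1_rel_of)

lemma Df_is_bijection:
  assumes "Dt K t" "Dt K u" "Dt K v" shows "Df K (\<lambda>e. is_bijection M (t e) (u e) (v e))"
proof (rule Df_cong)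
  show "Df K (\<lambda>e. is_function_on M (t e) (u e) \<and>
    (\<forall>x \<in> U. \<forall>y \<in> U. (x, y) \<in> rel_of M (t e) \<longrightarrow> y \<in> el (v e)) \<and>
    (\<forall>x \<in> el (v e). \<exists>y \<in> U. (y, x) \<in> rel_of M (t e) \<and> (\<forall>z \<in> U. (z, x) \<in> rel_of M (t e) \<longrightarrow> z = y)))"
    by (rule assms Df_pairs Df_is_function_on Df_logic Dt_var Dt_shift)+
qed (simp only: is_bijection_def ex1_rel_of all_rel_of)

lemma Df_equipotent:
  assumes "Dt K t" "Dt K u" shows "Df K (\<lambda>e. equipotent M (t e) (u e))"
proof (rule Df_cong)
  show "Df K (\<lambda>e. \<exists>f \<in> U. is_bijection M f (t e) (u e))"
    by (rule assms Df_is_bijection Df_logic Dt_var Dt_shift)+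
qed (auto simp: equipotent_def is_bijection_iff is_rel_def)

lemmas Df_funs = Df_is_rel Df_is_function_on Df_is_bijection Df_equipotent

definition eqp :: "'a set \<Rightarrow> 'a set \<Rightarrow> bool" where
  "eqp S T \<longleftrightarrow> (\<exists>R. irel R \<and> bijrel R S T)"

lemma equipotent_iff: "equipotent M X Y \<longleftrightarrow> eqp (el X) (el Y)"
  unfolding equipotent_def eqp_def is_bijection_iff
  by (metis irel_rel_of is_rel_mkr rel_of_mkr)


section \<open>Natural numbers\<close>

definition emp :: 'a where "emp = mk {}"

definition sc :: "'a \<Rightarrow> 'a" where "sc x = mk (insert x (el x))"

definition om :: 'a where "om = (THE w. is_omega M w)"

lemma emp [simp]: "is_set M emp" "el emp = {}" "emp \<in> U"
  by (simp_all add: emp_def)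

lemma sc [simp]: "x \<in> U \<Longrightarrow> is_set M (sc x)" "x \<in> U \<Longrightarrow> el (sc x) = insert x (el x)"
  "x \<in> U \<Longrightarrow> sc x \<in> U"
  by (simp_all add: sc_def)

lemma is_empty_iff: "is_empty M z \<longleftrightarrow> z = emp"
  unfolding is_empty_def using ext_set emp by metis

lemma is_succ_iff: "x \<in> U \<Longrightarrow> is_succ M x y \<longleftrightarrow> y = sc x"
  unfolding is_succ_def using ext_set sc by metis

lemma is_inductive_iff:
  "is_inductive M x \<longleftrightarrow> is_set M x \<and> emp \<in> el x \<and> (\<forall>y \<in> el x. sc y \<in> el x)"
  by (auto simp: is_inductive_def is_empty_iff is_succ_iff)

lemma Df_eq_emp:
  assumes "Dt K t" shows "Df K (\<lambda>e. t e = emp)"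
proof (rule Df_cong)
  show "Df K (\<lambda>e. is_set M (t e) \<and> (\<forall>x \<in> U. x \<notin> el (t e)))"
    by (rule assms Df_logic Dt_var Dt_shift)+
  show "t e = emp \<longleftrightarrow> is_set M (t e) \<and> (\<forall>x \<in> U. x \<notin> el (t e))" for e
    using is_empty_iff[of "t e"] el_subset_U[of "t e"] unfolding is_empty_def by blast
qed

lemma Df_eq_sc:
  assumes "Dt K t" "Dt K u" shows "Df K (\<lambda>e. u e = sc (t e))"
proof (rule Df_cong)
  show "Df K (\<lambda>e. is_set M (u e) \<and> (\<forall>x \<in> U. x \<in> el (u e) \<longleftrightarrow> x = t e \<or> x \<in> el (t e)))"
    by (rule assms Df_logic Dt_var Dt_shift)+
  show "u e = sc (t e) \<longleftrightarrow> is_set M (u e) \<and> (\<forall>x \<in> U. x \<in> el (u e) \<longleftrightarrow> x = t e \<or> x \<in> el (t e))"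
    if "range e \<subseteq> U" for e
  proof -
    have t: "t e \<in> U" using Dt_in_U[OF assms(1) that] .
    have "u e = sc (t e) \<longleftrightarrow> is_set M (u e) \<and> el (u e) = insert (t e) (el (t e))"
      using is_succ_iff[OF t, of "u e"] by (simp add: is_succ_def)
    then show ?thesis using t el_subset_U[of "t e"] el_subset_U[of "u e"] by blast
  qed
qed

lemma Df_is_inductive:
  assumes "Dt K t" shows "Df K (\<lambda>e. is_inductive M (t e))"
proof (rule Df_cong)
  show "Df K (\<lambda>e. is_set M (t e) \<and> (\<exists>x \<in> el (t e). x = emp) \<and> (\<forall>y \<in> el (t e). \<exists>z \<in> el (t e). z = sc y))"
    by (rule assms Df_eq_emp Df_eq_sc Df_logic Dt_var Dt_shift)+
qed (simp add: is_inductive_iff)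

lemma is_omega_unique: "is_omega M v \<Longrightarrow> is_omega M w \<Longrightarrow> v = w"
  by (rule ext_set) (simp_all add: is_omega_def is_inductive_iff subset_antisym)

lemma is_omega_om: "is_omega M om"
proof -
  obtain x where x: "is_inductive M x"
    using zfa_model by (auto simp: zfa_model_def infinity_axiom_def)
  let ?S = "{n \<in> el x. \<forall>y \<in> U. is_inductive M y \<longrightarrow> n \<in> el y}"
  have "Df U (\<lambda>e. \<forall>y \<in> U. is_inductive M y \<longrightarrow> e 0 \<in> el y)"
    by (rule Df_is_inductive Df_logic Dt_var)+
  then have S: "internal ?S"
    by (rule internal_sep) (use x in \<open>simp add: is_inductive_iff\<close>)
  moreover have "is_inductive M (mk ?S)"
    using S x unfolding is_inductive_iff by auto
  ultimately have o: "is_omega M (mk ?S)"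
    unfolding is_omega_def by (auto simp: is_inductive_iff)
  have "mk ?S = om"
    unfolding om_def using o by (rule the_equality[symmetric]) (rule is_omega_unique[OF _ o])
  with o show ?thesis by simp
qed

lemma is_omega_iff: "is_omega M w \<longleftrightarrow> w = om"
  using is_omega_om is_omega_unique by blast

lemma om_simps [simp]: "is_set M om" "om \<in> U" "emp \<in> el om" "n \<in> el om \<Longrightarrow> sc n \<in> el om"
  using is_omega_om by (auto simp: is_omega_def is_inductive_iff)

lemma is_natural_iff: "is_natural M n \<longleftrightarrow> n \<in> el om"
  by (simp add: is_natural_def is_omega_iff)

text \<open>For definable \<open>P\<close> the set of numbers with \<open>P\<close> exists in
  \<open>M\<close> and is inductive, so the minimality of \<open>om\<close> applies. For other
  predicates this would fail when \<open>om\<close> is nonstandard.\<close>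

lemma om_induct [consumes 1, case_names Df emp sc]:
  assumes "n \<in> el om" "Df K (\<lambda>e. P (e 0))" "P emp" "\<And>k. k \<in> el om \<Longrightarrow> P k \<Longrightarrow> P (sc k)"
  shows "P n"
proof -
  have S: "internal {n \<in> el om. P n}"
    using assms(2) by (rule internal_sep) simp
  have "is_inductive M (mk {n \<in> el om. P n})"
    using S assms(3,4) by (simp add: is_inductive_iff)
  then have "el om \<subseteq> {n \<in> el om. P n}"
    using is_omega_om S unfolding is_omega_def by (metis el_mk)
  then show ?thesis using assms(1) by blast
qed

lemma om_set: "n \<in> el om \<Longrightarrow> is_set M n"
proof (induction rule: om_induct)
  show "Df U (\<lambda>e. is_set M (e 0))" by (rule Df_logic Dt_var)+
qed simp_all

lemma om_trans: "n \<in> el om \<Longrightarrow> k \<in> el n \<Longrightarrow> el k \<subseteq> el n"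
proof -
  assume "n \<in> el om"
  then have "\<forall>k \<in> el n. el k \<subseteq> el n"
  proof (induction rule: om_induct)
    show "Df U (\<lambda>e. \<forall>k \<in> el (e 0). el k \<subseteq> el (e 0))" by (rule Df_logic Dt_var)+
  qed auto
  then show "k \<in> el n \<Longrightarrow> el k \<subseteq> el n" by blast
qed

lemma om_el_subset: "n \<in> el om \<Longrightarrow> el n \<subseteq> el om"
proof (induction rule: om_induct)
  show "Df U (\<lambda>e. el (e 0) \<subseteq> el om)" by (rule Df_logic Dt_var Dt_const | simp)+
qed simp_all

lemma om_irrefl: "n \<in> el om \<Longrightarrow> n \<notin> el n"
proof (induction rule: om_induct)
  show "Df U (\<lambda>e. e 0 \<notin> el (e 0))" by (rule Df_logic Dt_var)+
next
  fix k assume k: "k \<in> el om" "k \<notin> el k"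
  have "sc k \<noteq> k" using k(2) sc(2)[of k] k(1) by (metis el_in_U insertI1)
  moreover have "sc k \<notin> el k" using om_trans[OF k(1), of "sc k"] k by auto
  ultimately show "sc k \<notin> el (sc k)" using k(1) by simp
qed simp

lemma om_linear:
  assumes "n \<in> el om" "m \<in> el om" shows "n \<in> el m \<or> n = m \<or> m \<in> el n"
proof -
  have zero: "emp = k \<or> emp \<in> el k" if "k \<in> el om" for k
    using that
  proof (induction rule: om_induct)
    show "Df U (\<lambda>e. emp = e 0 \<or> emp \<in> el (e 0))"
      by (rule Df_logic Dt_var Dt_const | simp)+
  qed auto
  \<comment> \<open>A successor of something below \<open>sc m\<close> is at most
    \<open>sc m\<close>. Inside the induction \<open>sc n\<close> is replaced by a witness
    \<open>n'\<close>, because the calculus knows \<open>sc\<close> only through its graph.\<close>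
  have suc: "sc n = sc m \<or> sc n \<in> el (sc m)" if "m \<in> el om" "n \<in> el (sc m)" for n m
  proof -
    have "\<forall>n \<in> U. n \<in> el m \<or> n = m \<longrightarrow> (\<exists>n' \<in> U. n' = sc n \<and> (n' \<in> el m \<or> n' = m \<or> n' = sc m))"
      using that(1)
    proof (induction rule: om_induct)
      show "Df U (\<lambda>e. \<forall>n \<in> U. n \<in> el (e 0) \<or> n = e 0 \<longrightarrow>
          (\<exists>n' \<in> U. n' = sc n \<and> (n' \<in> el (e 0) \<or> n' = e 0 \<or> n' = sc (e 0))))"
        by (rule Df_eq_sc Df_logic Dt_var)+
    qed auto
    then show ?thesis using that by auto
  qed
  show ?thesis
    using assms(1)
  proof (induction rule: om_induct)
    show "Df U (\<lambda>e. e 0 \<in> el m \<or> e 0 = m \<or> m \<in> el (e 0))"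
      by (rule Df_logic Dt_var Dt_const el_in_U[OF assms(2)])+
  next
    show "emp \<in> el m \<or> emp = m \<or> m \<in> el emp" using zero[OF assms(2)] by auto
  next
    fix k assume k: "k \<in> el om" and IH: "k \<in> el m \<or> k = m \<or> m \<in> el k"
    then consider "k \<in> el m" | "m \<in> el (sc k)" by auto
    then show "sc k \<in> el m \<or> sc k = m \<or> m \<in> el (sc k)"
    proof cases
      case 1
      have "sc k \<in> el m \<or> sc k = m"
      proof -
        have "m \<in> el om \<Longrightarrow> k \<in> el m \<Longrightarrow> sc k \<in> el m \<or> sc k = m"
        proof (induction rule: om_induct)
          show "Df U (\<lambda>e. k \<in> el (e 0) \<longrightarrow> sc k \<in> el (e 0) \<or> sc k = e 0)"
            by (rule Df_logic Dt_var Dt_const el_in_U[OF k] sc(3))+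
        next
          fix j assume "j \<in> el om" "k \<in> el (sc j)"
          then show "sc k \<in> el (sc j) \<or> sc k = sc j"
            using suc[of j k] by auto
        qed auto
        then show ?thesis using assms(2) 1 by blast
      qed
      then show ?thesis by blast
    qed auto
  qed
qed


section \<open>Finite sets\<close>

lemma bijrelI:
  assumes "R \<subseteq> S \<times> T" "\<And>x. x \<in> S \<Longrightarrow> \<exists>y. (x, y) \<in> R" "\<And>y. y \<in> T \<Longrightarrow> \<exists>x. (x, y) \<in> R"
    "\<And>x y y'. (x, y) \<in> R \<Longrightarrow> (x, y') \<in> R \<Longrightarrow> y = y'" "\<And>x x' y. (x, y) \<in> R \<Longrightarrow> (x', y) \<in> R \<Longrightarrow> x = x'"
  shows "bijrel R S T"
  unfolding bijrel_def using assms by metis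

lemma bijrelD:
  assumes "bijrel R S T"
  shows "R \<subseteq> S \<times> T" "x \<in> S \<Longrightarrow> \<exists>y. (x, y) \<in> R" "y \<in> T \<Longrightarrow> \<exists>x. (x, y) \<in> R"
    "(x, y) \<in> R \<Longrightarrow> (x, y') \<in> R \<Longrightarrow> y = y'" "(x, y) \<in> R \<Longrightarrow> (x', y) \<in> R \<Longrightarrow> x = x'"
  using assms unfolding bijrel_def by blast+

lemma irel_sep2:
  assumes "internal S" "internal T" "Df K (\<lambda>e. P (e 0) (e 1))"
  shows "irel {(x, y). x \<in> S \<and> y \<in> T \<and> P x y}"
proof -
  have "Df U (\<lambda>e. e 0 \<in> el (mk S) \<and> e 1 \<in> el (mk T) \<and> P (e 0) (e 1))"
    by (rule Df_logic Df_to_U[OF assms(3)] Dt_var Dt_const | simp add: assms)+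
  then have "Df U (\<lambda>e. (e 0, e 1) \<in> {(x, y). x \<in> S \<and> y \<in> T \<and> P x y})"
    using assms by simp
  from irel_sep[OF this assms(1,2)] show ?thesis by blast
qed

lemma irel_Times:
  assumes "internal S" "internal T" shows "irel (S \<times> T)"
proof -
  have "Df U (\<lambda>e. e 0 = e 0 \<and> e 1 = e 1)" by (rule Df_logic Dt_var)+
  from irel_sep2[OF assms this] have "irel {(x, y). x \<in> S \<and> y \<in> T}" by simp
  moreover have "{(x, y). x \<in> S \<and> y \<in> T} = S \<times> T" by auto
  ultimately show ?thesis by simp
qed

lemma Df_irel_mem: "irel R \<Longrightarrow> Dt U t \<Longrightarrow> Dt U u \<Longrightarrow> Df U (\<lambda>e. (t e, u e) \<in> R)"
  using Df_subst2[OF Df_irel] by blast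

lemma Df_internal_mem: "internal S \<Longrightarrow> Dt U t \<Longrightarrow> Df U (\<lambda>e. t e \<in> S)"
  using Df_subst1[OF Df_internal] by blast

lemma irel_in_U: "irel R \<Longrightarrow> (x, y) \<in> R \<Longrightarrow> x \<in> U" "irel R \<Longrightarrow> (x, y) \<in> R \<Longrightarrow> y \<in> U"
  by (auto simp: irel_def)

lemma irel_insert:
  assumes "irel R" "x \<in> U" "y \<in> U" shows "irel (insert (x, y) R)"
proof -
  have "codes (insert (x, y) R) = insert (Pr x y) (codes R)" by (simp add: codes_def)
  then show ?thesis using assms by (simp add: irel_def)
qed

lemma irel_Un: "irel R \<Longrightarrow> irel S \<Longrightarrow> irel (R \<union> S)"
  by (auto simp: irel_def codes_def image_Un)

lemma irel_sub:
  assumes "irel R" "Df K (\<lambda>e. P (e 0) (e 1))" shows "irel {(x, y). (x, y) \<in> R \<and> P x y}"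
proof -
  have "Df U (\<lambda>e. (e 0, e 1) \<in> R \<and> P (e 0) (e 1))"
    by (rule Df_conj Df_irel_mem assms Df_to_U[OF assms(2)] Dt_var)+
  from irel_sep2[OF internal_Domain_Range[OF assms(1)] this]
  have "irel {(x, y). x \<in> Domain R \<and> y \<in> Range R \<and> (x, y) \<in> R \<and> P x y}" .
  moreover have "{(x, y). x \<in> Domain R \<and> y \<in> Range R \<and> (x, y) \<in> R \<and> P x y} = {(x, y). (x, y) \<in> R \<and> P x y}"
    by auto
  ultimately show ?thesis by simp
qed

lemma irel_comp:
  assumes "irel R" "irel S" shows "irel (R O S)"
proof -
  have D: "Df U (\<lambda>e. \<exists>y \<in> U. (e 0, y) \<in> R \<and> (y, e 1) \<in> S)"
    by (rule Df_logic Df_irel_mem assms Dt_var)+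
  have "irel {(x, z). x \<in> Domain R \<and> z \<in> Range S \<and> (\<exists>y \<in> U. (x, y) \<in> R \<and> (y, z) \<in> S)}"
    by (rule irel_sep2[OF _ _ D]) (use assms internal_Domain_Range in auto)
  moreover have "{(x, z). x \<in> Domain R \<and> z \<in> Range S \<and> (\<exists>y \<in> U. (x, y) \<in> R \<and> (y, z) \<in> S)} = R O S"
    using irel_in_U[OF assms(1)] by blast
  ultimately show ?thesis by simp
qed

lemma irel_converse:
  assumes "irel R" shows "irel (R\<inverse>)"
proof -
  have D: "Df U (\<lambda>e. (e 1, e 0) \<in> R)"
    by (rule Df_irel_mem assms Dt_var)+
  have "irel {(x, y). x \<in> Range R \<and> y \<in> Domain R \<and> (y, x) \<in> R}"
    by (rule irel_sep2[OF _ _ D]) (use assms internal_Domain_Range in auto)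
  moreover have "{(x, y). x \<in> Range R \<and> y \<in> Domain R \<and> (y, x) \<in> R} = R\<inverse>"
    by blast
  ultimately show ?thesis by simp
qed

lemma bijrel_converse: "bijrel R S T \<Longrightarrow> bijrel (R\<inverse>) T S"
  by (auto simp: bijrel_def)

lemma eqp_sym: "eqp S T \<Longrightarrow> eqp T S"
  unfolding eqp_def using bijrel_converse irel_converse by blast

lemma eqp_trans:
  assumes "eqp S T" "eqp T V" shows "eqp S V"
proof -
  obtain R where R: "irel R" "bijrel R S T" using assms(1) unfolding eqp_def by blast
  obtain Q where Q: "irel Q" "bijrel Q T V" using assms(2) unfolding eqp_def by blast
  note r = bijrelD[OF R(2)] and q = bijrelD[OF Q(2)]
  have "bijrel (R O Q) S V"
  proof (rule bijrelI)
    show "R O Q \<subseteq> S \<times> V" using r(1) q(1) by blast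
    show "\<exists>y. (x, y) \<in> R O Q" if "x \<in> S" for x using r(1) r(2)[OF that] q(2) by blast
    show "\<exists>x. (x, y) \<in> R O Q" if "y \<in> V" for y using q(1) q(3)[OF that] r(3) by blast
    show "y = y'" if "(x, y) \<in> R O Q" "(x, y') \<in> R O Q" for x y y' using that r(4) q(4) by blast
    show "x = x'" if "(x, y) \<in> R O Q" "(x', y) \<in> R O Q" for x x' y using that r(5) q(5) by blast
  qed
  then show ?thesis using irel_comp[OF R(1) Q(1)] unfolding eqp_def by blast
qed

lemma eqp_refl: "internal S \<Longrightarrow> eqp S S"
proof -
  assume S: "internal S"
  have "Df U (\<lambda>e. e 0 = e 1)" by (rule Df_logic Dt_var)+
  from irel_sep2[OF S S this] have "irel {(x, y). x \<in> S \<and> y \<in> S \<and> x = y}" .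
  moreover have "bijrel {(x, y). x \<in> S \<and> y \<in> S \<and> x = y} S S" by (auto intro: bijrelI)
  ultimately show ?thesis unfolding eqp_def by blast
qed

text \<open>The size is an element of \<open>om\<close>, possibly nonstandard, so \<open>Fin\<close>
  is not the HOL predicate \<open>finite\<close> and its closure properties have to be derived
  inside \<open>M\<close>.\<close>

definition Fin :: "'a set \<Rightarrow> bool" where
  "Fin S \<longleftrightarrow> internal S \<and> (\<exists>n \<in> el om. eqp S (el n))"

lemma Fin_internal: "Fin S \<Longrightarrow> internal S"
  by (simp add: Fin_def)

lemma finite_in_iff: "finite_in M X \<longleftrightarrow> is_set M X \<and> Fin (el X)"
  unfolding finite_in_def Fin_def is_natural_iff equipotent_iff by auto

text \<open>Finiteness mentions \<open>om\<close>, which therefore becomes a parameter. Every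
  permutation fixes \<open>om\<close>, so definitions through finiteness remain invariant.\<close>

lemma Df_Fin_om:
  assumes "om \<in> K" "Dt K t" shows "Df K (\<lambda>e. Fin (el (t e)))"
proof (rule Df_cong)
  show "Df K (\<lambda>e. \<exists>n \<in> el om. equipotent M (t e) n)"
    by (rule assms Df_funs Df_logic Dt_var Dt_const Dt_shift om_simps(2))+
qed (use Dt_in_U[OF assms(2)] in \<open>simp add: Fin_def equipotent_iff\<close>)

lemmas Df_Fin = Df_Fin_om[OF om_simps(2)]

text \<open>The double shift accounts for two binders: the set \<open>Z\<close> that collects the
  elements, and below it the element \<open>z\<close> itself.\<close>

lemma Df_Fin_Collect:
  assumes "om \<in> K" "Df K (\<lambda>e. Q (\<lambda>i. e (Suc (Suc i))) (e 0))"
  shows "Df K (\<lambda>e. Fin {z \<in> U. Q e z})"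
proof (rule Df_cong)
  show "Df K (\<lambda>e. \<exists>Z \<in> U. Fin (el Z) \<and> (\<forall>z \<in> U. z \<in> el Z \<longleftrightarrow> Q e z))"
    by (rule assms Df_Fin_om Df_logic Dt_var)+
  have "el Z = {z \<in> U. Q e z}" if "\<forall>z \<in> U. z \<in> el Z \<longleftrightarrow> Q e z" for e Z
    using that el_subset_U[of Z] by blast
  moreover have "\<exists>Z \<in> U. el Z = {z \<in> U. Q e z}" if "Fin {z \<in> U. Q e z}" for e
    using that Fin_internal el_mk mk_in_U by metis
  ultimately show "Fin {z \<in> U. Q e z} \<longleftrightarrow> (\<exists>Z \<in> U. Fin (el Z) \<and> (\<forall>z \<in> U. z \<in> el Z \<longleftrightarrow> Q e z))" for e
    by (metis (mono_tags, lifting) mem_Collect_eq)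
qed

lemma Fin_empty [simp]: "Fin {}"
  using eqp_refl[of "{}"] om_simps(3) emp(2) unfolding Fin_def by (metis internal_empty)

lemma Fin_om: "n \<in> el om \<Longrightarrow> Fin (el n)"
  unfolding Fin_def using eqp_refl[of "el n"] by auto

lemma eqp_insert:
  assumes "eqp S T" "x \<notin> S" "y \<notin> T" "x \<in> U" "y \<in> U"
  shows "eqp (insert x S) (insert y T)"
proof -
  obtain R where R: "irel R" "bijrel R S T" using assms(1) unfolding eqp_def by blast
  note r = bijrelD[OF R(2)]
  have "bijrel (insert (x, y) R) (insert x S) (insert y T)"
  proof (rule bijrelI)
    show "insert (x, y) R \<subseteq> insert x S \<times> insert y T" using r(1) by blast
    show "\<exists>b. (a, b) \<in> insert (x, y) R" if "a \<in> insert x S" for a using that r(2)[of a] by blast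
    show "\<exists>a. (a, b) \<in> insert (x, y) R" if "b \<in> insert y T" for b using that r(3)[of b] by blast
    show "b = b'" if "(a, b) \<in> insert (x, y) R" "(a, b') \<in> insert (x, y) R" for a b b'
      using that r(1) r(4)[of a b b'] assms(2) by blast
    show "a = a'" if "(a, b) \<in> insert (x, y) R" "(a', b) \<in> insert (x, y) R" for a a' b
      using that r(1) r(5)[of a b a'] assms(3) by blast
  qed
  then show ?thesis using irel_insert[OF R(1) assms(4,5)] unfolding eqp_def by blast
qed

lemma Fin_insert [simp]:
  assumes "Fin S" "x \<in> U" shows "Fin (insert x S)"
proof (cases "x \<in> S")
  case True
  then show ?thesis using assms by (simp add: insert_absorb)
next
  case False
  obtain n where n: "n \<in> el om" "eqp S (el n)" using assms unfolding Fin_def by blast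
  have "eqp (insert x S) (el (sc n))"
    using eqp_insert[OF n(2) False om_irrefl[OF n(1)] assms(2)] n(1) by simp
  then show ?thesis using assms(1,2) n om_simps(4)[OF n(1)] unfolding Fin_def by (blast intro: internal_insert)
qed

text \<open>Induction on the size in \<open>om\<close>, generalized over all sets of that size. The
  induction predicate has to be definable as a property of a code of the set.\<close>

lemma Fin_induct [consumes 1, case_names Df emp insert]:
  assumes "Fin S" "Df U (\<lambda>e. P (el (e 0)))" "P {}"
    "\<And>S x. Fin S \<Longrightarrow> P S \<Longrightarrow> x \<in> U \<Longrightarrow> x \<notin> S \<Longrightarrow> P (insert x S)"
  shows "P S"
proof -
  have step: "\<forall>X \<in> U. equipotent M X n \<longrightarrow> P (el X)" if "n \<in> el om" for n
    using that
  proof (induction rule: om_induct)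
    show "Df U (\<lambda>e. \<forall>X \<in> U. equipotent M X (e 0) \<longrightarrow> P (el X))"
      by (rule Df_subst1[OF assms(2)] Df_all_U Df_imp Df_funs Dt_var)+
  next
    show "\<forall>X \<in> U. equipotent M X emp \<longrightarrow> P (el X)"
    proof (intro ballI impI)
      fix X assume "X \<in> U" "equipotent M X emp"
      then have "el X = {}" unfolding equipotent_iff eqp_def bijrel_def by fastforce
      then show "P (el X)" using assms(3) by simp
    qed
  next
    fix k assume k: "k \<in> el om" and IH: "\<forall>X \<in> U. equipotent M X k \<longrightarrow> P (el X)"
    show "\<forall>X \<in> U. equipotent M X (sc k) \<longrightarrow> P (el X)"
    proof (intro ballI impI)
      fix X assume X: "X \<in> U" "equipotent M X (sc k)"
      then obtain R where R: "irel R" "bijrel R (el X) (insert k (el k))"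
        using k unfolding equipotent_iff eqp_def by auto
      note r = bijrelD[OF R(2)]
      \<comment> \<open>The last element \<open>k\<close> of \<open>sc k\<close> is removed together
        with its preimage \<open>x\<close>; what remains has size \<open>k\<close>.\<close>
      obtain x where x: "(x, k) \<in> R" using r(3)[of k] by auto
      have xU: "x \<in> U" "x \<in> el X" using r(1) x by auto
      have "Df U (\<lambda>e. e 1 \<noteq> k)" by (rule Df_logic Dt_var Dt_const el_in_U[OF k] | simp add: k)+
      from irel_sub[OF R(1) this] have "irel {(x, y). (x, y) \<in> R \<and> y \<noteq> k}" .
      moreover have "bijrel {(x, y). (x, y) \<in> R \<and> y \<noteq> k} (el X - {x}) (el k)"
      proof (rule bijrelI)
        show "{(x, y). (x, y) \<in> R \<and> y \<noteq> k} \<subseteq> (el X - {x}) \<times> el k" using r x by blast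
        show "\<exists>y. (z, y) \<in> {(x, y). (x, y) \<in> R \<and> y \<noteq> k}" if "z \<in> el X - {x}" for z
          using that r(2)[of z] r(5)[OF x] by blast
        show "\<exists>z. (z, y) \<in> {(x, y). (x, y) \<in> R \<and> y \<noteq> k}" if "y \<in> el k" for y
          using that r(3)[of y] om_irrefl[OF k] by blast
      qed (use r(4,5) in blast)+
      ultimately have "eqp (el X - {x}) (el k)" unfolding eqp_def by blast
      moreover have int: "internal (el X - {x})" using X(1) xU by simp
      ultimately have F: "Fin (el X - {x})" "P (el X - {x})"
        using k IH int unfolding Fin_def equipotent_iff by (blast, metis el_mk mk_in_U)
      from assms(4)[OF F xU(1)] show "P (el X)" using xU(2) by (simp add: insert_absorb)
    qed
  qed
  obtain n where n: "n \<in> el om" "eqp S (el n)" "internal S" using assms(1) unfolding Fin_def by blast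
  then have "mk S \<in> U" "equipotent M (mk S) n" by (simp_all add: equipotent_iff)
  then have "P (el (mk S))" using step n(1) by blast
  then show ?thesis using n(3) by simp
qed

lemma Fin_subset:
  assumes "Fin S" "T \<subseteq> S" "internal T" shows "Fin T"
proof -
  have "\<forall>Y \<in> U. el Y \<subseteq> S \<longrightarrow> Fin (el Y)"
    using assms(1)
  proof (induction rule: Fin_induct)
    show "Df U (\<lambda>e. \<forall>Y \<in> U. el Y \<subseteq> el (e 0) \<longrightarrow> Fin (el Y))"
      by (rule Df_logic Df_Fin Dt_var)+
  next
    fix S x assume S: "Fin S" "\<forall>Y \<in> U. el Y \<subseteq> S \<longrightarrow> Fin (el Y)" "x \<in> U" "x \<notin> S"
    show "\<forall>Y \<in> U. el Y \<subseteq> insert x S \<longrightarrow> Fin (el Y)"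
    proof (intro ballI impI)
      fix Y assume Y: "Y \<in> U" "el Y \<subseteq> insert x S"
      have "internal (el Y - {x})" using Y S by simp
      moreover have "el Y - {x} \<subseteq> S" using Y by blast
      ultimately have "Fin (el Y - {x})" using S(2) by (metis el_mk mk_in_U)
      then have "Fin (insert x (el Y - {x}))" using S(3) by (rule Fin_insert)
      then show "Fin (el Y)"
        using \<open>Fin (el Y - {x})\<close> by (cases "x \<in> el Y") (simp_all add: insert_absorb)
    qed
  qed simp
  then show ?thesis using assms by (metis el_mk mk_in_U)
qed

lemma Fin_Un [simp]:
  assumes "Fin S" "Fin T" shows "Fin (S \<union> T)"
  using assms(1)
proof (induction rule: Fin_induct)
  have T: "internal T" using assms(2) by (rule Fin_internal)
  have "Df U (\<lambda>e. Fin {z \<in> U. z \<in> el (e 0) \<or> z \<in> T})"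
    by (rule Df_Fin_Collect Df_logic Df_internal_mem Dt_var T om_simps(2))+
  moreover have "{z \<in> U. z \<in> X \<or> z \<in> T} = X \<union> T" if "X \<subseteq> U" for X
    using that internal_subset_U[OF T] by blast
  ultimately show "Df U (\<lambda>e. Fin (el (e 0) \<union> T))" using el_subset_U by simp
qed (simp_all add: assms(2))

text \<open>The map is given as a definable, possibly partial relation instead of a HOL function,
  because only predicates can be definable.\<close>

lemma Fin_image:
  assumes S: "Fin S" and R: "Df K (\<lambda>e. R (e 0) (e 1))"
    and single: "\<And>x y y'. x \<in> S \<Longrightarrow> y \<in> U \<Longrightarrow> y' \<in> U \<Longrightarrow> R x y \<Longrightarrow> R x y' \<Longrightarrow> y = y'"
  shows "Fin {y \<in> U. \<exists>x \<in> S. R x y}"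
proof -
  note R = Df_subst2[OF Df_to_U[OF R]]
  have SI: "internal S" using Fin_internal[OF S] .
  have "T \<subseteq> S \<longrightarrow> Fin {y \<in> U. \<exists>x \<in> T. R x y}" if "Fin T" for T
    using that
  proof (induction rule: Fin_induct)
    have "Df U (\<lambda>e. el (e 0) \<subseteq> el (mk S) \<longrightarrow> Fin {y \<in> U. \<exists>x \<in> el (e 0). R x y})"
      by (rule Df_Fin_Collect Df_logic Dt_var R Dt_const om_simps(2) mk_in_U[OF SI])+
    then show "Df U (\<lambda>e. el (e 0) \<subseteq> S \<longrightarrow> Fin {y \<in> U. \<exists>x \<in> el (e 0). R x y})"
      using SI by simp
  next
    fix T x assume IH: "T \<subseteq> S \<longrightarrow> Fin {y \<in> U. \<exists>x \<in> T. R x y}"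
    show "insert x T \<subseteq> S \<longrightarrow> Fin {y \<in> U. \<exists>x \<in> insert x T. R x y}"
    proof
      assume sub: "insert x T \<subseteq> S"
      show "Fin {y \<in> U. \<exists>x \<in> insert x T. R x y}"
      proof (cases "\<exists>y \<in> U. R x y")
        case True
        then obtain y where y: "y \<in> U" "R x y" by blast
        then have "{y \<in> U. \<exists>x \<in> insert x T. R x y} = insert y {y \<in> U. \<exists>x \<in> T. R x y}"
          using single[of x y] sub by blast
        then show ?thesis using IH sub y by simp
      next
        case False
        then have "{y \<in> U. \<exists>x \<in> insert x T. R x y} = {y \<in> U. \<exists>x \<in> T. R x y}" by blast
        then show ?thesis using IH sub by simp
      qed
    qed
  qed simp
  then show ?thesis using S by blast
qed

lemma Fin_UN:
  assumes "Fin S" "\<And>x. x \<in> S \<Longrightarrow> Fin (el x)" shows "Fin (\<Union>x \<in> S. el x)"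
proof -
  have "(\<forall>x \<in> S. Fin (el x)) \<longrightarrow> Fin (\<Union>x \<in> S. el x)"
    using assms(1)
  proof (induction rule: Fin_induct)
    have "Df U (\<lambda>e. (\<forall>x \<in> el (e 0). Fin (el x)) \<longrightarrow> Fin {z \<in> U. \<exists>x \<in> el (e 0). z \<in> el x})"
      by (rule Df_Fin_Collect Df_Fin Df_logic Dt_var om_simps(2))+
    moreover have "{z \<in> U. \<exists>x \<in> X. z \<in> el x} = (\<Union>x \<in> X. el x)" for X
      using el_subset_U by blast
    ultimately show "Df U (\<lambda>e. (\<forall>x \<in> el (e 0). Fin (el x)) \<longrightarrow> Fin (\<Union>x \<in> el (e 0). el x))" by simp
  qed simp_all
  then show ?thesis using assms(2) by blast
qed

text \<open>A subset of \<open>insert x S\<close> is a subset of \<open>S\<close> or arises from one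
  by adding \<open>x\<close>. The second kind is the image of the first under the definable map
  \<open>?R\<close>.\<close>

lemma Fin_Pow:
  assumes "Fin S" shows "Fin {z. is_set M z \<and> el z \<subseteq> S}"
proof -
  have "Fin {z \<in> U. is_set M z \<and> el z \<subseteq> S}"
    using assms
  proof (induction rule: Fin_induct)
    show "Df U (\<lambda>e. Fin {z \<in> U. is_set M z \<and> el z \<subseteq> el (e 0)})"
      by (rule Df_Fin_Collect Df_logic Dt_var om_simps(2))+
  next
    have "{z \<in> U. is_set M z \<and> el z \<subseteq> {}} = {emp}"
      using is_empty_iff unfolding is_empty_def by auto
    then show "Fin {z \<in> U. is_set M z \<and> el z \<subseteq> {}}" by simp
  next
    fix S x assume IH: "Fin {z \<in> U. is_set M z \<and> el z \<subseteq> S}" (is "Fin ?Z")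
      and S: "Fin S" "x \<in> U" "x \<notin> S"
    let ?R = "\<lambda>u v. is_set M v \<and> (\<forall>w \<in> U. w \<in> el v \<longleftrightarrow> w = x \<or> w \<in> el u)"
    have D: "Df U (\<lambda>e. ?R (e 0) (e 1))"
      by (rule Df_logic Dt_var Dt_const S(2))+
    have R: "?R u v \<longleftrightarrow> is_set M v \<and> el v = insert x (el u)" for u v
      using S(2) el_subset_U[of u] el_subset_U[of v] by blast
    have "Fin {v \<in> U. \<exists>u \<in> ?Z. ?R u v}"
    proof (rule Fin_image[OF IH D])
      show "v = w" if "?R u v" "?R u w" for u v w
        using that ext_set[of v w] unfolding R by simp
    qed
    then have "Fin ({v \<in> U. \<exists>u \<in> ?Z. ?R u v} \<union> ?Z)" (is "Fin ?F") using IH by (rule Fin_Un)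
    moreover have "?F = {z \<in> U. is_set M z \<and> el z \<subseteq> insert x S}"
    proof (intro subset_antisym subsetI)
      fix z assume "z \<in> ?F" then show "z \<in> {z \<in> U. is_set M z \<and> el z \<subseteq> insert x S}"
        unfolding R by blast
    next
      fix z assume z: "z \<in> {z \<in> U. is_set M z \<and> el z \<subseteq> insert x S}"
      have int: "internal (el z - {x})" using z S(2) by simp
      show "z \<in> ?F"
      proof (cases "x \<in> el z")
        case True
        have "mk (el z - {x}) \<in> ?Z" using int z by auto
        moreover have "?R (mk (el z - {x})) z" unfolding R using int z True by auto
        ultimately show ?thesis using z by blast
      qed (use z in blast)
    qed
    ultimately show "Fin {z \<in> U. is_set M z \<and> el z \<subseteq> insert x S}" by simp
  qed
  moreover have "{z \<in> U. is_set M z \<and> el z \<subseteq> S} = {z. is_set M z \<and> el z \<subseteq> S}"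
    using is_set_in_U by blast
  ultimately show ?thesis by simp
qed

section \<open>Comparison of finite sizes\<close>

lemma eqp_remove:
  assumes "eqp S T" "x \<in> S" "y \<in> T" shows "eqp (S - {x}) (T - {y})"
proof -
  obtain R where R: "irel R" "bijrel R S T" using assms(1) unfolding eqp_def by blast
  note r = bijrelD[OF R(2)]
  \<comment> \<open>\<open>t\<close> is the partner of \<open>y\<close> and \<open>u\<close> the
    partner of \<open>x\<close>. Unless \<open>t = x\<close>, removing \<open>x\<close> and
    \<open>y\<close> leaves both without a partner, and they are matched with each other.\<close>
  obtain t where t1: "(t, y) \<in> R" using r(3)[OF assms(3)] by blast
  obtain u where t2: "(x, u) \<in> R" using r(2)[OF assms(2)] by blast
  note t = t1 t2
  have U: "x \<in> U" "y \<in> U" "t \<in> U" "u \<in> U" using t irel_in_U[OF R(1)] by blast+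
  let ?Q = "{(a, b). (a, b) \<in> R \<and> a \<noteq> x \<and> b \<noteq> y}"
  have "Df U (\<lambda>e. e 0 \<noteq> x \<and> e 1 \<noteq> y)" by (rule Df_logic Dt_var Dt_const U)+
  from irel_sub[OF R(1) this] have Q: "irel ?Q" .
  show ?thesis
  proof (cases "t = x")
    case True
    have "bijrel ?Q (S - {x}) (T - {y})"
    proof (rule bijrelI)
      show "\<exists>b. (a, b) \<in> ?Q" if a: "a \<in> S - {x}" for a
      proof -
        obtain b where "(a, b) \<in> R" using r(2)[of a] a by blast
        moreover from this have "b \<noteq> y" using r(5)[OF t(1), of a] a True by blast
        ultimately show ?thesis using a by blast
      qed
      show "\<exists>a. (a, b) \<in> ?Q" if b: "b \<in> T - {y}" for b
      proof -
        obtain a where "(a, b) \<in> R" using r(3)[of b] b by blast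
        moreover from this have "a \<noteq> x" using r(4)[OF t(1), of b] b True by blast
        ultimately show ?thesis using b by blast
      qed
    qed (use r in blast)+
    then show ?thesis using Q unfolding eqp_def by blast
  next
    case False
    have "bijrel (insert (t, u) ?Q) (S - {x}) (T - {y})"
    proof (rule bijrelI)
      show "insert (t, u) ?Q \<subseteq> (S - {x}) \<times> (T - {y})" using r(1) t False r(5)[OF t(1), of x] t(2) by blast
      show "\<exists>b. (a, b) \<in> insert (t, u) ?Q" if a: "a \<in> S - {x}" for a
      proof -
        obtain b where b: "(a, b) \<in> R" using r(2)[of a] a by blast
        show ?thesis using r(5)[OF t(1), of a] a b by (cases "a = t") blast+
      qed
      show "\<exists>a. (a, b) \<in> insert (t, u) ?Q" if b: "b \<in> T - {y}" for b
      proof -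
        obtain a where a: "(a, b) \<in> R" using r(3)[of b] b by blast
        show ?thesis using r(4)[OF t(2), of b] a b by (cases "b = u") blast+
      qed
      show "b = b'" if "(a, b) \<in> insert (t, u) ?Q" "(a, b') \<in> insert (t, u) ?Q" for a b b'
        using that r(4) t(1) by blast
      show "a = a'" if "(a, b) \<in> insert (t, u) ?Q" "(a', b) \<in> insert (t, u) ?Q" for a a' b
        using that r(5) t(2) by blast
    qed
    then show ?thesis using irel_insert[OF Q U(3,4)] unfolding eqp_def by blast
  qed
qed

lemma eqp_subset:
  assumes "eqp S T" "internal S'" "S' \<subseteq> S"
  shows "\<exists>T'. T' \<subseteq> T \<and> internal T' \<and> eqp S' T'"
proof -
  obtain R where R: "irel R" "bijrel R S T" using assms(1) unfolding eqp_def by blast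
  note r = bijrelD[OF R(2)]
  have "Df U (\<lambda>e. e 0 \<in> S')" by (rule Df_internal_mem assms Dt_var)+
  from irel_sub[OF R(1) this] have Q: "irel {(x, y). (x, y) \<in> R \<and> x \<in> S'}" (is "irel ?Q") .
  have "Range ?Q \<subseteq> T" using r(1) by blast
  moreover have "bijrel ?Q S' (Range ?Q)"
  proof (rule bijrelI)
    show "\<exists>y. (x, y) \<in> ?Q" if "x \<in> S'" for x using r(2)[of x] assms(3) that by blast
  qed (use r(4,5) in blast)+
  ultimately show ?thesis using Q internal_Domain_Range[OF Q] unfolding eqp_def by blast
qed

text \<open>Induction on \<open>S\<close>: one point is removed from each of the two equipotent sets
  in such a way that the rest of the smaller one lies in the old \<open>S\<close>.\<close>

lemma Fin_Dedekind:
  assumes "Fin S" "T \<subseteq> S" "internal T" "eqp T S" shows "T = S"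
proof -
  have "\<forall>X \<in> U. \<forall>Y \<in> U. el Y = S \<and> el X \<subseteq> S \<and> equipotent M X Y \<longrightarrow> el X = S"
    using assms(1)
  proof (induction rule: Fin_induct)
    have "Df U (\<lambda>e. \<forall>X \<in> U. \<forall>Y \<in> U. (el Y \<subseteq> el (e 0) \<and> el (e 0) \<subseteq> el Y) \<and> el X \<subseteq> el (e 0) \<and> equipotent M X Y \<longrightarrow>
      el X \<subseteq> el (e 0) \<and> el (e 0) \<subseteq> el X)"
      by (rule Df_logic Df_funs Dt_var)+
    then show "Df U (\<lambda>e. \<forall>X \<in> U. \<forall>Y \<in> U. el Y = el (e 0) \<and> el X \<subseteq> el (e 0) \<and> equipotent M X Y \<longrightarrow> el X = el (e 0))"
      by (simp only: set_eq_subset)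
  next
    fix S x assume S: "Fin S" "x \<in> U" "x \<notin> S"
      and IH: "\<forall>X \<in> U. \<forall>Y \<in> U. el Y = S \<and> el X \<subseteq> S \<and> equipotent M X Y \<longrightarrow> el X = S"
    have IH: "T = S" if "internal T" "T \<subseteq> S" "eqp T S" for T
      using IH[rule_format, of "mk T" "mk S"] that Fin_internal[OF S(1)] by (simp add: equipotent_iff)
    show "\<forall>X \<in> U. \<forall>Y \<in> U. el Y = insert x S \<and> el X \<subseteq> insert x S \<and> equipotent M X Y \<longrightarrow> el X = insert x S"
    proof (intro ballI impI)
      fix X Y assume X: "X \<in> U" and Y: "Y \<in> U" "el Y = insert x S \<and> el X \<subseteq> insert x S \<and> equipotent M X Y"
      then have X': "eqp (el X) (insert x S)" "el X \<subseteq> insert x S" unfolding equipotent_iff by (metis, blast)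
      \<comment> \<open>If \<open>x\<close> lies in \<open>X\<close> it must be the point removed;
        otherwise any point of \<open>X\<close> will do, and the equality then contradicts
        \<open>X\<close> being contained in \<open>S\<close>.\<close>
      have *: "el X - {t} = S" if "t \<in> el X" "t = x \<or> x \<notin> el X" for t
      proof (rule IH)
        show "eqp (el X - {t}) S"
          using eqp_remove[OF X'(1), of t x] that S(3) by simp
      qed (use that X X' in auto)
      show "el X = insert x S"
      proof (cases "x \<in> el X")
        case True
        then show ?thesis using *[of x] by blast
      next
        case False
        obtain t where "t \<in> el X" using X'(1) unfolding eqp_def bijrel_def by blast
        then show ?thesis using *[of t] False X'(2) by blast
      qed
    qed
  qed simp
  then show ?thesis
    using assms Fin_internal[OF assms(1)] by (metis el_mk mk_in_U equipotent_iff)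
qed

lemma pigeonhole:
  assumes "n \<in> el om" "T \<subseteq> el n" "internal T" shows "\<not> eqp T (el (sc n))"
proof
  assume "eqp T (el (sc n))"
  moreover have "Fin (el (sc n))" using assms(1) by (intro Fin_om) simp
  moreover have "T \<subseteq> el (sc n)" using assms by auto
  ultimately have "T = el (sc n)" using assms(3) by (intro Fin_Dedekind)
  then show False using assms(1,2) om_irrefl[OF assms(1)] by auto
qed

text \<open>Since \<open>sc n\<close> is contained in \<open>m\<close>, a bijection of
  \<open>T\<close> with \<open>m\<close> would embed \<open>sc n\<close> into \<open>S\<close> and
  hence into \<open>n\<close>, against the pigeonhole principle.\<close>

lemma not_eqp_larger:
  assumes "n \<in> el om" "m \<in> el om" "n \<in> el m" "T \<subseteq> S" "internal T" "eqp S (el n)"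
  shows "\<not> eqp T (el m)"
proof
  assume T: "eqp T (el m)"
  have "el (sc n) \<subseteq> el m" using assms(1,2,3) om_trans[OF assms(2,3)] by auto
  then obtain T' where T': "T' \<subseteq> T" "internal T'" "eqp (el (sc n)) T'"
    using eqp_subset[OF eqp_sym[OF T], of "el (sc n)"] assms(1) by auto
  obtain T'' where "T'' \<subseteq> el n" "internal T''" "eqp T' T''"
    using eqp_subset[OF assms(6) T'(2)] T'(1) assms(4) by blast
  then show False using pigeonhole[OF assms(1)] eqp_trans[OF T'(3)] eqp_sym by blast
qed

lemma not_Fin_om: "\<not> Fin (el om)"
proof
  assume "Fin (el om)"
  then obtain n where n: "n \<in> el om" "eqp (el om) (el n)" unfolding Fin_def by blast
  have "\<not> eqp (el (sc n)) (el (sc n))"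
    by (rule not_eqp_larger[OF n(1) _ _ _ _ n(2)]) (use n(1) om_el_subset[of "sc n"] in auto)
  then show False using n(1) by (simp add: eqp_refl)
qed

lemma Fin_eqp: "Fin S \<Longrightarrow> eqp S T \<Longrightarrow> internal T \<Longrightarrow> Fin T"
  unfolding Fin_def using eqp_trans eqp_sym by blast

text \<open>Only the existence of a subset of each size is claimed, so the induction step adds a
  single new point and no sequence of choices is made.\<close>

lemma infinite_has_subset:
  assumes "internal S" "\<not> Fin S" "n \<in> el om"
  shows "\<exists>T. T \<subseteq> S \<and> internal T \<and> eqp T (el n)"
proof -
  have "\<exists>X \<in> U. el X \<subseteq> el (mk S) \<and> equipotent M X n"
    using assms(3)
  proof (induction rule: om_induct)
    show "Df U (\<lambda>e. \<exists>X \<in> U. el X \<subseteq> el (mk S) \<and> equipotent M X (e 0))"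
      by (rule Df_logic Df_funs Dt_var Dt_const | simp add: assms)+
  next
    show "\<exists>X \<in> U. el X \<subseteq> el (mk S) \<and> equipotent M X emp"
      by (intro bexI[of _ emp]) (auto simp: equipotent_iff eqp_refl)
  next
    fix k assume k: "k \<in> el om" "\<exists>X \<in> U. el X \<subseteq> el (mk S) \<and> equipotent M X k"
    then obtain X where X: "X \<in> U" "el X \<subseteq> S" "eqp (el X) (el k)"
      using assms(1) by (auto simp: equipotent_iff)
    then have "Fin (el X)" using k(1) unfolding Fin_def by auto
    then obtain x where x: "x \<in> S" "x \<notin> el X" using assms(2) X(2) by (metis subsetI subset_antisym)
    have xU: "x \<in> U" using x internal_subset_U[OF assms(1)] by blast
    have "eqp (insert x (el X)) (insert k (el k))"
      using eqp_insert[OF X(3) x(2) om_irrefl[OF k(1)] xU] k(1) by simp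
    then show "\<exists>X \<in> U. el X \<subseteq> el (mk S) \<and> equipotent M X (sc k)"
      using X x xU k(1) assms(1) by (intro bexI[of _ "mk (insert x (el X))"]) (simp_all add: equipotent_iff)
  qed
  then show ?thesis using assms(1) unfolding equipotent_iff by auto
qed

section \<open>The action of the permutations of the atoms\<close>


lemma is_transitive_iff:
  "is_transitive M t \<longleftrightarrow> is_set M t \<and> (\<forall>u \<in> el t. el u \<subseteq> el t)"
  by (simp add: is_transitive_def)

lemma Df_is_transitive: "Dt K t \<Longrightarrow> Df K (\<lambda>e. is_transitive M (t e))"
  unfolding is_transitive_iff by (rule Df_logic Dt_var Dt_shift | assumption)+

text \<open>The transitive closure of \<open>{x}\<close> is the union of its levels: level 0 is
  \<open>{x}\<close>, and level \<open>n + 1\<close> is the union of the elements of level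
  \<open>n\<close>. The recursion along \<open>om\<close> runs through approximations inside
  \<open>M\<close>. A transitive set around \<open>x\<close> is what turns foundation into induction
  on membership.\<close>

lemma transitive_set_ex:
  assumes x: "x \<in> U" shows "\<exists>t. is_transitive M t \<and> x \<in> el t"
proof -
  \<comment> \<open>\<open>W\<close> relates \<open>k\<close> to the elements of level
    \<open>k\<close>. Only the levels up to and including \<open>n\<close> are constrained;
    \<open>W\<close> may contain anything at other first components.\<close>
  define approx where "approx W n \<longleftrightarrow> is_rel W \<and> (\<forall>k \<in> U. k = emp \<longrightarrow> (\<forall>y \<in> U. (k, y) \<in> rel_of M W \<longleftrightarrow> y = x)) \<and>
    (\<forall>k \<in> el n. \<forall>k' \<in> U. k' = sc k \<longrightarrow> (\<forall>y \<in> U. (k', y) \<in> rel_of M W \<longleftrightarrow>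
       (\<exists>z \<in> U. (k, z) \<in> rel_of M W \<and> y \<in> el z)))" for W n
  have Df_approx: "Df U (\<lambda>e. approx (t e) (u e))" if "Dt U t" "Dt U u" for t u
    unfolding approx_def
    by (rule Df_is_rel Df_eq_emp Df_eq_sc Df_rel_of Df_logic that Dt_var Dt_const x Dt_shift)+
  have base: "(emp, y) \<in> rel_of M W \<longleftrightarrow> y = x" if "approx W n" "y \<in> U" for W n y
    using that unfolding approx_def by simp
  have rel: "irel (rel_of M W)" if "approx W n" for W n
    using that unfolding approx_def by (elim conjE irel_rel_of)
  have agree: "(k, y) \<in> rel_of M W \<longleftrightarrow> (k, y) \<in> rel_of M W'"
    if "approx W n" "approx W' n'" "n \<in> el om" "n' \<in> el om" "k \<in> el om" "k \<in> el (sc n)" "k \<in> el (sc n')" "y \<in> U" for W W' n n' k y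
  proof -
    have W: "W \<in> U" "W' \<in> U" using that by (simp_all add: approx_def is_rel_def)
    note U = el_in_U[OF that(3)] el_in_U[OF that(4)]
    have "(k \<in> el n \<or> k = n) \<and> (k \<in> el n' \<or> k = n') \<longrightarrow> (\<forall>y \<in> U. (k, y) \<in> rel_of M W \<longleftrightarrow> (k, y) \<in> rel_of M W')"
      using that(5)
    proof (induction rule: om_induct)
      show "Df U (\<lambda>e. (e 0 \<in> el n \<or> e 0 = n) \<and> (e 0 \<in> el n' \<or> e 0 = n') \<longrightarrow>
          (\<forall>y \<in> U. (e 0, y) \<in> rel_of M W \<longleftrightarrow> (e 0, y) \<in> rel_of M W'))"
        by (rule Df_rel_of Df_logic Dt_var Dt_const W U)+
    next
      fix k assume k: "k \<in> el om" and
        IH: "(k \<in> el n \<or> k = n) \<and> (k \<in> el n' \<or> k = n') \<longrightarrow> (\<forall>y \<in> U. (k, y) \<in> rel_of M W \<longleftrightarrow> (k, y) \<in> rel_of M W')"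
      have less: "k \<in> el m" if "sc k \<in> el m \<or> sc k = m" "m \<in> el om" for m
        using that om_trans[of m "sc k"] k by auto
      show "(sc k \<in> el n \<or> sc k = n) \<and> (sc k \<in> el n' \<or> sc k = n') \<longrightarrow>
          (\<forall>y \<in> U. (sc k, y) \<in> rel_of M W \<longleftrightarrow> (sc k, y) \<in> rel_of M W')"
      proof (intro impI ballI)
        fix y assume "(sc k \<in> el n \<or> sc k = n) \<and> (sc k \<in> el n' \<or> sc k = n')" and y: "y \<in> U"
        then have kn: "k \<in> el n" "k \<in> el n'" using less[of n] less[of n'] that by blast+
        have kU: "sc k \<in> U" using k by simp
        have "(sc k, y) \<in> rel_of M W \<longleftrightarrow> (\<exists>z \<in> U. (k, z) \<in> rel_of M W \<and> y \<in> el z)"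
          using that(1) kn(1) kU y unfolding approx_def by blast
        moreover have "(sc k, y) \<in> rel_of M W' \<longleftrightarrow> (\<exists>z \<in> U. (k, z) \<in> rel_of M W' \<and> y \<in> el z)"
          using that(2) kn(2) kU y unfolding approx_def by blast
        ultimately show "(sc k, y) \<in> rel_of M W \<longleftrightarrow> (sc k, y) \<in> rel_of M W'"
          using IH kn by blast
      qed
    next
      show "(emp \<in> el n \<or> emp = n) \<and> (emp \<in> el n' \<or> emp = n') \<longrightarrow>
          (\<forall>y \<in> U. (emp, y) \<in> rel_of M W \<longleftrightarrow> (emp, y) \<in> rel_of M W')"
        using base[OF that(1)] base[OF that(2)] by simp
    qed
    then show ?thesis using that(6-8) U by auto
  qed
  have ex: "\<exists>W \<in> U. approx W n" if "n \<in> el om" for n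
    using that
  proof (induction rule: om_induct)
    show "Df U (\<lambda>e. \<exists>W \<in> U. approx W (e 0))" by (rule Df_approx Df_logic Dt_var)+
  next
    have R: "irel {(emp, x)}" using irel_insert[of "{}" emp x] x by (simp add: irel_def codes_def)
    have "approx (mkr {(emp, x)}) emp"
      unfolding approx_def rel_of_mkr[OF R] emp(2) using R by simp
    then show "\<exists>W \<in> U. approx W emp" using mkr_in_U[OF R] by blast
  next
    fix n assume n: "n \<in> el om" "\<exists>W \<in> U. approx W n"
    then obtain W where W: "approx W n" "W \<in> U" by blast
    let ?R = "rel_of M W"
    have R: "irel ?R" using rel[OF W(1)] .
    have nU: "n \<in> U" "sc n \<in> U" using n(1) by simp_all
    \<comment> \<open>Level \<open>sc n\<close> of the old \<open>W\<close> is unspecified, so its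
      pairs are discarded before the correct level is added.\<close>
    have "Df U (\<lambda>e. e 0 \<noteq> sc n)" by (rule Df_logic Dt_var Dt_const nU)+
    from irel_sub[OF R this] have 1: "irel {(k, y). (k, y) \<in> ?R \<and> k \<noteq> sc n}" .
    have "Df U (\<lambda>e. \<exists>z \<in> U. (n, z) \<in> ?R \<and> e 1 \<in> el z)"
      by (rule Df_irel_mem R Df_logic Dt_var Dt_const nU)+
    from irel_sep2[OF _ internal_UN[OF internal_Domain_Range(2)[OF R]] this, of "{sc n}"]
    have 2: "irel {(k, y). k \<in> {sc n} \<and> y \<in> (\<Union>z \<in> Range ?R. el z) \<and> (\<exists>z \<in> U. (n, z) \<in> ?R \<and> y \<in> el z)}"
      using nU by simp
    let ?Q = "{(k, y). (k, y) \<in> ?R \<and> k \<noteq> sc n} \<union>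
      {(k, y). k \<in> {sc n} \<and> y \<in> (\<Union>z \<in> Range ?R. el z) \<and> (\<exists>z \<in> U. (n, z) \<in> ?R \<and> y \<in> el z)}"
    have Q: "irel ?Q" using 1 2 by (rule irel_Un)
    have QR: "(k, y) \<in> ?Q \<longleftrightarrow> (k, y) \<in> ?R" if "k \<noteq> sc n" for k y using that by blast
    have Qn: "(sc n, y) \<in> ?Q \<longleftrightarrow> (\<exists>z \<in> U. (n, z) \<in> ?R \<and> y \<in> el z)" for y by blast
    have ne: "emp \<noteq> sc n" using sc(2)[OF nU(1)] emp(2) by (metis empty_iff insertI1)
    have less: "k \<noteq> sc n \<and> sc k \<noteq> sc n" if "k \<in> el n" for k
    proof -
      have "k \<noteq> sc n" using that om_trans[OF n(1) that] om_irrefl[OF n(1)] nU by auto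
      moreover have "sc k \<noteq> sc n"
        using that om_trans[OF n(1) that] om_irrefl[OF n(1)] nU sc(2)[of k] sc(2)[of n]
        by (metis el_in_U insert_iff subsetD)
      ultimately show ?thesis by blast
    qed
    have nn: "n \<noteq> sc n" using om_irrefl[OF n(1)] sc(2)[OF nU(1)] by (metis insertI1)
    have "approx (mkr ?Q) (sc n)"
      unfolding approx_def
    proof (intro conjI ballI impI)
      show "is_rel (mkr ?Q)" using Q by (rule is_rel_mkr)
      show "(k, y) \<in> rel_of M (mkr ?Q) \<longleftrightarrow> y = x" if "k = emp" "y \<in> U" for k y
      proof -
        have "(emp, y) \<in> ?R \<longleftrightarrow> y = x" using W(1) that emp(3) unfolding approx_def by blast
        then show ?thesis unfolding rel_of_mkr[OF Q] that(1) QR[OF ne] .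
      qed
      show "(k', y) \<in> rel_of M (mkr ?Q) \<longleftrightarrow> (\<exists>z \<in> U. (k, z) \<in> rel_of M (mkr ?Q) \<and> y \<in> el z)"
        if k: "k \<in> el (sc n)" "k' \<in> U" "k' = sc k" "y \<in> U" for k k' y
      proof -
        consider "k = n" | "k \<in> el n" using k nU by auto
        then show ?thesis
        proof cases
          case 1
          show ?thesis unfolding rel_of_mkr[OF Q] k(3) 1 Qn QR[OF nn] by (rule refl)
        next
          case 2
          have "(sc k, y) \<in> ?R \<longleftrightarrow> (\<exists>z \<in> U. (k, z) \<in> ?R \<and> y \<in> el z)"
            using W(1) k 2 unfolding approx_def by blast
          then show ?thesis
            unfolding rel_of_mkr[OF Q] k(3) using less[OF 2] QR by presburger
        qed
      qed
    qed
    then show "\<exists>W \<in> U. approx W (sc n)" using mkr_in_U[OF Q] by blast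
  qed
  \<comment> \<open>\<open>?L n L\<close> says that \<open>L\<close> is level \<open>n\<close>.
    Agreement of the approximations makes \<open>L\<close> unique, so replacement collects the
    levels and a union joins them.\<close>
  let ?L = "\<lambda>n L. is_set M L \<and> (\<exists>W \<in> U. approx W n \<and> (\<forall>y \<in> U. y \<in> el L \<longleftrightarrow> (n, y) \<in> rel_of M W))"
  have D: "Df U (\<lambda>e. ?L (e 0) (e 1))"
    by (rule Df_approx Df_rel_of Df_logic Dt_var)+
  have uniq: "L = L'" if n: "n \<in> el om" and L: "?L n L" "?L n L'" for n L L'
  proof -
    obtain W where W: "approx W n" "\<forall>y \<in> U. y \<in> el L \<longleftrightarrow> (n, y) \<in> rel_of M W" using L by blast
    obtain W' where W': "approx W' n" "\<forall>y \<in> U. y \<in> el L' \<longleftrightarrow> (n, y) \<in> rel_of M W'" using L by blast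
    have "\<forall>y \<in> U. y \<in> el L \<longleftrightarrow> y \<in> el L'"
      using W W' agree[OF W(1) W'(1) n n n] n by simp
    then have "el L = el L'" using el_subset_U by blast
    then show ?thesis using L ext_set by blast
  qed
  have exL: "\<exists>L \<in> U. ?L n L" if "n \<in> el om" "approx W n" for n W
  proof -
    have R: "irel (rel_of M W)" using rel[OF that(2)] .
    have "Df U (\<lambda>e. (n, e 0) \<in> rel_of M W)"
      by (rule Df_irel_mem R Dt_var Dt_const el_in_U[OF that(1)])+
    from internal_sep[OF this internal_Domain_Range(2)[OF R]]
    have I: "internal {y \<in> Range (rel_of M W). (n, y) \<in> rel_of M W}" (is "internal ?S") .
    have "W \<in> U" using that(2) by (simp add: approx_def is_rel_def)
    then have "?L n (mk ?S)" using that(2) I by (intro conjI bexI[of _ W]) auto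
    then show ?thesis using mk_in_U[OF I] by blast
  qed
  have I: "internal {L \<in> U. \<exists>n \<in> el om. ?L n L}"
    by (rule internal_repl[OF D]) (use uniq in \<open>simp_all only: internal_el om_simps\<close>)
  let ?T = "\<Union>L \<in> {L \<in> U. \<exists>n \<in> el om. ?L n L}. el L"
  have T: "internal ?T" using I by (rule internal_UN)
  have T_iff: "y \<in> ?T \<longleftrightarrow> (\<exists>n \<in> el om. \<exists>W \<in> U. approx W n \<and> (n, y) \<in> rel_of M W)" (is "_ \<longleftrightarrow> ?r") if "y \<in> U" for y
  proof
    assume "y \<in> ?T" then show ?r using that by blast
  next
    assume ?r
    then obtain n W where nW: "n \<in> el om" "W \<in> U" "approx W n" "(n, y) \<in> rel_of M W" by blast
    then obtain L where L: "L \<in> U" "?L n L" using exL by blast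
    then obtain W' where W': "approx W' n" "\<forall>y \<in> U. y \<in> el L \<longleftrightarrow> (n, y) \<in> rel_of M W'" by blast
    have "y \<in> el L" using W' agree[OF W'(1) nW(3) nW(1) nW(1) nW(1)] nW that by simp
    then show "y \<in> ?T" using L nW(1) by blast
  qed
  have "is_transitive M (mk ?T)"
    unfolding is_transitive_iff el_mk[OF T]
  proof (intro conjI ballI subsetI)
    fix u v assume u: "u \<in> ?T" and v: "v \<in> el u"
    have uU: "u \<in> U" using u internal_subset_U[OF T] by blast
    then obtain n W where nW: "n \<in> el om" "W \<in> U" "approx W n" "(n, u) \<in> rel_of M W"
      using u T_iff by blast
    obtain W' where W': "W' \<in> U" "approx W' (sc n)" using ex[of "sc n"] nW by auto
    have "(n, u) \<in> rel_of M W'"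
      using agree[OF nW(3) W'(2) nW(1) _ nW(1)] nW uU by simp
    then have "(sc n, v) \<in> rel_of M W'"
      using W'(2) v nW(1) uU el_in_U[OF v] sc(2,3)[OF el_in_U[OF nW(1)]] unfolding approx_def by blast
    then show "v \<in> ?T" using T_iff[OF el_in_U[OF v]] W' om_simps(4)[OF nW(1)] by blast
  qed (use T in simp)
  moreover have "x \<in> ?T"
  proof -
    obtain W where W: "W \<in> U" "approx W emp" using ex[of emp] by auto
    have "(emp, x) \<in> rel_of M W" using base[OF W(2) x] by blast
    then show ?thesis by (intro T_iff[OF x, THEN iffD2] bexI[OF _ om_simps(3)] bexI[OF _ W(1)] conjI W(2))
  qed
  ultimately show ?thesis
    by (intro exI[of _ "mk ?T"] conjI) (assumption, simp only: el_mk[OF T])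
qed

lemma foundation_internal:
  assumes "internal S" "S \<noteq> {}" shows "\<exists>y \<in> S. el y \<inter> S = {}"
proof -
  have "foundation M" using zfa_model by (simp add: zfa_model_def)
  moreover have "is_nonempty_set M (mk S)" using assms by (simp add: is_nonempty_set_def)
  ultimately show ?thesis unfolding foundation_def using assms(1) by (metis el_mk)
qed

text \<open>Inside a transitive set containing \<open>x\<close>, the counterexamples form a set of
  \<open>M\<close>; a membership-minimal one contradicts the step.\<close>

lemma eps_induct [consumes 1, case_names Df step]:
  assumes "x \<in> U" "Df K (\<lambda>e. P (e 0))" "\<And>x. x \<in> U \<Longrightarrow> (\<And>y. y \<in> el x \<Longrightarrow> P y) \<Longrightarrow> P x"
  shows "P x"
proof (rule ccontr)
  assume "\<not> P x"
  obtain t where t: "is_transitive M t" "x \<in> el t" using transitive_set_ex[OF assms(1)] by blast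
  have "internal {y \<in> el t. \<not> P y}"
    by (rule internal_sep[OF Df_not[OF assms(2)]]) (use t in \<open>simp add: is_transitive_def\<close>)
  then obtain y where y: "y \<in> el t" "\<not> P y" "el y \<inter> {y \<in> el t. \<not> P y} = {}"
    using foundation_internal[of "{y \<in> el t. \<not> P y}"] t \<open>\<not> P x\<close> by blast
  then have "\<And>z. z \<in> el y \<Longrightarrow> P z" using t unfolding is_transitive_def by blast
  then show False using assms(3) y el_in_U by blast
qed

end

lemma Image_eq_on: "(\<And>z w. z \<in> S \<Longrightarrow> (z, w) \<in> R \<longleftrightarrow> (z, w) \<in> Q) \<Longrightarrow> R `` S = Q `` S"
  by blast

locale zfa_atoms = zfa M for M :: "'a set_structure" +
  fixes A :: 'a
  assumes atoms: "is_set_of_atoms M A"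
begin

lemma A_simps [simp]: "is_set M A" "A \<in> U"
  using atoms by (auto simp: is_set_of_atoms_def)

lemma el_A: "a \<in> el A \<longleftrightarrow> a \<in> U \<and> atom M a"
  using atoms by (auto simp: is_set_of_atoms_def)

lemma el_atom_A: "a \<in> el A \<Longrightarrow> el a = {}"
  by (simp add: el_A el_atom)

abbreviation "G \<equiv> permutations M A"

lemma G_iff: "g \<in> G \<longleftrightarrow> is_rel g \<and> bijrel (rel_of M g) (el A) (el A)"
  by (simp add: permutations_def is_bijection_iff)

lemma G_in_U [simp]: "g \<in> G \<Longrightarrow> g \<in> U"
  by (simp add: G_iff is_rel_def)

lemma mkr_in_G: "irel R \<Longrightarrow> bijrel R (el A) (el A) \<Longrightarrow> mkr R \<in> G"
  by (simp add: G_iff)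

definition good :: "'a \<Rightarrow> 'a \<Rightarrow> 'a \<Rightarrow> bool" where
  "good g t h \<longleftrightarrow> is_transitive M t \<and> is_function_on M h t \<and>
     (\<forall>u v. (u, v) \<in> rel_of M h \<longrightarrow>
        (if atom M u then (u, v) \<in> rel_of M g
         else is_set M v \<and> el v = rel_of M h `` el u))"

lemma acts_good: "acts M g x y \<longleftrightarrow> (\<exists>t h. good g t h \<and> x \<in> el t \<and> (x, y) \<in> rel_of M h)"
  unfolding acts_def good_def by blast

lemma actsI: "good g t h \<Longrightarrow> x \<in> el t \<Longrightarrow> (x, y) \<in> rel_of M h \<Longrightarrow> acts M g x y"
  unfolding acts_good by blast

lemma good_in_U: "good g t h \<Longrightarrow> t \<in> U" "good g t h \<Longrightarrow> h \<in> U"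
  by (simp_all add: good_def is_transitive_def is_function_on_def)

lemma acts_in_U: "acts M g x y \<Longrightarrow> x \<in> U" "acts M g x y \<Longrightarrow> y \<in> U"
  unfolding acts_good by (auto dest: rel_of_in_U)

lemma Df_good:
  assumes "Dt K t" "Dt K u" "Dt K v" shows "Df K (\<lambda>e. good (t e) (u e) (v e))"
proof (rule Df_cong)
  show "Df K (\<lambda>e. is_transitive M (u e) \<and> is_function_on M (v e) (u e) \<and>
     (\<forall>a \<in> U. \<forall>b \<in> U. (a, b) \<in> rel_of M (v e) \<longrightarrow>
        (if atom M a then (a, b) \<in> rel_of M (t e)
         else is_set M b \<and> (\<forall>c \<in> U. c \<in> el b \<longleftrightarrow> (\<exists>d \<in> el a. (d, c) \<in> rel_of M (v e))))))"
    by (rule assms Df_is_transitive Df_funs Df_rel_of Df_logic Dt_var Dt_shift)+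
  have "el b = rel_of M h `` el a \<longleftrightarrow> (\<forall>c \<in> U. c \<in> el b \<longleftrightarrow> (\<exists>d \<in> el a. (d, c) \<in> rel_of M h))" for b h a
    unfolding set_eq_iff Image_iff by (meson el_in_U rel_of_in_U)
  then show "good (t e) (u e) (v e) \<longleftrightarrow> is_transitive M (u e) \<and> is_function_on M (v e) (u e) \<and>
     (\<forall>a \<in> U. \<forall>b \<in> U. (a, b) \<in> rel_of M (v e) \<longrightarrow>
        (if atom M a then (a, b) \<in> rel_of M (t e)
         else is_set M b \<and> (\<forall>c \<in> U. c \<in> el b \<longleftrightarrow> (\<exists>d \<in> el a. (d, c) \<in> rel_of M (v e)))))" for e
    unfolding good_def all_rel_of by simp
qed

lemma Df_acts:
  assumes "Dt K t" "Dt K u" "Dt K v" shows "Df K (\<lambda>e. acts M (t e) (u e) (v e))"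
proof (rule Df_cong)
  show "Df K (\<lambda>e. \<exists>s \<in> U. \<exists>h \<in> U. good (t e) s h \<and> u e \<in> el s \<and> (u e, v e) \<in> rel_of M h)"
    by (rule assms Df_good Df_rel_of Df_logic Dt_var Dt_shift)+
qed (use good_in_U in \<open>unfold acts_good, blast\<close>)

lemma good_total: "good g t h \<Longrightarrow> u \<in> el t \<Longrightarrow> \<exists>v. (u, v) \<in> rel_of M h"
  unfolding good_def is_function_on_iff by blast

lemma good_functional: "good g t h \<Longrightarrow> (u, v) \<in> rel_of M h \<Longrightarrow> (u, v') \<in> rel_of M h \<Longrightarrow> v = v'"
  unfolding good_def is_function_on_iff by blast

lemma good_trans: "good g t h \<Longrightarrow> u \<in> el t \<Longrightarrow> w \<in> el u \<Longrightarrow> w \<in> el t"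
  unfolding good_def is_transitive_def by blast

lemma good_atom: "good g t h \<Longrightarrow> (u, v) \<in> rel_of M h \<Longrightarrow> atom M u \<Longrightarrow> (u, v) \<in> rel_of M g"
  unfolding good_def by metis

lemma good_set: "good g t h \<Longrightarrow> (u, v) \<in> rel_of M h \<Longrightarrow> \<not> atom M u \<Longrightarrow>
    is_set M v \<and> el v = rel_of M h `` el u"
  unfolding good_def by metis

lemma G_functional: "g \<in> G \<Longrightarrow> (u, v) \<in> rel_of M g \<Longrightarrow> (u, v') \<in> rel_of M g \<Longrightarrow> v = v'"
  unfolding G_iff by (blast dest: bijrelD(4))

text \<open>Two witnesses \<open>h\<close> and \<open>h'\<close> may live on different transitive
  sets. By induction on membership they agree on the elements of \<open>x\<close>, hence give
  \<open>x\<close> the same image.\<close>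

lemma acts_unique:
  assumes g: "g \<in> G" and "acts M g x y" "acts M g x y'" shows "y = y'"
proof -
  have "x \<in> U" using acts_in_U assms by blast
  then have "\<forall>y \<in> U. \<forall>y' \<in> U. acts M g x y \<and> acts M g x y' \<longrightarrow> y = y'"
  proof (induction rule: eps_induct)
    show "Df U (\<lambda>e. \<forall>y \<in> U. \<forall>y' \<in> U. acts M g (e 0) y \<and> acts M g (e 0) y' \<longrightarrow> y = y')"
      by (rule Df_acts Df_logic Dt_var Dt_const G_in_U[OF g])+
  next
    fix x assume x: "x \<in> U"
      and IH: "\<And>z. z \<in> el x \<Longrightarrow> \<forall>y \<in> U. \<forall>y' \<in> U. acts M g z y \<and> acts M g z y' \<longrightarrow> y = y'"
    show "\<forall>y \<in> U. \<forall>y' \<in> U. acts M g x y \<and> acts M g x y' \<longrightarrow> y = y'"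
    proof (intro ballI impI)
      fix y y' assume "acts M g x y \<and> acts M g x y'"
      then obtain t h t' h' where t: "good g t h" "x \<in> el t" "(x, y) \<in> rel_of M h"
        and t': "good g t' h'" "x \<in> el t'" "(x, y') \<in> rel_of M h'"
        unfolding acts_good by blast
      show "y = y'"
      proof (cases "atom M x")
        case True
        show ?thesis using G_functional[OF g good_atom[OF t(1,3) True] good_atom[OF t'(1,3) True]] .
      next
        case False
        have same: "(z, v) \<in> rel_of M h \<longleftrightarrow> (z, v) \<in> rel_of M h'" if z: "z \<in> el x" for z v
        proof -
          have zt: "z \<in> el t" "z \<in> el t'" using good_trans t t' z by blast+
          obtain w w' where w: "(z, w) \<in> rel_of M h" "(z, w') \<in> rel_of M h'"
            using good_total[OF t(1) zt(1)] good_total[OF t'(1) zt(2)] by blast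
          have "acts M g z w" "acts M g z w'" unfolding acts_good using w zt t(1) t'(1) by blast+
          then have "w = w'" using IH[OF z] acts_in_U by blast
          then show ?thesis using w good_functional[OF t(1)] good_functional[OF t'(1)] by blast
        qed
        have y: "is_set M y \<and> el y = rel_of M h `` el x" "is_set M y' \<and> el y' = rel_of M h' `` el x"
          using good_set[OF t(1,3) False] good_set[OF t'(1,3) False] by blast+
        have "rel_of M h `` el x = rel_of M h' `` el x" using same by blast
        then show ?thesis using y ext_set by simp
      qed
    qed
  qed
  then show ?thesis using assms acts_in_U by blast
qed

lemma acts_total:
  assumes g: "g \<in> G" and "x \<in> U" shows "\<exists>y. acts M g x y"
proof -
  from assms(2) have "\<exists>y \<in> U. acts M g x y"
  proof (induction rule: eps_induct)
    show "Df U (\<lambda>e. \<exists>y \<in> U. acts M g (e 0) y)"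
      by (rule Df_acts Df_logic Dt_var Dt_const G_in_U[OF g])+
  next
    fix x assume x: "x \<in> U" and IH: "\<And>z. z \<in> el x \<Longrightarrow> \<exists>y \<in> U. acts M g z y"
    obtain t where t: "is_transitive M t" "x \<in> el t" using transitive_set_ex[OF x] by blast
    \<comment> \<open>\<open>?S\<close> is transitive, so that a witness for \<open>x\<close> is the action on \<open>?S\<close> extended by one pair.\<close>
    let ?S = "{w \<in> el t. \<exists>y \<in> U. acts M g w y}"
    let ?P = "\<lambda>w v. w \<in> el t \<and> acts M g w v"
    have tU: "t \<in> U" using t(1) by (simp add: is_transitive_def)
    have D: "Df U (\<lambda>e. \<exists>y \<in> U. acts M g (e 0) y)"
      by (rule Df_acts Df_logic Dt_var Dt_const G_in_U[OF g])+
    have S: "internal ?S" by (rule internal_sep[OF D internal_el[OF tU]])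
    have x_sub: "el x \<subseteq> ?S" using t IH unfolding is_transitive_def by blast
    have S_trans: "el w \<subseteq> ?S" if w: "w \<in> ?S" for w
    proof
      fix z assume z: "z \<in> el w"
      obtain y where "acts M g w y" using w by blast
      then obtain t' h' where t': "good g t' h'" "w \<in> el t'" unfolding acts_good by blast
      then have "z \<in> el t'" using good_trans z by blast
      moreover from this obtain v where "(z, v) \<in> rel_of M h'" using good_total t' by blast
      ultimately have "acts M g z v" using t' unfolding acts_good by blast
      then show "z \<in> ?S" using z w t(1) acts_in_U unfolding is_transitive_def by blast
    qed
    have D2: "Df U (\<lambda>e. acts M g (e 0) (e 1))"
      by (rule Df_acts Dt_var Dt_const G_in_U[OF g])+
    have I: "internal {v \<in> U. \<exists>u \<in> ?S. acts M g u v}"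
      by (rule internal_repl[OF D2 S]) (use acts_unique[OF g] in blast)
    from irel_sep2[OF S I D2]
    have R: "irel {(u, v). u \<in> ?S \<and> v \<in> {v \<in> U. \<exists>u \<in> ?S. acts M g u v} \<and> acts M g u v}" (is "irel ?R") .
    have Ix: "internal {v \<in> U. \<exists>u \<in> el x. acts M g u v}"
      by (rule internal_repl[OF D2 internal_el[OF x]]) (use acts_unique[OF g] in blast)
    have R_iff: "(u, v) \<in> ?R \<longleftrightarrow> u \<in> ?S \<and> acts M g u v" for u v
      using acts_in_U by blast
    show "\<exists>y \<in> U. acts M g x y"
    proof (cases "x \<in> ?S")
      case True then show ?thesis by blast
    next
      case False
      obtain y where y: "y \<in> U" "if atom M x then (x, y) \<in> rel_of M g
          else is_set M y \<and> el y = {v \<in> U. \<exists>u \<in> el x. acts M g u v}"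
      proof (cases "atom M x")
        case True
        then have "x \<in> el A" using x by (simp add: el_A)
        then obtain y where "(x, y) \<in> rel_of M g" using g unfolding G_iff bijrel_def by blast
        then show ?thesis using that True rel_of_in_U by simp
      next
        case False
        then show ?thesis using that[of "mk {v \<in> U. \<exists>u \<in> el x. acts M g u v}"] Ix by simp
      qed
      let ?Q = "insert (x, y) ?R"
      have Q: "irel ?Q" using R x y(1) by (rule irel_insert)
      have T: "internal (insert x ?S)" using S x by (rule internal_insert)
      have "good g (mk (insert x ?S)) (mkr ?Q)"
        unfolding good_def is_function_on_iff rel_of_mkr[OF Q] el_mk[OF T] is_transitive_def
      proof (intro conjI allI impI ballI)
        show "is_set M (mk (insert x ?S))" using T by simp
        show "el u \<subseteq> insert x ?S" if "u \<in> insert x ?S" for u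
          using that x_sub S_trans[of u] by blast
        show "is_rel (mkr ?Q)" using Q by simp
        show "Domain ?Q \<subseteq> insert x ?S" by blast
        show "\<exists>!v. (u, v) \<in> ?Q" if u: "u \<in> insert x ?S" for u
        proof (cases "u = x")
          case True
          then show ?thesis using False by blast
        next
          case ux: False
          then obtain v where v: "acts M g u v" "u \<in> ?S" using u by blast
          have w: "(u, w) \<in> ?Q \<longleftrightarrow> w = v" for w using v ux R_iff acts_unique[OF g v(1)] by blast
          show ?thesis by (simp only: w, blast)
        qed
        fix u v assume uv: "(u, v) \<in> ?Q"
        show "if atom M u then (u, v) \<in> rel_of M g else is_set M v \<and> el v = ?Q `` el u"
        proof (cases "u = x")
          case True
          then have "v = y" using uv False by blast
          have "x \<notin> el x" using x_sub False by blast
          then have "(u, v) \<in> ?Q \<longleftrightarrow> acts M g u v" if "u \<in> el x" for u v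
            using x_sub R_iff[of u v] that by blast
          then have "?Q `` el x = {(u, v). acts M g u v} `` el x"
            by (intro Image_eq_on) blast
          then have "?Q `` el x = {v \<in> U. \<exists>u \<in> el x. acts M g u v}"
            using acts_in_U by blast
          then show ?thesis using y(2) True \<open>v = y\<close> by simp
        next
          case ux: False
          then have uv': "u \<in> ?S" "acts M g u v" using uv by blast+
          then obtain t' h' where t': "good g t' h'" "u \<in> el t'" "(u, v) \<in> rel_of M h'"
            unfolding acts_good by blast
          show ?thesis
          proof (cases "atom M u")
            case True
            then show ?thesis using good_atom[OF t'(1,3)] by simp
          next
            case nat: False
            have us: "el u \<subseteq> ?S" using S_trans uv' by blast
            have *: "(z, w) \<in> rel_of M h' \<longleftrightarrow> acts M g z w" if "z \<in> el u" for z w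
            proof
              have zt: "z \<in> el t'" using good_trans t' that by blast
              show "acts M g z w" if "(z, w) \<in> rel_of M h'" using that t' zt unfolding acts_good by blast
              assume a: "acts M g z w"
              obtain w' where w': "(z, w') \<in> rel_of M h'" using good_total[OF t'(1) zt] by blast
              then have "acts M g z w'" using t' zt unfolding acts_good by blast
              then show "(z, w) \<in> rel_of M h'" using w' acts_unique[OF g a] by simp
            qed
            have "rel_of M h' `` el u = ?Q `` el u"
            proof (rule Image_eq_on)
              fix z w assume z: "z \<in> el u"
              then have "z \<in> ?S" "z \<noteq> x" using us False by blast+
              then show "(z, w) \<in> rel_of M h' \<longleftrightarrow> (z, w) \<in> ?Q" using *[OF z, of w] R_iff[of z w] by blast
            qed
            then show ?thesis using good_set[OF t'(1,3) nat] nat by simp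
          qed
        qed
      qed
      then have "acts M g x y"
        by (rule actsI) (simp_all only: el_mk[OF T] rel_of_mkr[OF Q] insert_iff simp_thms)
      then show ?thesis using y(1) by blast
    qed
  qed
  then show ?thesis by blast
qed

definition act :: "'a \<Rightarrow> 'a \<Rightarrow> 'a" where
  "act g x = (THE y. acts M g x y)"

lemma acts_iff: "g \<in> G \<Longrightarrow> x \<in> U \<Longrightarrow> acts M g x y \<longleftrightarrow> y = act g x"
  unfolding act_def by (metis acts_total acts_unique the_equality)

lemma act_in_U [simp]: "g \<in> G \<Longrightarrow> x \<in> U \<Longrightarrow> act g x \<in> U"
  using acts_iff acts_in_U by blast

lemma act_atom: "g \<in> G \<Longrightarrow> a \<in> el A \<Longrightarrow> (a, y) \<in> rel_of M g \<longleftrightarrow> y = act g a"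
proof -
  assume g: "g \<in> G" and a: "a \<in> el A"
  then have "acts M g a (act g a)" using acts_iff by simp
  then obtain t h where "good g t h" "(a, act g a) \<in> rel_of M h" unfolding acts_good by blast
  then have "(a, act g a) \<in> rel_of M g" using good_atom a el_A by blast
  then show ?thesis using G_functional[OF g] by blast
qed

lemma act_set:
  assumes g: "g \<in> G" and x: "is_set M x"
  shows "is_set M (act g x)" "el (act g x) = act g ` el x"
proof -
  have "acts M g x (act g x)" using acts_iff g x by simp
  then obtain t h where h: "good g t h" "x \<in> el t" "(x, act g x) \<in> rel_of M h" unfolding acts_good by blast
  have "\<not> atom M x" using x by (simp add: is_set_def)
  note s = good_set[OF h(1,3) this]
  then show "is_set M (act g x)" by blast
  have "(u, v) \<in> rel_of M h \<longleftrightarrow> v = act g u" if "u \<in> el x" for u v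
  proof -
    have ut: "u \<in> el t" using good_trans h that by blast
    obtain w where w: "(u, w) \<in> rel_of M h" using good_total[OF h(1) ut] by blast
    then have "acts M g u w" unfolding acts_good using h ut by blast
    then have "w = act g u" using acts_iff[OF g el_in_U[OF ut]] by blast
    then show ?thesis using w good_functional[OF h(1)] by blast
  qed
  then have "rel_of M h `` el x = act g ` el x" by blast
  then show "el (act g x) = act g ` el x" using s by simp
qed

lemma act_in_A: "g \<in> G \<Longrightarrow> a \<in> el A \<Longrightarrow> act g a \<in> el A"
  using act_atom[of g a "act g a"] unfolding G_iff bijrel_def by blast

lemma Df_act_eq:
  assumes "g \<in> G" "g \<in> K" "Dt K t" "Dt K u" shows "Df K (\<lambda>e. u e = act g (t e))"
  by (rule Df_cong[OF Df_acts[OF Dt_const[OF assms(2)] assms(3,4)]])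
    (use assms Dt_in_U[OF assms(3)] in \<open>simp_all add: acts_iff\<close>)

text \<open>\<open>O\<close> composes from left to right, so \<open>h\<close> acts first. For atoms
  the equation is the composition of the relations, and it spreads to sets by induction on
  membership.\<close>

lemma act_comp:
  assumes "g \<in> G" "h \<in> G" "k \<in> G" "rel_of M k = rel_of M h O rel_of M g" "x \<in> U"
  shows "act k x = act g (act h x)"
proof -
  from \<open>x \<in> U\<close> have "\<exists>y \<in> U. y = act h x \<and> (\<exists>z \<in> U. z = act g y \<and> z = act k x)"
  proof (induction rule: eps_induct)
    show "Df U (\<lambda>e. \<exists>y \<in> U. y = act h (e 0) \<and> (\<exists>z \<in> U. z = act g y \<and> z = act k (e 0)))"
      by (rule Df_act_eq Df_logic Dt_var assms G_in_U)+
  next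
    fix x assume x: "x \<in> U" and "\<And>z. z \<in> el x \<Longrightarrow> \<exists>y \<in> U. y = act h z \<and> (\<exists>w \<in> U. w = act g y \<and> w = act k z)"
    then have IH: "\<And>z. z \<in> el x \<Longrightarrow> act k z = act g (act h z)" by simp
    have "act k x = act g (act h x)"
    proof (cases "atom M x")
      case True
      then have a: "x \<in> el A" using x by (simp add: el_A)
      have "(x, act g (act h x)) \<in> rel_of M h O rel_of M g"
        using act_atom[OF assms(2) a] act_atom[OF assms(1) act_in_A[OF assms(2) a]] by blast
      then show ?thesis using act_atom[OF assms(3) a] assms(4) by simp
    next
      case False
      then have s: "is_set M x" using x by (simp add: is_set_def)
      show ?thesis
      proof (rule ext_set)
        show "el (act k x) = el (act g (act h x))"
          using act_set assms s IH by (simp add: image_image)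
      qed (use act_set assms s in simp_all)
    qed
    then show "\<exists>y \<in> U. y = act h x \<and> (\<exists>z \<in> U. z = act g y \<and> z = act k x)"
      using x assms by simp
  qed
  then show ?thesis by simp
qed

lemma act_id:
  assumes "i \<in> G" "rel_of M i = Id_on (el A)" "x \<in> U" shows "act i x = x"
  using assms(3)
proof (induction rule: eps_induct)
  have "Df U (\<lambda>e. e 0 = act i (e 0))"
    by (rule Df_act_eq Dt_var assms G_in_U)+
  then show "Df U (\<lambda>e. act i (e 0) = e 0)" by (simp add: eq_commute)
next
  fix x assume x: "x \<in> U" and IH: "\<And>y. y \<in> el x \<Longrightarrow> act i y = y"
  show "act i x = x"
  proof (cases "atom M x")
    case True
    then have a: "x \<in> el A" using x by (simp add: el_A)
    then show ?thesis using act_atom[OF assms(1) a, of x] assms(2) by (simp add: Id_on_def)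
  next
    case False
    then have s: "is_set M x" using x by (simp add: is_set_def)
    show ?thesis
      by (rule ext_set) (use act_set assms(1) s IH in auto)
  qed
qed

lemma G_id: "\<exists>i \<in> G. rel_of M i = Id_on (el A)"
proof -
  have D: "Df U (\<lambda>e. e 0 = e 1)" by (rule Df_logic Dt_var)+
  have "irel {(x, y). x \<in> el A \<and> y \<in> el A \<and> x = y}" by (rule irel_sep2[OF _ _ D]) simp_all
  moreover have "{(x, y). x \<in> el A \<and> y \<in> el A \<and> x = y} = Id_on (el A)" by (auto simp: Id_on_def)
  ultimately have I: "irel (Id_on (el A))" by simp
  have "bijrel (Id_on (el A)) (el A) (el A)" by (auto intro: bijrelI)
  then show ?thesis using mkr_in_G[OF I] I by (intro bexI[of _ "mkr (Id_on (el A))"]) auto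
qed

lemma G_comp:
  assumes "g \<in> G" "h \<in> G" shows "\<exists>k \<in> G. rel_of M k = rel_of M h O rel_of M g"
proof -
  note gr = assms[unfolded G_iff]
  have I: "irel (rel_of M h O rel_of M g)" using gr by (blast intro: irel_comp irel_rel_of)
  note r = bijrelD[OF conjunct2[OF gr(1)]] and q = bijrelD[OF conjunct2[OF gr(2)]]
  have "bijrel (rel_of M h O rel_of M g) (el A) (el A)"
  proof (rule bijrelI)
    show "rel_of M h O rel_of M g \<subseteq> el A \<times> el A" using r(1) q(1) by blast
    show "\<exists>y. (x, y) \<in> rel_of M h O rel_of M g" if "x \<in> el A" for x
      using q(1) q(2)[OF that] r(2) by blast
    show "\<exists>x. (x, y) \<in> rel_of M h O rel_of M g" if "y \<in> el A" for y
      using r(1) r(3)[OF that] q(3) by blast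
    show "y = y'" if "(x, y) \<in> rel_of M h O rel_of M g" "(x, y') \<in> rel_of M h O rel_of M g" for x y y'
      using that r(4) q(4) by blast
    show "x = x'" if "(x, y) \<in> rel_of M h O rel_of M g" "(x', y) \<in> rel_of M h O rel_of M g" for x x' y
      using that r(5) q(5) by blast
  qed
  then show ?thesis using mkr_in_G[OF I] I by (intro bexI[of _ "mkr (rel_of M h O rel_of M g)"]) auto
qed

lemma G_inv:
  assumes "g \<in> G" shows "\<exists>k \<in> G. rel_of M k = (rel_of M g)\<inverse>"
proof -
  have I: "irel ((rel_of M g)\<inverse>)" using assms unfolding G_iff by (blast intro: irel_converse irel_rel_of)
  have "bijrel ((rel_of M g)\<inverse>) (el A) (el A)"
    using assms unfolding G_iff by (blast intro: bijrel_converse)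
  then show ?thesis using mkr_in_G[OF I] I by (intro bexI[of _ "mkr ((rel_of M g)\<inverse>)"]) auto
qed

lemma bijrel_O_converse:
  assumes "bijrel R S T" shows "R O R\<inverse> = Id_on S"
proof (intro subset_antisym subrelI)
  note r = bijrelD[OF assms]
  show "(x, z) \<in> Id_on S" if "(x, z) \<in> R O R\<inverse>" for x z
    using that r(1,5) by blast
  show "(x, z) \<in> R O R\<inverse>" if "(x, z) \<in> Id_on S" for x z
    using that r(2)[of x] by blast
qed

lemma act_inv:
  assumes "g \<in> G" "k \<in> G" "rel_of M k = (rel_of M g)\<inverse>" "x \<in> U"
  shows "act k (act g x) = x" "act g (act k x) = x"
proof -
  obtain i where i: "i \<in> G" "rel_of M i = Id_on (el A)" using G_id by blast
  have b: "bijrel (rel_of M g) (el A) (el A)" using assms(1) by (simp add: G_iff)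
  have "rel_of M g O rel_of M k = Id_on (el A)"
    unfolding assms(3) by (rule bijrel_O_converse[OF b])
  then show "act k (act g x) = x"
    using act_comp[OF assms(2,1) i(1)] act_id[OF i] assms(4) i(2) by simp
  have "rel_of M k O rel_of M g = Id_on (el A)"
    using bijrel_O_converse[OF bijrel_converse[OF b]] by (simp add: assms(3))
  then show "act g (act k x) = x"
    using act_comp[OF assms(1,2) i(1)] act_id[OF i] assms(4) i(2) by simp
qed

text \<open>Together with \<open>automorphism_Df\<close> this makes every predicate definable from
  fixed parameters invariant under the group action.\<close>

lemma automorphism_act:
  assumes g: "g \<in> G" shows "automorphism (act g)"
proof -
  obtain k where k: "k \<in> G" "rel_of M k = (rel_of M g)\<inverse>" using G_inv[OF g] by blast
  have bij: "bij_betw (act g) U U"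
    by (rule bij_betw_byWitness[of _ "act k"]) (use g k act_inv[OF g k] in auto)
  have atom: "atom M (act g x) = atom M x" if "x \<in> U" for x
    using act_in_A[OF g, of x] act_set(1)[OF g, of x] that unfolding el_A is_set_def by blast
  have "mem M (act g x) (act g y) = mem M x y" if x: "x \<in> U" and y: "y \<in> U" for x y
  proof -
    have "act g x \<in> el (act g y) \<longleftrightarrow> x \<in> el y"
    proof (cases "atom M y")
      case True
      then show ?thesis using atom[OF y] el_atom y g by simp
    next
      case False
      then have "is_set M y" using y by (simp add: is_set_def)
      then show ?thesis
        using act_set(2)[OF g] bij x el_in_U unfolding bij_betw_def by (auto dest: inj_onD)
    qed
    then show ?thesis using x y g unfolding elems_def by simp
  qed
  then show ?thesis using bij atom unfolding automorphism_def by blast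
qed

end

section \<open>The finite partition model\<close>

context zfa
begin

lemma Df_in_closure: 
  assumes "Dt K t" "Dt K u" shows "Df K (\<lambda>e. in_closure M (t e) (u e))"
proof (rule Df_cong)
  show "Df K (\<lambda>e. \<forall>s \<in> U. is_transitive M s \<and> t e \<in> el s \<longrightarrow> u e \<in> el s)"
    by (rule assms Df_is_transitive Df_logic Dt_var Dt_shift)+
  show "in_closure M (t e) (u e) \<longleftrightarrow> (\<forall>s \<in> U. is_transitive M s \<and> t e \<in> el s \<longrightarrow> u e \<in> el s)"
    if "range e \<subseteq> U" for e
    using Dt_in_U[OF assms(2) that] unfolding in_closure_def is_transitive_def by auto
qed

lemma in_closure_refl: "x \<in> U \<Longrightarrow> in_closure M x x"
  by (simp add: in_closure_def)

lemma in_closure_step: "y \<in> el x \<Longrightarrow> in_closure M y z \<Longrightarrow> in_closure M x z"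
  unfolding in_closure_def is_transitive_def by blast

text \<open>Inside a transitive set, \<open>x\<close> together with the closures of its elements is
  again transitive, so it already contains the closure of \<open>x\<close>. This reduces hereditary
  symmetry of \<open>x\<close> to that of its elements.\<close>

lemma in_closure_cases:
  assumes "in_closure M x z" "x \<in> U"
  shows "z = x \<or> (\<exists>y \<in> el x. in_closure M y z)"
proof -
  obtain t where t: "is_transitive M t" "x \<in> el t" using transitive_set_ex[OF assms(2)] by blast
  have tU: "t \<in> U" using t by (simp add: is_transitive_def)
  let ?S = "{w \<in> el t. w = x \<or> (\<exists>y \<in> el x. in_closure M y w)}"
  have "Df U (\<lambda>e. e 0 = x \<or> (\<exists>y \<in> el x. in_closure M y (e 0)))"
    by (rule Df_in_closure Df_logic Dt_var Dt_const assms)+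
  then have S: "internal ?S" by (rule internal_sep) (simp add: tU)
  have "el u \<subseteq> ?S" if u: "u \<in> ?S" for u
  proof
    fix v assume v: "v \<in> el u"
    have vt: "v \<in> el t" using u v t(1) unfolding is_transitive_def by blast
    consider "u = x" | y where "y \<in> el x" "in_closure M y u" using u by blast
    then show "v \<in> ?S"
    proof cases
      case 1
      then show ?thesis using v vt in_closure_refl[OF el_in_U[OF v]] by blast
    next
      case (2 y)
      then have "in_closure M y v" using v unfolding in_closure_def is_transitive_def by (blast intro: el_in_U)
      then show ?thesis using vt 2 by blast
    qed
  qed
  then have "is_transitive M (mk ?S)" unfolding is_transitive_def el_mk[OF S] using is_set_mk[OF S] by blast
  then have "z \<in> el (mk ?S)" using assms(1) t el_mk[OF S] unfolding in_closure_def by blast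
  then show ?thesis unfolding el_mk[OF S] by blast
qed

end

context zfa_atoms
begin

lemma act_mk:
  assumes "g \<in> G" "internal S" shows "act g (mk S) = mk (act g ` S)"
  using act_set[OF assms(1) is_set_mk[OF assms(2)]] assms(2) by (intro mk_eqI[symmetric]) simp_all

lemma act_Pr:
  assumes "g \<in> G" "x \<in> U" "y \<in> U" shows "act g (Pr x y) = Pr (act g x) (act g y)"
  using assms by (simp add: Pr_def act_mk)

lemma act_inj: "g \<in> G \<Longrightarrow> x \<in> U \<Longrightarrow> y \<in> U \<Longrightarrow> act g x = act g y \<longleftrightarrow> x = y"
  using automorphism_inj[OF automorphism_act] .

lemma act_el: "g \<in> G \<Longrightarrow> x \<in> U \<Longrightarrow> el (act g x) = act g ` el x"
  using automorphism_el[OF automorphism_act] .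

lemma act_mem: "g \<in> G \<Longrightarrow> x \<in> U \<Longrightarrow> y \<in> U \<Longrightarrow> act g x \<in> el (act g y) \<longleftrightarrow> x \<in> el y"
  unfolding act_el image_iff using act_inj[of g x] el_in_U by blast

lemma act_is_set: "g \<in> G \<Longrightarrow> x \<in> U \<Longrightarrow> is_set M (act g x) \<longleftrightarrow> is_set M x"
  using automorphism_is_set[OF automorphism_act] .

lemma act_rel_of:
  assumes "g \<in> G" "x \<in> U" "y \<in> U" "f \<in> U"
  shows "(act g x, act g y) \<in> rel_of M (act g f) \<longleftrightarrow> (x, y) \<in> rel_of M f"
  using assms by (simp add: rel_of_iff act_mem flip: act_Pr)

lemma fixed_rel_of:
  assumes "g \<in> G" "act g f = f" "f \<in> U" "(x, y) \<in> rel_of M f"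
  shows "(act g x, act g y) \<in> rel_of M f"
  using act_rel_of[OF assms(1) _ _ assms(3), of x y] assms(2,4) rel_of_in_U[OF assms(4)] by simp

text \<open>Invariance gives \<open>act g x \<in> S\<close> iff \<open>x \<in> S\<close>; as
  \<open>act g\<close> maps \<open>U\<close> onto itself, the image of \<open>S\<close> is exactly
  \<open>S\<close>.\<close>

lemma fixed_mk:
  assumes "g \<in> G" "internal S" "Df K (\<lambda>e. e 0 \<in> S)" "\<And>k. k \<in> K \<Longrightarrow> k \<in> U \<Longrightarrow> act g k = k"
  shows "act g (mk S) = mk S"
proof (rule ext_set)
  have x: "act g x \<in> S \<longleftrightarrow> x \<in> S" if "x \<in> U" for x
    by (rule automorphism_Df1[OF assms(3) automorphism_act[OF assms(1)] assms(4) that])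
  have bij: "act g ` U = U"
    using automorphism_act[OF assms(1)] by (auto simp: automorphism_def bij_betw_def)
  have SU: "S \<subseteq> U" using internal_subset_U[OF assms(2)] .
  have "act g ` S = S"
  proof
    show "act g ` S \<subseteq> S" using x SU by blast
    show "S \<subseteq> act g ` S"
    proof
      fix y assume y: "y \<in> S"
      then obtain z where "z \<in> U" "y = act g z" using bij SU by blast
      then show "y \<in> act g ` S" using x y by blast
    qed
  qed
  then show "el (act g (mk S)) = el (mk S)" using act_set[OF assms(1) is_set_mk[OF assms(2)]] assms(2) by simp
qed (use act_set[OF assms(1) is_set_mk[OF assms(2)]] assms(2) in simp_all)

lemma act_elementwise:
  assumes "g \<in> G" "is_set M x" "\<And>y. y \<in> el x \<Longrightarrow> act g y = y" shows "act g x = x"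
  by (rule ext_set) (use act_set[OF assms(1,2)] assms(2,3) in auto)

text \<open>For \<open>a = b\<close> this is the identity, so transpositions can be used without
  assuming distinct points.\<close>

definition swap :: "'a \<Rightarrow> 'a \<Rightarrow> 'a" where
  "swap a b = mkr {(x, y). x \<in> el A \<and> y \<in> el A \<and> (x = a \<and> y = b \<or> x = b \<and> y = a \<or> x \<noteq> a \<and> x \<noteq> b \<and> y = x)}"

lemma
  assumes a: "a \<in> el A" and b: "b \<in> el A"
  shows swap_in_G: "swap a b \<in> G"
    and act_swap: "act (swap a b) a = b" "act (swap a b) b = a"
      "c \<in> el A \<Longrightarrow> c \<noteq> a \<Longrightarrow> c \<noteq> b \<Longrightarrow> act (swap a b) c = c"
proof -
  let ?R = "{(x, y). x \<in> el A \<and> y \<in> el A \<and> (x = a \<and> y = b \<or> x = b \<and> y = a \<or> x \<noteq> a \<and> x \<noteq> b \<and> y = x)}"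
  have "Df U (\<lambda>e. e 0 = a \<and> e 1 = b \<or> e 0 = b \<and> e 1 = a \<or> e 0 \<noteq> a \<and> e 0 \<noteq> b \<and> e 1 = e 0)"
    by (rule Df_logic Dt_var Dt_const el_in_U[OF a] el_in_U[OF b])+
  from irel_sep2[OF _ _ this] have R: "irel ?R" by simp
  moreover have "bijrel ?R (el A) (el A)"
  proof (rule bijrelI)
    show "\<exists>y. (x, y) \<in> ?R" if "x \<in> el A" for x
      using that a b by (cases "x = a"; cases "x = b") auto
    show "\<exists>x. (x, y) \<in> ?R" if "y \<in> el A" for y
      using that a b by (cases "y = a"; cases "y = b") auto
  qed blast+
  ultimately show G: "swap a b \<in> G" unfolding swap_def by (rule mkr_in_G)
  have r: "rel_of M (swap a b) = ?R" unfolding swap_def using R by (rule rel_of_mkr)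
  have *: "act (swap a b) x = y" if "(x, y) \<in> ?R" for x y
  proof -
    have "x \<in> el A" using that by blast
    then show ?thesis using iffD1[OF act_atom[OF G, of x y, unfolded r] that] by simp
  qed
  show "act (swap a b) a = b" "act (swap a b) b = a" using * a b by blast+
  show "c \<in> el A \<Longrightarrow> c \<noteq> a \<Longrightarrow> c \<noteq> b \<Longrightarrow> act (swap a b) c = c" using * by blast
qed

lemma act_swap_set:
  assumes a: "a \<in> el A" "b \<in> el A" "is_set M x" "el x \<subseteq> el A" "a \<in> el x \<longleftrightarrow> b \<in> el x"
  shows "act (swap a b) x = x"
proof (rule ext_set)
  note s = act_swap[OF a(1,2)]
  have "act (swap a b) ` el x = el x"
  proof
    have *: "act (swap a b) y \<in> el x \<and> act (swap a b) (act (swap a b) y) = y" if y: "y \<in> el x" for y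
    proof -
      have "y \<in> el A" using a(4) y by blast
      then consider "y = a" | "y = b" | "y \<noteq> a" "y \<noteq> b" "y \<in> el A" by blast
      then show ?thesis using s a(5) y by cases simp_all
    qed
    show "act (swap a b) ` el x \<subseteq> el x" using * by blast
    show "el x \<subseteq> act (swap a b) ` el x"
    proof
      fix y assume "y \<in> el x"
      then show "y \<in> act (swap a b) ` el x" using *[of y] by (intro image_eqI[of _ _ "act (swap a b) y"]) simp_all
    qed
  qed
  then show "el (act (swap a b) x) = el x" using act_set[OF swap_in_G[OF a(1,2)] a(3)] by simp
qed (use act_set[OF swap_in_G[OF a(1,2)] a(3)] a(3) in simp_all)

text \<open>Members of the filter are sets of \<open>M\<close>; stabilizers become such sets by
  separation from the set of all permutations.\<close>

lemma internal_G: "internal G"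
proof -
  have R: "irel (el A \<times> el A)" by (rule irel_Times) simp_all
  have "internal {g \<in> {z. is_set M z \<and> el z \<subseteq> el (mkr (el A \<times> el A))}. is_bijection M g A A}"
  proof (rule internal_sep)
    show "Df U (\<lambda>e. is_bijection M (e 0) A A)" by (rule Df_funs Dt_var Dt_const A_simps)+
    show "internal {z. is_set M z \<and> el z \<subseteq> el (mkr (el A \<times> el A))}" 
      by (rule internal_Pow) (simp add: R)
  qed
  moreover have "{g \<in> {z. is_set M z \<and> el z \<subseteq> el (mkr (el A \<times> el A))}. is_bijection M g A A} = G"
  proof -
    have "is_set M g \<and> el g \<subseteq> el (mkr (el A \<times> el A))" if "is_bijection M g A A" for g
    proof -
      have g: "is_rel g" "rel_of M g \<subseteq> el A \<times> el A" using that by (auto simp: is_bijection_iff bijrel_def)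
      have "codes (rel_of M g) \<subseteq> codes (el A \<times> el A)" using g(2) unfolding codes_def by blast
      then show ?thesis using g(1) is_rel_codes[OF g(1)] el_mkr[OF R] by (simp add: is_rel_def)
    qed
    then show ?thesis unfolding permutations_def by blast
  qed
  ultimately show ?thesis by simp
qed

section \<open>Supports and the universe of the model\<close>

definition fin_part :: "'a \<Rightarrow> bool" where
  "fin_part Q \<longleftrightarrow> is_partition M A Q \<and> finite_in M Q"

text \<open>The permutations considered map every block onto itself as a set; they may move the
  atoms inside it.\<close>

definition supports :: "'a \<Rightarrow> 'a \<Rightarrow> bool" where
  "supports Q x \<longleftrightarrow> (\<forall>g \<in> G. (\<forall>B \<in> el Q. act g B = B) \<longrightarrow> act g x = x)"

abbreviation "\<F> \<equiv> finite_partition_filter M A"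

lemma fix_pointwise_iff: "fix_pointwise M G Q = {g \<in> G. \<forall>B \<in> el Q. act g B = B}"
  unfolding fix_pointwise_def using acts_iff el_in_U by (metis (no_types, lifting))

text \<open>This replaces the filter by supports. For the backward direction the stabilizer of
  \<open>x\<close> is formed as a set of \<open>M\<close> and checked to be a subgroup; it then
  belongs to the filter because of \<open>Q\<close>.\<close>

lemma symmetric_iff:
  assumes x: "x \<in> U"
  shows "symmetric M G \<F> x \<longleftrightarrow> (\<exists>Q. fin_part Q \<and> supports Q x)"
proof
  assume "symmetric M G \<F> x"
  then obtain H Q where H: "fin_part Q" "fix_pointwise M G Q \<subseteq> el H" "el H = {g \<in> G. acts M g x x}"
    unfolding symmetric_def finite_partition_filter_def fin_part_def by blast
  have "supports Q x"
    unfolding supports_def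
  proof (intro ballI impI)
    fix g assume g: "g \<in> G" "\<forall>B \<in> el Q. act g B = B"
    then have "g \<in> el H" using H(2) unfolding fix_pointwise_iff by blast
    then show "act g x = x" using acts_iff[OF g(1) x, of x] unfolding H(3) by simp
  qed
  with H(1) show "\<exists>Q. fin_part Q \<and> supports Q x" by blast
next
  assume "\<exists>Q. fin_part Q \<and> supports Q x"
  then obtain Q where Q: "fin_part Q" "supports Q x" by blast
  let ?H = "{g \<in> G. acts M g x x}"
  have "Df U (\<lambda>e. acts M (e 0) x x)" by (rule Df_acts Dt_var Dt_const x)+
  then have H: "internal ?H" by (rule internal_sep) (rule internal_G)
  have H_iff: "g \<in> ?H \<longleftrightarrow> g \<in> G \<and> act g x = x" for g using acts_iff[OF _ x] by auto
  have "is_subgroup M A G (mk ?H)"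
    unfolding is_subgroup_def el_mk[OF H]
  proof (intro conjI ballI)
    show "is_set M (mk ?H)" using H by simp
    show "?H \<subseteq> G" by blast
    show "\<exists>i \<in> ?H. rel_of M i = Id_on (el A)"
      using G_id act_id[OF _ _ x] H_iff by blast
    show "\<exists>k \<in> ?H. rel_of M k = rel_of M h O rel_of M g" if "g \<in> ?H" "h \<in> ?H" for g h
    proof -
      have gh: "g \<in> G" "h \<in> G" "act g x = x" "act h x = x" using that H_iff by blast+
      obtain k where k: "k \<in> G" "rel_of M k = rel_of M h O rel_of M g" using G_comp[OF gh(1,2)] by blast
      have "act k x = x" using act_comp[OF gh(1,2) k x] gh by simp
      then show ?thesis using k H_iff by blast
    qed
    show "\<exists>k \<in> ?H. rel_of M k = (rel_of M g)\<inverse>" if "g \<in> ?H" for g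
    proof -
      have g: "g \<in> G" "act g x = x" using that H_iff by blast+
      obtain k where k: "k \<in> G" "rel_of M k = (rel_of M g)\<inverse>" using G_inv[OF g(1)] by blast
      have "act k x = x" using act_inv(1)[OF g(1) k x] g by simp
      then show ?thesis using k H_iff by blast
    qed
  qed
  moreover have "fix_pointwise M G Q \<subseteq> el (mk ?H)"
    using Q(2) unfolding el_mk[OF H] fix_pointwise_iff supports_def using H_iff by blast
  ultimately have "mk ?H \<in> \<F>"
    using Q(1) unfolding finite_partition_filter_def fin_part_def by blast
  then show "symmetric M G \<F> x"
    unfolding symmetric_def using el_mk[OF H] by blast
qed

abbreviation "V \<equiv> finite_partition_model M A"
abbreviation "VU \<equiv> univ V"

lemma V_simps: "mem V = mem M" "atom V = atom M"
  "VU = {x \<in> U. \<forall>y. in_closure M x y \<longrightarrow> symmetric M G \<F> y}"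
  by (simp_all add: finite_partition_model_def permutation_model_def)

lemma V_in_U [simp]: "x \<in> VU \<Longrightarrow> x \<in> U"
  by (simp add: V_simps)

lemma V_support: "x \<in> VU \<Longrightarrow> \<exists>Q. fin_part Q \<and> supports Q x"
  using symmetric_iff[of x] in_closure_refl[of x] unfolding V_simps(3) by blast

lemma V_trans: "x \<in> VU \<Longrightarrow> y \<in> el x \<Longrightarrow> y \<in> VU"
  using in_closure_step[of y x] el_in_U unfolding V_simps(3) by blast

lemma V_I: "x \<in> U \<Longrightarrow> el x \<subseteq> VU \<Longrightarrow> fin_part Q \<Longrightarrow> supports Q x \<Longrightarrow> x \<in> VU"
  using in_closure_cases[of x] symmetric_iff[of x] unfolding V_simps(3) by blast

lemma el_V: "x \<in> VU \<Longrightarrow> elems V x = el x"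
  using V_trans[of x] V_in_U unfolding elems_def V_simps(1) by blast

lemma is_set_V: "is_set V x \<longleftrightarrow> x \<in> VU \<and> is_set M x"
  using V_in_U unfolding is_set_def V_simps(1,2) by blast

lemma fin_part_blocks:
  assumes "fin_part Q"
  shows "Q \<in> U" "Fin (el Q)" "B \<in> el Q \<Longrightarrow> is_set M B" "B \<in> el Q \<Longrightarrow> el B \<subseteq> el A"
    "a \<in> el A \<Longrightarrow> \<exists>B \<in> el Q. a \<in> el B"
    "B \<in> el Q \<Longrightarrow> C \<in> el Q \<Longrightarrow> a \<in> el B \<Longrightarrow> a \<in> el C \<Longrightarrow> B = C"
proof -
  have Q: "is_set M Q" "Fin (el Q)" "\<forall>B \<in> el Q. is_set M B" "(\<Union>B \<in> el Q. el B) = el A"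
    "\<forall>B \<in> el Q. \<forall>C \<in> el Q. B \<noteq> C \<longrightarrow> el B \<inter> el C = {}"
    using assms unfolding fin_part_def is_partition_def finite_in_iff is_nonempty_set_def by blast+
  then show "Q \<in> U" "Fin (el Q)" "B \<in> el Q \<Longrightarrow> is_set M B" by simp_all
  show "B \<in> el Q \<Longrightarrow> el B \<subseteq> el A" "a \<in> el A \<Longrightarrow> \<exists>B \<in> el Q. a \<in> el B" using Q(4) by blast+
  show "B \<in> el Q \<Longrightarrow> C \<in> el Q \<Longrightarrow> a \<in> el B \<Longrightarrow> a \<in> el C \<Longrightarrow> B = C" using Q(5) by blast
qed

text \<open>Each block contains both \<open>a\<close> and \<open>b\<close> or neither of them, so
  the transposition maps every block to itself.\<close>

lemma supports_swap:
  assumes "fin_part Q" "supports Q x" "B \<in> el Q" "a \<in> el B" "b \<in> el B"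
  shows "act (swap a b) x = x"
proof -
  note Q = fin_part_blocks[OF assms(1)]
  have ab: "a \<in> el A" "b \<in> el A" using Q(4)[OF assms(3)] assms(4,5) by blast+
  have "act (swap a b) C = C" if C: "C \<in> el Q" for C
    using act_swap_set[OF ab Q(3)[OF C] Q(4)[OF C]] Q(6)[OF assms(3) C] assms(4,5) by blast
  then show ?thesis using assms(2) swap_in_G[OF ab] unfolding supports_def by blast
qed

text \<open>The atoms outside this finite set are those of the infinite blocks. It yields an
  infinite block, the critical member of the cofinite family, and the finite region that carries an
  antichain.\<close>

lemma Fin_small_blocks:
  assumes "fin_part Q"
  shows "Fin (\<Union>B \<in> {B \<in> el Q. Fin (el B)}. el B)"
proof (rule Fin_UN)
  have "Df U (\<lambda>e. Fin (el (e 0)))" by (rule Df_Fin Dt_var)+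
  then have "internal {B \<in> el Q. Fin (el B)}"
    by (rule internal_sep) (use fin_part_blocks[OF assms] in simp)
  then show "Fin {B \<in> el Q. Fin (el B)}"
    by (rule Fin_subset[OF fin_part_blocks(2)[OF assms], rotated]) blast
qed blast

text \<open>
  Finite supports suffice for all the objects constructed below. Unlike finite partitions, which need
  common refinements, they are combined by taking unions.
\<close>

definition fsupp :: "'a set \<Rightarrow> 'a \<Rightarrow> bool" where
  "fsupp E x \<longleftrightarrow> Fin E \<and> E \<subseteq> el A \<and> (\<forall>g \<in> G. (\<forall>a \<in> E. act g a = a) \<longrightarrow> act g x = x)"

lemma fsupp_mono: "fsupp E x \<Longrightarrow> Fin F \<Longrightarrow> E \<subseteq> F \<Longrightarrow> F \<subseteq> el A \<Longrightarrow> fsupp F x"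
  unfolding fsupp_def by blast

lemma fsupp_Pr:
  assumes "fsupp E x" "fsupp F y" "x \<in> U" "y \<in> U" shows "fsupp (E \<union> F) (Pr x y)"
  using assms unfolding fsupp_def by (auto simp: act_Pr)

lemma act_nat: 
  assumes g: "g \<in> G" and "n \<in> el om" shows "act g n = n"
  using assms(2)
proof (induction rule: om_induct)
  have "Df U (\<lambda>e. e 0 = act g (e 0))" by (rule Df_act_eq Dt_var g G_in_U)+
  then show "Df U (\<lambda>e. act g (e 0) = e 0)" by (simp add: eq_commute)
next
  show "act g emp = emp" by (rule act_elementwise[OF g]) simp_all
next
  fix k assume k: "k \<in> el om" "act g k = k"
  show "act g (sc k) = sc k"
  proof (rule ext_set)
    have kU: "k \<in> U" using k(1) by simp
    have "act g ` el k = el k" using act_el[OF g kU] k(2) by simp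
    then show "el (act g (sc k)) = el (sc k)"
      using act_el[OF g sc(3)[OF kU]] k(2) kU by simp
  qed (use act_is_set[OF g] k in simp_all)
qed

lemma fsupp_nat: "n \<in> el om \<Longrightarrow> fsupp {} n"
  by (simp add: fsupp_def act_nat)

end

locale zfa_countable_atoms = zfa_atoms +
  assumes countable_A: "countably_infinite_in M A"
begin

lemma A_eqp_om: "eqp (el A) (el om)"
  using countable_A by (simp add: countably_infinite_in_def is_omega_iff equipotent_iff)

lemma A_infinite: "\<not> Fin (el A)"
  using Fin_eqp[OF _ A_eqp_om] not_Fin_om by auto

lemma infinite_pick:
  assumes "\<not> Fin S" "internal S" "Fin T" obtains a where "a \<in> S" "a \<notin> T"
proof -
  have "\<not> S \<subseteq> T" using Fin_subset[OF assms(3) _ assms(2)] assms(1) by blast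
  then show thesis using that by blast
qed

lemma infinite_block:
  assumes "fin_part Q" obtains B where "B \<in> el Q" "\<not> Fin (el B)"
proof -
  obtain a where a: "a \<in> el A" "a \<notin> (\<Union>B \<in> {B \<in> el Q. Fin (el B)}. el B)"
    using infinite_pick[OF A_infinite internal_el[OF A_simps(2)] Fin_small_blocks[OF assms]] by blast
  then obtain B where "B \<in> el Q" "a \<in> el B" using fin_part_blocks(5)[OF assms] by blast
  then show thesis using a(2) that by blast
qed

text \<open>The partition consists of the singletons from \<open>E\<close> and the remaining block
  \<open>el A - E\<close>. A permutation fixing these blocks fixes every atom of
  \<open>E\<close>.\<close>

lemma fsupp_fin_part:
  assumes "fsupp E x" obtains Q where "fin_part Q" "supports Q x"
proof -
  have E: "Fin E" "E \<subseteq> el A" and fix_E: "\<And>g. g \<in> G \<Longrightarrow> \<forall>a \<in> E. act g a = a \<Longrightarrow> act g x = x"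
    using assms unfolding fsupp_def by blast+
  have EU: "internal E" using Fin_internal[OF E(1)] .
  let ?S = "{s \<in> U. \<exists>a \<in> E. is_upair M a a s}"
  have D: "Df U (\<lambda>e. is_upair M (e 0) (e 0) (e 1))" by (rule Df_pairs Dt_var)+
  have S: "Fin ?S" by (rule Fin_image[OF E(1) D]) (simp add: is_upair_iff)
  have S_iff: "s \<in> ?S \<longleftrightarrow> (\<exists>a \<in> E. s = mk {a})" for s
    using internal_subset_U[OF EU] by (auto simp: is_upair_iff subset_eq)
  have rest: "internal (el A - E)" using EU by simp
  \<comment> \<open>Blocks must be non-empty: \<open>c\<close> is an element of the remaining block,
    available because there are infinitely many atoms.\<close>
  obtain c where c: "c \<in> el A - E" using infinite_pick[OF A_infinite _ E(1)] by auto
  let ?Q = "insert (mk (el A - E)) ?S"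
  have Q: "Fin ?Q" using S rest by simp
  have QI: "internal ?Q" using Fin_internal[OF Q] .
  have el_single: "el (mk {a}) = {a}" "is_set M (mk {a})" if "a \<in> E" for a
    using that internal_subset_U[OF EU] by (simp_all add: subset_eq)
  have "is_partition M A (mk ?Q)"
    unfolding is_partition_def el_mk[OF QI]
  proof (intro conjI ballI impI)
    show "is_set M (mk ?Q)" using QI by simp
    show "is_nonempty_set M B" if B: "B \<in> ?Q" for B
    proof (cases "B = mk (el A - E)")
      case True
      then show ?thesis using rest c unfolding is_nonempty_set_def by auto
    next
      case False
      then obtain a where "a \<in> E" "B = mk {a}" using B S_iff by blast
      then show ?thesis using el_single unfolding is_nonempty_set_def by auto
    qed
    show "(\<Union>B \<in> ?Q. el B) = el A"
    proof -
      have "?S = (\<lambda>a. mk {a}) ` E" using S_iff by blast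
      then have "(\<Union>B \<in> ?S. el B) = E"
        using el_single(1) by simp
      then show ?thesis using el_mk[OF rest] E(2) by auto
    qed
    show "el B \<inter> el C = {}" if "B \<in> ?Q" "C \<in> ?Q" "B \<noteq> C" for B C
    proof -
      have "B = mk (el A - E) \<or> (\<exists>a \<in> E. B = mk {a})" "C = mk (el A - E) \<or> (\<exists>a \<in> E. C = mk {a})"
        using that S_iff by blast+
      then show ?thesis using that(3) el_mk[OF rest] el_single(1) by auto
    qed
  qed
  then have "fin_part (mk ?Q)" unfolding fin_part_def finite_in_iff using Q QI by simp
  moreover have "supports (mk ?Q) x"
    unfolding supports_def el_mk[OF QI]
  proof (intro ballI impI)
    fix g assume g: "g \<in> G" "\<forall>B \<in> ?Q. act g B = B"
    have "act g a = a" if a: "a \<in> E" for a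
    proof -
      have "mk {a} \<in> ?Q" using a S_iff by blast
      then have "act g (mk {a}) = mk {a}" using g(2) by blast
      then have "el (act g (mk {a})) = {a}" using el_single[OF a] by simp
      moreover have "el (act g (mk {a})) = {act g a}" using act_set(2)[OF g(1) el_single(2)[OF a]] el_single(1)[OF a] by simp
      ultimately show ?thesis by simp
    qed
    then show "act g x = x" using fix_E g(1) by blast
  qed
  ultimately show thesis by (rule that)
qed

lemma V_fsupp: "x \<in> U \<Longrightarrow> el x \<subseteq> VU \<Longrightarrow> fsupp E x \<Longrightarrow> x \<in> VU"
  using fsupp_fin_part V_I by metis

lemma atom_V: "a \<in> el A \<Longrightarrow> a \<in> VU \<and> fsupp {a} a"
proof -
  assume a: "a \<in> el A"
  then have s: "fsupp {a} a" unfolding fsupp_def by auto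
  then show ?thesis using V_fsupp[of a] el_atom_A[OF a] a by auto
qed

lemma Pr_V:
  assumes "x \<in> VU" "y \<in> VU" "fsupp E x" "fsupp F y"
  shows "Pr x y \<in> VU" "fsupp (E \<union> F) (Pr x y)"
proof -
  have U: "x \<in> U" "y \<in> U" using assms by simp_all
  show s: "fsupp (E \<union> F) (Pr x y)" using fsupp_Pr assms(3,4) U by blast
  have "fsupp E (mk {x})" "fsupp (E \<union> F) (mk {x, y})"
    using assms(3,4) U unfolding fsupp_def by (auto simp: act_mk)
  then have "mk {x} \<in> VU" "mk {x, y} \<in> VU"
    using V_fsupp[of "mk {x}" E] V_fsupp[of "mk {x, y}" "E \<union> F"] assms(1,2) U by simp_all
  then show "Pr x y \<in> VU" using s U el_Pr[OF U] by (intro V_fsupp[of "Pr x y"]) auto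
qed

lemma subset_A_V: "is_set M x \<Longrightarrow> el x \<subseteq> el A \<Longrightarrow> fsupp E x \<Longrightarrow> x \<in> VU"
  using V_fsupp[of x E] atom_V by auto

text \<open>The transitive closure of \<open>n\<close> stays inside the transitive set
  \<open>om\<close>, all of whose elements are fixed by the group. This avoids an induction on a
  predicate about \<open>VU\<close>.\<close>

lemma nat_V: "n \<in> el om \<Longrightarrow> n \<in> VU"
proof -
  assume n: "n \<in> el om"
  have "in_closure M n y \<Longrightarrow> y \<in> el om" for y
  proof -
    assume y: "in_closure M n y"
    have "is_transitive M om" using om_el_subset by (auto simp: is_transitive_def)
    then show "y \<in> el om" using y n unfolding in_closure_def by blast
  qed
  then show "n \<in> VU"
    using n symmetric_iff fsupp_fin_part[OF fsupp_nat] el_in_U unfolding V_simps(3) mem_Collect_eq by metis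
qed

lemma act_om: "g \<in> G \<Longrightarrow> act g om = om"
  by (rule act_elementwise) (simp_all add: act_nat)

lemma act_A: "g \<in> G \<Longrightarrow> act g A = A"
proof -
  assume g: "g \<in> G"
  \<comment> \<open>Being an atom is definable without parameters, so the set of atoms is invariant
    under the whole group.\<close>
  have "Df {} (\<lambda>e. atom M (e 0))" by (rule Df_logic Dt_var)+
  then have "Df {} (\<lambda>e. e 0 \<in> el A)" by (rule Df_cong) (auto simp: el_A)
  from fixed_mk[OF g internal_el[OF A_simps(2)] this] show ?thesis by simp
qed

lemma om_V: "om \<in> VU"
  by (rule V_fsupp[of om "{}"]) (auto simp: nat_V fsupp_def act_om)

lemma A_V: "A \<in> VU"
  by (rule V_fsupp[of A "{}"]) (auto simp: atom_V fsupp_def act_A)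

section \<open>Absoluteness between \<open>M\<close> and the model\<close>

lemma is_upair_V: "u \<in> VU \<Longrightarrow> is_upair V x y u \<longleftrightarrow> is_upair M x y u"
  by (simp add: is_upair_def is_set_V el_V)

lemma is_opair_V:
  assumes "p \<in> VU" shows "is_opair V x y p \<longleftrightarrow> is_opair M x y p"
proof
  assume "is_opair V x y p"
  then obtain u v where uv: "is_upair V x x u" "is_upair V x y v" "is_upair V u v p"
    unfolding is_opair_def by blast
  moreover from this have "u \<in> VU" "v \<in> VU" unfolding is_upair_def is_set_V by blast+
  ultimately show "is_opair M x y p" using is_upair_V assms unfolding is_opair_def by blast
next
  assume "is_opair M x y p"
  then obtain u v where uv: "is_upair M x x u" "is_upair M x y v" "is_upair M u v p"
    unfolding is_opair_def by blast
  moreover from this have "u \<in> el p" "v \<in> el p" unfolding is_upair_def by blast+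
  then have "u \<in> VU" "v \<in> VU" using assms V_trans by blast+
  ultimately show "is_opair V x y p" using is_upair_V assms unfolding is_opair_def by blast
qed

lemma opair_components_V: "p \<in> VU \<Longrightarrow> is_opair M x y p \<Longrightarrow> x \<in> VU \<and> y \<in> VU"
  unfolding is_opair_def is_upair_def by (metis V_trans insertI1 insert_subset subset_insertI)

lemma rel_of_V: "f \<in> VU \<Longrightarrow> rel_of V f = rel_of M f"
proof -
  assume f: "f \<in> VU"
  have "p \<in> el f \<Longrightarrow> p \<in> VU" for p using f V_trans by blast
  then show ?thesis
    unfolding rel_of_def el_V[OF f] using is_opair_V opair_components_V V_in_U by blast
qed

lemma is_function_on_V:
  assumes f: "f \<in> VU" "X \<in> VU" shows "is_function_on V f X \<longleftrightarrow> is_function_on M f X"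
proof -
  have p: "p \<in> el f \<Longrightarrow> p \<in> VU" for p using f V_trans by blast
  have "(\<forall>p \<in> el f. \<exists>x \<in> el X. \<exists>y \<in> VU. is_opair V x y p) \<longleftrightarrow> (\<forall>p \<in> el f. \<exists>x \<in> el X. \<exists>y \<in> U. is_opair M x y p)"
    using is_opair_V[OF p] opair_components_V[OF p] V_in_U by meson
  then show ?thesis
    unfolding is_function_on_def rel_of_V[OF f(1)] el_V[OF f(1)] el_V[OF f(2)] is_set_V using f by blast
qed

lemma is_bijection_V:
  assumes "f \<in> VU" "X \<in> VU" "Y \<in> VU" shows "is_bijection V f X Y \<longleftrightarrow> is_bijection M f X Y"
  unfolding is_bijection_def is_function_on_V[OF assms(1,2)] rel_of_V[OF assms(1)] el_V[OF assms(3)] ..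

lemma is_bijection_V_in: "is_bijection V f X Y \<Longrightarrow> f \<in> VU"
  by (simp add: is_bijection_def is_function_on_def is_set_V)

lemma is_function_on_V_in: "is_function_on V f X \<Longrightarrow> f \<in> VU"
  by (simp add: is_function_on_def is_set_V)

lemma equipotent_V_I:
  assumes "is_bijection M f X Y" "f \<in> VU" "X \<in> VU" "Y \<in> VU" shows "equipotent V X Y"
  using assms is_bijection_V unfolding equipotent_def by blast

lemma is_empty_V: "is_empty V z \<longleftrightarrow> z = emp"
proof -
  have "emp \<in> VU" using nat_V by simp
  then show ?thesis
    using is_empty_iff[of z] el_V[of z] unfolding is_empty_def is_set_V by (metis V_in_U)
qed

lemma is_succ_V: "x \<in> VU \<Longrightarrow> is_succ V x y \<longleftrightarrow> y \<in> VU \<and> y = sc x"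
proof -
  assume x: "x \<in> VU"
  have "is_succ V x y \<longleftrightarrow> y \<in> VU \<and> is_succ M x y"
    unfolding is_succ_def is_set_V el_V[OF x] using el_V[of y] by (metis (no_types))
  then show ?thesis using is_succ_iff[OF V_in_U[OF x]] by simp
qed

lemma is_inductive_V: "x \<in> VU \<Longrightarrow> is_inductive V x \<longleftrightarrow> is_inductive M x"
  using V_trans[of x] is_succ_V
  unfolding is_inductive_iff by (auto simp: is_inductive_def is_set_V el_V is_empty_V)

text \<open>\<open>om\<close> belongs to the model, and a set inductive there is inductive in
  \<open>M\<close>; hence \<open>om\<close> is minimal in the model as well.\<close>

lemma is_omega_V: "is_omega V w \<longleftrightarrow> w = om"
proof -
  have ind: "x \<in> VU \<and> is_inductive M x" if "is_inductive V x" for x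
    using that is_inductive_V[of x] by (auto simp: is_inductive_def is_set_V)
  have om: "is_inductive V om" using is_inductive_V[OF om_V] is_omega_om by (simp add: is_omega_def)
  have "is_omega V om"
    unfolding is_omega_def using om ind is_omega_om el_V om_V by (simp add: is_omega_def)
  moreover have "w = om" if "is_omega V w"
  proof -
    have w: "w \<in> VU" "is_inductive M w" using that ind unfolding is_omega_def by blast+
    have "elems V w \<subseteq> elems V om" "elems V om \<subseteq> elems V w"
      using that om \<open>is_omega V om\<close> unfolding is_omega_def by blast+
    then have "el w = el om" using el_V w(1) om_V by simp
    then show ?thesis using w(2) ext_set by (simp add: is_inductive_iff)
  qed
  ultimately show ?thesis by blast
qed

lemma is_natural_V: "is_natural V n \<longleftrightarrow> n \<in> el om"
  by (simp add: is_natural_def is_omega_V el_V[OF om_V])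

lemma equipotent_V_D: "equipotent V X Y \<Longrightarrow> X \<in> VU \<Longrightarrow> Y \<in> VU \<Longrightarrow> \<exists>f \<in> VU. is_bijection M f X Y"
  using is_bijection_V[of _ X Y] is_bijection_V_in[of _ X Y] unfolding equipotent_def by metis

text \<open>The finite and the infinite case are merged: either way the model has a bijection onto a
  set of natural numbers, and those are fixed by all permutations.\<close>

lemma countable_in_V_D:
  assumes "countable_in V X"
  obtains f Y where "X \<in> VU" "f \<in> VU" "Y \<in> U" "el Y \<subseteq> el om" "is_bijection M f X Y"
proof -
  have X: "X \<in> VU" using assms unfolding countable_in_def finite_in_def countably_infinite_in_def is_set_V by blast
  from assms consider n where "n \<in> el om" "equipotent V X n" | "equipotent V X om"
    unfolding countable_in_def finite_in_def countably_infinite_in_def is_omega_V is_natural_V by blast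
  then show thesis
  proof cases
    case 1
    then show thesis using that[OF X] equipotent_V_D[OF 1(2) X nat_V] om_el_subset by (metis el_in_U)
  next
    case 2
    then obtain f where "f \<in> VU" "is_bijection M f X om" using equipotent_V_D[OF 2 X om_V] by blast
    then show thesis by (intro that[OF X, of f om]) simp_all
  qed
qed

text \<open>One finite set \<open>E\<close> supporting all entries supports every pair and hence the
  relation. This brings bijections of \<open>M\<close> that witness finiteness into the
  model.\<close>

lemma fsupp_rel_V:
  assumes f: "is_rel f" and E: "Fin E" "E \<subseteq> el A"
    and "\<And>x y. (x, y) \<in> rel_of M f \<Longrightarrow> x \<in> VU \<and> y \<in> VU \<and> fsupp E x \<and> fsupp E y"
  shows "f \<in> VU"
proof (rule V_fsupp)
  have f_el: "p \<in> VU \<and> fsupp E p" if p: "p \<in> el f" for p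
  proof -
    obtain x y where "x \<in> U" "y \<in> U" "p = Pr x y"
      using f p unfolding is_rel_def by blast
    then have xy: "p = Pr x y" "(x, y) \<in> rel_of M f" using p by (simp_all add: rel_of_iff)
    then show ?thesis using Pr_V[of x y E E] assms(4)[OF xy(2)] by simp
  qed
  then show "el f \<subseteq> VU" by blast
  have fs: "is_set M f" using f by (simp add: is_rel_def)
  then show "f \<in> U" by simp
  show "fsupp E f"
    unfolding fsupp_def
  proof (intro conjI E ballI impI)
    fix g assume g: "g \<in> G" "\<forall>a \<in> E. act g a = a"
    then show "act g f = f" using act_elementwise[OF g(1) fs] f_el unfolding fsupp_def by blast
  qed
qed

section \<open>Failure of the choice principles\<close>


lemma mem_codes: "p \<in> codes R \<longleftrightarrow> (\<exists>x y. (x, y) \<in> R \<and> p = Pr x y)"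
  by (force simp: codes_def)

lemma V_definable:
  assumes "internal S" "S \<subseteq> VU" "Df K (\<lambda>e. e 0 \<in> S)"
    "\<And>g k. g \<in> G \<Longrightarrow> k \<in> K \<Longrightarrow> k \<in> U \<Longrightarrow> act g k = k"
  shows "mk S \<in> VU" "fsupp {} (mk S)"
proof -
  show s: "fsupp {} (mk S)"
    unfolding fsupp_def using fixed_mk[OF _ assms(1,3,4)] by simp
  show "mk S \<in> VU"
    by (rule V_fsupp[OF _ _ s]) (use assms in simp_all)
qed

text \<open>In contrast to a common support, the supports of the entries may vary with the pair:
  they only place the pairs in the model, while definability makes the whole relation
  symmetric.\<close>

lemma rel_V_definable:
  assumes R: "irel R" and D: "Df K (\<lambda>e. (e 0, e 1) \<in> R)"
    and fixed: "\<And>g k. g \<in> G \<Longrightarrow> k \<in> K \<Longrightarrow> k \<in> U \<Longrightarrow> act g k = k"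
    and V: "\<And>x y. (x, y) \<in> R \<Longrightarrow> \<exists>E F. x \<in> VU \<and> y \<in> VU \<and> fsupp E x \<and> fsupp F y"
  shows "mkr R \<in> VU" "act g (mkr R) = mkr R \<or> g \<notin> G"
proof -
  have D': "Df K (\<lambda>e. \<exists>x \<in> U. \<exists>y \<in> U. is_opair M x y (e 0) \<and> (x, y) \<in> R)"
    by (rule Df_subst2[of K "\<lambda>x y. (x, y) \<in> R", OF D] Df_pairs Df_logic Dt_var)+
  have "Df K (\<lambda>e. e 0 \<in> codes R)"
  proof (rule Df_cong[OF D'])
    fix e :: "nat \<Rightarrow> 'a"
    show "e 0 \<in> codes R \<longleftrightarrow> (\<exists>x \<in> U. \<exists>y \<in> U. is_opair M x y (e 0) \<and> (x, y) \<in> R)"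
      using R unfolding codes_def is_opair_iff irel_def by force
  qed
  moreover have "internal (codes R)" using R by (simp add: irel_def)
  moreover have "codes R \<subseteq> VU"
    using V Pr_V(1) unfolding codes_def by (auto, metis)
  ultimately show "mkr R \<in> VU" "act g (mkr R) = mkr R \<or> g \<notin> G"
    unfolding mkr_def using V_definable[of "codes R" K] fixed unfolding fsupp_def by auto
qed

lemma infinite_V_A: "infinite_in V A"
proof -
  have "\<not> finite_in V A"
  proof
    assume "finite_in V A"
    then obtain n where n: "n \<in> el om" "equipotent V A n"
      unfolding finite_in_def is_natural_V by blast
    then obtain f where "is_bijection M f A n" using equipotent_V_D[OF _ A_V nat_V] by blast
    then have "eqp (el A) (el n)" using equipotent_iff equipotent_def by metis
    then show False using A_infinite n(1) unfolding Fin_def by auto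
  qed
  then show ?thesis unfolding infinite_in_def is_set_V using A_V by simp
qed

lemma block_cases:
  assumes "fin_part Q" "supports Q f" "f \<in> U" "B \<in> el Q" "a \<in> el B" "b \<in> el B" "(x, y) \<in> rel_of M f"
  shows "(act (swap a b) x, act (swap a b) y) \<in> rel_of M f"
proof -
  have ab: "a \<in> el A" "b \<in> el A" using fin_part_blocks(4)[OF assms(1,4)] assms(5,6) by blast+
  show ?thesis
    by (rule fixed_rel_of[OF swap_in_G[OF ab] supports_swap[OF assms(1,2,4-6)] assms(3,7)])
qed

section \<open>Permutations without fixed points and Form 3\<close>

lemma no_fixed_point_free_permutation:
  assumes f: "is_bijection V f A A" shows "\<not> fixed_point_free V f"
proof
  assume free: "fixed_point_free V f"
  have fV: "f \<in> VU" using is_bijection_V_in[OF f] .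
  let ?R = "rel_of M f"
  have b: "bijrel ?R (el A) (el A)"
    using f is_bijection_V[OF fV A_V A_V] by (simp add: is_bijection_iff)
  note r = bijrelD[OF b]
  have ne: "x \<noteq> y" if "(x, y) \<in> ?R" for x y
    using free that unfolding fixed_point_free_def rel_of_V[OF fV] by blast
  obtain Q where Q: "fin_part Q" "supports Q f" using V_support[OF fV] by blast
  obtain B where B: "B \<in> el Q" "\<not> Fin (el B)" using infinite_block[OF Q(1)] by blast
  have BU: "internal (el B)" "el B \<subseteq> el A" using fin_part_blocks(4)[OF Q(1) B(1)] B(1) by simp_all
  obtain x where x: "x \<in> el B" using B(2) by fastforce
  obtain y where xy: "(x, y) \<in> ?R" using r(2) x BU by blast
  have yA: "y \<in> el A" using r(1) xy by blast
  obtain c where c: "c \<in> el B" "c \<notin> {x, y}"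
    using infinite_pick[OF B(2) BU(1), of "{x, y}"] x yA BU by auto
  have xc: "x \<in> el A" "c \<in> el A" using x c BU by blast+
  have move: "(act (swap u v) x, act (swap u v) y) \<in> ?R" if "u \<in> el B" "v \<in> el B" for u v
    using block_cases[OF Q V_in_U[OF fV] B(1) that xy] .
  show False
  proof (cases "y \<in> el B")
    case True
    then have "(x, c) \<in> ?R"
      using move[of y c] c xc yA ne[OF xy] act_swap[OF yA xc(2)] by (metis insertCI)
    then show False using r(4)[OF xy] c by blast
  next
    case False
    then have "(c, y) \<in> ?R"
      using move[of x c] x c xc yA act_swap[OF xc] by (metis)
    then show False using r(5)[OF xy] c by blast
  qed
qed

lemma not_EPWFP: "\<not> EPWFP V"
  using infinite_V_A no_fixed_point_free_permutation unfolding EPWFP_def by blast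

lemma not_ISAE: "\<not> ISAE V"
  using infinite_V_A no_fixed_point_free_permutation unfolding ISAE_def by blast

lemma not_Form3: "\<not> Form3 V"
proof
  assume F3: "Form3 V"
  define e1 where "e1 = sc emp"
  define t where "t = sc e1"
  have nat: "emp \<in> el om" "e1 \<in> el om" "t \<in> el om" by (simp_all add: e1_def t_def)
  have el_t: "el t = {emp, e1}" by (auto simp: e1_def t_def)
  have "is_upair V emp e1 t"
    using nat_V[OF nat(3)] el_t nat by (simp add: is_upair_def is_set_V el_V om_set)
  then have two: "is_two V t"
    unfolding is_two_def using is_empty_V is_succ_V[OF nat_V[OF nat(1)]] nat_V[OF nat(2)] e1_def by blast
  let ?R = "el A \<times> el t"
  have R: "irel ?R" by (rule irel_Times) (use nat in simp_all)
  have D: "Df {A, t} (\<lambda>e. e 0 \<in> el A \<and> e 1 \<in> el t)"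
    by (rule Df_logic Dt_var Dt_const insertI1 insertI2 A_simps(2) el_in_U[OF nat(3)])+
  have Z: "mkr ?R \<in> VU"
  proof (rule rel_V_definable(1)[OF R])
    show "Df {A, t} (\<lambda>e. (e 0, e 1) \<in> ?R)" using D by simp
    show "act g k = k" if "g \<in> G" "k \<in> {A, t}" for g k
      using that act_A act_nat nat(3) by auto
    show "\<exists>E F. x \<in> VU \<and> y \<in> VU \<and> fsupp E x \<and> fsupp F y" if "(x, y) \<in> ?R" for x y
    proof -
      have xy: "x \<in> el A" "y \<in> el om" using that el_t nat by auto
      show ?thesis using atom_V[OF xy(1)] nat_V[OF xy(2)] fsupp_nat[OF xy(2)] by blast
    qed
  qed
  let ?Z = "mkr ?R"
  have "is_product V A t ?Z"
    unfolding is_product_def el_V[OF Z] el_V[OF A_V] el_V[OF nat_V[OF nat(3)]]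
  proof
    show "is_set V ?Z" using Z R by (simp add: is_set_V)
    show "el ?Z = {p \<in> VU. \<exists>x \<in> el A. \<exists>y \<in> el t. is_opair V x y p}"
    proof (intro Set.set_eqI iffI)
      fix p assume p: "p \<in> el ?Z"
      then obtain x y where "x \<in> el A" "y \<in> el t" "p = Pr x y" unfolding el_mkr[OF R] mem_codes by blast
      moreover have "p \<in> VU" using V_trans[OF Z p] .
      ultimately show "p \<in> {p \<in> VU. \<exists>x \<in> el A. \<exists>y \<in> el t. is_opair V x y p}"
        using is_opair_V[of p] by (auto simp: is_opair_iff)
    next
      fix p assume "p \<in> {p \<in> VU. \<exists>x \<in> el A. \<exists>y \<in> el t. is_opair V x y p}"
      then show "p \<in> el ?Z"
        unfolding el_mkr[OF R] mem_codes using is_opair_V[of p] unfolding is_opair_iff by blast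
    qed
  qed
  then have "equipotent V A ?Z" using F3 two infinite_V_A unfolding Form3_def by blast
  then obtain f where fV: "f \<in> VU" and f: "is_bijection M f A ?Z" using equipotent_V_D[OF _ A_V Z] by blast
  have b: "bijrel (rel_of M f) (el A) (el ?Z)" using f by (simp add: is_bijection_iff)
  note r = bijrelD[OF b]
  obtain Q where Q: "fin_part Q" "supports Q f" using V_support[OF fV] by blast
  obtain B where B: "B \<in> el Q" "\<not> Fin (el B)" using infinite_block[OF Q(1)] by blast
  have BU: "internal (el B)" "el B \<subseteq> el A" using fin_part_blocks(4)[OF Q(1) B(1)] B(1) by simp_all
  \<comment> \<open>\<open>F x y i\<close> says that \<open>f\<close> sends \<open>x\<close> to the
    pair \<open>(y, i)\<close>. Transpositions act on \<open>y\<close> only, since \<open>i\<close>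
    is a natural number.\<close>
  define F where "F x y i \<longleftrightarrow> x \<in> el A \<and> y \<in> el A \<and> i \<in> el t \<and> (x, Pr y i) \<in> rel_of M f" for x y i
  have F_ex: "\<exists>y i. F x y i" if xA: "x \<in> el A" for x
  proof -
    obtain z where z: "(x, z) \<in> rel_of M f" using r(2)[OF xA] by blast
    then have "z \<in> codes ?R" using r(1) el_mkr[OF R] by blast
    then show ?thesis using z xA unfolding F_def mem_codes by blast
  qed
  have F_surj: "\<exists>x. F x y i" if "y \<in> el A" "i \<in> el t" for y i
  proof -
    have "Pr y i \<in> el ?Z" unfolding el_mkr[OF R] mem_codes using that by blast
    then show ?thesis using r(1) r(3) that unfolding F_def by blast
  qed
  have F_fun: "y = y' \<and> i = i'" if "F x y i" "F x y' i'" for x y i y' i'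
  proof -
    have "Pr y i = Pr y' i'" using that r(4) unfolding F_def by blast
    moreover have "y \<in> U" "i \<in> U" "y' \<in> U" "i' \<in> U" using that el_in_U unfolding F_def by blast+
    ultimately show ?thesis using Pr_inj by blast
  qed
  have F_inj: "x = x'" if "F x y i" "F x' y i" for x x' y i
    using that r(5) unfolding F_def by blast
  have move: "F (act (swap u v) x) (act (swap u v) y) i"
    if "u \<in> el B" "v \<in> el B" "F x y i" for u v x y i
  proof -
    have uv: "u \<in> el A" "v \<in> el A" using that BU by blast+
    note g = swap_in_G[OF uv]
    have i: "i \<in> el om" using that el_t nat unfolding F_def by auto
    have "(act (swap u v) x, act (swap u v) (Pr y i)) \<in> rel_of M f"
      using block_cases[OF Q V_in_U[OF fV] B(1) that(1,2)] that(3) unfolding F_def by blast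
    moreover have "act (swap u v) (Pr y i) = Pr (act (swap u v) y) i"
      using act_Pr[OF g, of y i] act_nat[OF g i] that(3) el_in_U[OF i] el_in_U[of y A] unfolding F_def by simp
    ultimately show ?thesis using that(3) act_in_A[OF g] unfolding F_def by auto
  qed
  \<comment> \<open>On the infinite block the first coordinate of the image of \<open>x\<close> must
    be \<open>x\<close> itself, by the argument used against permutations without fixed
    points.\<close>
  have diag: "y = x" if x: "x \<in> el B" and xy: "F x y i" for x y i
  proof (rule ccontr)
    assume ne: "y \<noteq> x"
    have yA: "y \<in> el A" using xy unfolding F_def by blast
    obtain c where c: "c \<in> el B" "c \<notin> {x, y}"
      using infinite_pick[OF B(2) BU(1), of "{x, y}"] x yA BU by auto
    have xc: "x \<in> el A" "c \<in> el A" using x c BU by blast+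
    show False
    proof (cases "y \<in> el B")
      case True
      have "act (swap y c) x = x" using act_swap(3)[OF yA xc(2) xc(1)] ne c by blast
      then have "F x c i" using move[OF True c(1) xy] act_swap(1)[OF yA xc(2)] by simp
      then show False using F_fun xy c by blast
    next
      case False
      have "act (swap x c) y = y" using act_swap(3)[OF xc yA] ne c by blast
      then have "F c y i" using move[OF x c(1) xy] act_swap(1)[OF xc] by simp
      then show False using F_inj xy c by blast
    qed
  qed
  obtain x where x: "x \<in> el B" using B(2) by fastforce
  then have xA: "x \<in> el A" using BU by blast
  obtain i where xi: "F x x i" using F_ex[OF xA] diag[OF x] by blast
  \<comment> \<open>The image of \<open>x\<close> is only one of the two pairs over
    \<open>x\<close>. The other one, \<open>(x, j)\<close>, is the image of some \<open>d\<close>,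
    which lies outside the block by \<open>diag\<close>. Exchanging \<open>x\<close> with a third
    point \<open>c\<close> of the block keeps \<open>d\<close> but turns its image into
    \<open>(c, j)\<close>.\<close>
  have "emp \<noteq> e1" unfolding e1_def using sc(2)[of emp] by (metis emp(2,3) empty_iff insertI1)
  then obtain j where j: "j \<in> el t" "j \<noteq> i" using el_t by auto
  obtain d where d: "F d x j" using F_surj[OF xA j(1)] by blast
  have dx: "d \<noteq> x" using d xi F_fun j by blast
  have dA: "d \<in> el A" using d unfolding F_def by blast
  have dB: "d \<notin> el B" using diag[OF _ d] dx by blast
  obtain c where c: "c \<in> el B" "c \<notin> {x, d}"
    using infinite_pick[OF B(2) BU(1), of "{x, d}"] xA dA by auto
  have cA: "c \<in> el A" using c BU by blast
  have "act (swap x c) d = d" using act_swap(3)[OF xA cA dA] dx c by blast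
  then have "F d c j" using move[OF x c(1) d] act_swap(1)[OF xA cA] by simp
  then show False using F_fun[OF d] c by blast
qed

text \<open>If every block met \<open>S\<close> in at most one point, \<open>S\<close> would be the
  image of the finite set of blocks under a partial map.\<close>

lemma two_in_block:
  assumes Q: "fin_part Q" and S: "internal S" "\<not> Fin S" "S \<subseteq> el A"
  obtains B a b where "B \<in> el Q" "a \<in> el B" "b \<in> el B" "a \<in> S" "b \<in> S" "a \<noteq> b"
proof -
  note q = fin_part_blocks[OF Q]
  let ?R = "\<lambda>C a. a \<in> el C \<and> a \<in> el (mk S)"
  have D: "Df U (\<lambda>e. ?R (e 0) (e 1))" by (rule Df_logic Dt_var Dt_const mk_in_U[OF S(1)])+
  have "\<exists>B \<in> el Q. \<exists>a b. a \<in> el B \<and> b \<in> el B \<and> a \<in> S \<and> b \<in> S \<and> a \<noteq> b"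
  proof (rule ccontr)
    assume no: "\<not> ?thesis"
    have "Fin {a \<in> U. \<exists>B \<in> el Q. ?R B a}"
      by (rule Fin_image[OF q(2) D]) (use no S(1) in auto)
    moreover have "{a \<in> U. \<exists>B \<in> el Q. ?R B a} = S"
      using q(5) S internal_subset_U[OF S(1)] by auto
    ultimately show False using S(2) by simp
  qed
  then show thesis using that by blast
qed

text \<open>A bijection with numbers is supported by a partition. Two points of \<open>y\<close> in
  one block can be exchanged while their numbers stay fixed, so they would get the same
  number.\<close>

lemma countable_V_small:
  assumes "countable_in V y" "el y \<subseteq> el A" shows "Fin (el y)"
proof (rule ccontr)
  assume inf: "\<not> Fin (el y)"
  obtain h Y where h: "y \<in> VU" "h \<in> VU" "el Y \<subseteq> el om" "is_bijection M h y Y"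
    using countable_in_V_D[OF assms(1)] by metis
  obtain Q where Q: "fin_part Q" "supports Q h" using V_support[OF h(2)] by blast
  obtain B a b where ab: "B \<in> el Q" "a \<in> el B" "b \<in> el B" "a \<in> el y" "b \<in> el y" "a \<noteq> b"
    using two_in_block[OF Q(1) internal_el[OF V_in_U[OF h(1)]] inf assms(2)] by blast
  have b: "bijrel (rel_of M h) (el y) (el Y)" using h(4) by (simp add: is_bijection_iff)
  note r = bijrelD[OF b]
  obtain n where n: "(a, n) \<in> rel_of M h" using r(2)[OF ab(4)] by blast
  then have "n \<in> el om" using r(1) h(3) by blast
  have AA: "a \<in> el A" "b \<in> el A" using ab assms(2) by blast+
  have "(b, n) \<in> rel_of M h"
    using block_cases[OF Q V_in_U[OF h(2)] ab(1-3) n] act_swap(1)[OF AA] act_nat[OF swap_in_G[OF AA] \<open>n \<in> el om\<close>] by simp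
  then show False using r(5)[OF n] ab(6) by blast
qed

text \<open>Cofinite sets are chosen because each is supported by its finite complement, and because
  for every finite partition the union of the infinite blocks is among them.\<close>

definition cofin :: 'a where
  "cofin = mk {X. is_set M X \<and> el X \<subseteq> el A \<and> Fin (el A - el X)}"

lemma cofin: "el cofin = {X. is_set M X \<and> el X \<subseteq> el A \<and> Fin (el A - el X)}" "cofin \<in> VU" "is_set M cofin"
  and fsupp_cofin: "fsupp {} cofin"
  and fsupp_cofin_el: "X \<in> el cofin \<Longrightarrow> fsupp (el A - el X) X"
proof -
  let ?S = "{X. is_set M X \<and> el X \<subseteq> el A \<and> Fin (el A - el X)}"
  have "el A - el X = {z \<in> U. z \<in> el A \<and> z \<notin> el X}" for X
    using el_subset_U[of A] by blast
  moreover have "Df {A, om} (\<lambda>e. is_set M (e 0) \<and> el (e 0) \<subseteq> el A \<and> Fin {z \<in> U. z \<in> el A \<and> z \<notin> el (e 0)})"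
    by (rule Df_Fin_Collect Df_logic Dt_var Dt_const insertI1 insertI2 A_simps(2) om_simps(2))+
  ultimately have D: "Df {A, om} (\<lambda>e. e 0 \<in> ?S)" by simp
  have S: "internal ?S"
    by (rule internal_sepI[OF D internal_Pow[OF internal_el[OF A_simps(2)]]]) blast
  have fs: "fsupp (el A - el X) X" if X: "X \<in> ?S" for X
  proof -
    have "act g X = X" if g: "g \<in> G" "\<forall>a \<in> el A - el X. act g a = a" for g
    proof -
      \<comment> \<open>\<open>X\<close> is written as the complement of its complement, so that it
        is definable from \<open>A\<close> and the finite set \<open>?E\<close>, both of which
        \<open>g\<close> fixes.\<close>
      have XU: "internal (el A - el X)" "X = mk (el A - (el A - el X))"
        using X by (auto simp: double_diff)
      let ?E = "mk (el A - el X)"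
      have E: "act g ?E = ?E"
        by (rule act_elementwise) (use XU g in simp_all)
      have "Df {A, ?E} (\<lambda>e. e 0 \<in> el A \<and> e 0 \<notin> el ?E)"
        by (rule Df_logic Dt_var Dt_const insertI1 insertI2 A_simps(2) mk_in_U XU(1))+
      then have "Df {A, ?E} (\<lambda>e. e 0 \<in> el A - (el A - el X))" using XU(1) by simp
      from fixed_mk[OF g(1) _ this] show ?thesis using XU E act_A g(1) by auto
    qed
    then show ?thesis using X unfolding fsupp_def by auto
  qed
  have "?S \<subseteq> VU" using subset_A_V fs by blast
  then show "cofin \<in> VU" "fsupp {} cofin"
    unfolding cofin_def using V_definable[OF S _ D] act_A act_om by auto
  show *: "el cofin = ?S" "is_set M cofin" unfolding cofin_def using S by simp_all
  show "X \<in> el cofin \<Longrightarrow> fsupp (el A - el X) X" using * fs by simp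
qed

text \<open>Common core of both multiple choice failures, as finite sets are countable. It is stated
  with functions of \<open>M\<close>, which by absoluteness covers those of the model.\<close>

lemma no_countable_choice:
  assumes f: "f \<in> VU" "is_function_on M f cofin"
    and y: "\<And>X y. (X, y) \<in> rel_of M f \<Longrightarrow> y \<in> VU \<Longrightarrow> is_nonempty_set V y \<and> countable_in V y \<and> el y \<subseteq> el X"
  shows False
proof -
  obtain Q where Q: "fin_part Q" "supports Q f" using V_support[OF f(1)] by blast
  let ?E = "\<Union>B \<in> {B \<in> el Q. Fin (el B)}. el B"
  have E: "Fin ?E" using Fin_small_blocks[OF Q(1)] .
  have EA: "?E \<subseteq> el A" using fin_part_blocks(4)[OF Q(1)] by blast
  have I: "internal (el A - ?E)" using Fin_internal[OF E] by simp
  define X where "X = mk (el A - ?E)"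
  have X: "is_set M X" "el X = el A - ?E" unfolding X_def using I by simp_all
  have Xc: "X \<in> el cofin" unfolding cofin using X E EA by (simp add: double_diff)
  obtain Y where Y: "(X, Y) \<in> rel_of M f" using f(2) Xc unfolding is_function_on_iff by blast
  have YV: "Y \<in> VU"
    using Y f(1) opair_components_V V_trans unfolding rel_of_def by blast
  note y = y[OF Y YV]
  have YX: "el Y \<subseteq> el X" "el Y \<noteq> {}" "countable_in V Y"
    using y el_V[OF YV] unfolding is_nonempty_set_def by simp_all
  then obtain c where c: "c \<in> el Y" by blast
  have cA: "c \<in> el A" "c \<notin> ?E" using c YX(1) X by blast+
  obtain B where B: "B \<in> el Q" "c \<in> el B" using fin_part_blocks(5)[OF Q(1) cA(1)] by blast
  have B_inf: "\<not> Fin (el B)" using B cA(2) by blast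
  have "el B \<subseteq> el Y"
  proof
    fix d assume d: "d \<in> el B"
    have dA: "d \<in> el A" using fin_part_blocks(4)[OF Q(1) B(1)] d by blast
    have dX: "d \<in> el X"
    proof -
      have "d \<notin> ?E" using fin_part_blocks(6)[OF Q(1) B(1) _ d] B_inf by blast
      then show ?thesis using X(2) dA by blast
    qed
    have cX: "c \<in> el X" using c YX(1) by blast
    \<comment> \<open>Both \<open>c\<close> and \<open>d\<close> lie in \<open>X\<close>, so their
      transposition fixes \<open>X\<close> and therefore the value \<open>Y\<close> at
      \<open>X\<close>. Since it moves \<open>c\<close> to \<open>d\<close>, the whole block of
      \<open>c\<close> lies in \<open>Y\<close>.\<close>
    have sX: "act (swap c d) X = X"
      by (rule act_swap_set[OF cA(1) dA X(1)]) (use X(2) cX dX in blast)+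
    have "(X, act (swap c d) Y) \<in> rel_of M f"
      using block_cases[OF Q V_in_U[OF f(1)] B d Y] sX by simp
    then have "act (swap c d) Y = Y" using Y f(2) unfolding is_function_on_iff by (metis el_in_U Xc)
    then have "act (swap c d) c \<in> el Y"
      using act_mem[OF swap_in_G[OF cA(1) dA], of c Y] c YV by simp
    then show "d \<in> el Y" using act_swap(1)[OF cA(1) dA] by simp
  qed
  moreover have "Fin (el Y)" using countable_V_small YX X(2) by blast
  ultimately show False using Fin_subset B_inf B(1) by (metis el_in_U internal_el)
qed

lemma is_nonempty_V: "is_nonempty_set V x \<longleftrightarrow> x \<in> VU \<and> is_set M x \<and> el x \<noteq> {}"
  using el_V[of x] unfolding is_nonempty_set_def is_set_V by auto

lemma cofin_nonempty: "X \<in> el cofin \<Longrightarrow> is_nonempty_set V X"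
  using A_infinite V_trans[OF cofin(2), of X] unfolding is_nonempty_V cofin by auto

lemma not_MC: "\<not> MC V"
proof
  assume "MC V"
  moreover have "is_set V cofin" using cofin by (simp add: is_set_V)
  moreover have "\<forall>x \<in> elems V cofin. is_nonempty_set V x"
    unfolding el_V[OF cofin(2)] using cofin_nonempty by blast
  ultimately obtain f where f: "is_function_on V f cofin"
    "\<forall>x y. (x, y) \<in> rel_of V f \<longrightarrow> is_nonempty_set V y \<and> finite_in V y \<and> elems V y \<subseteq> elems V x"
    unfolding MC_def by blast
  have fV: "f \<in> VU" using is_function_on_V_in[OF f(1)] .
  have f_fun: "is_function_on M f cofin" using f(1) is_function_on_V[OF fV cofin(2)] by blast
  show False
  proof (rule no_countable_choice[OF fV f_fun])
    fix X y assume Xy: "(X, y) \<in> rel_of M f" "y \<in> VU"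
    have "X \<in> VU" using Xy(1) f_fun V_trans[OF cofin(2)] unfolding is_function_on_iff by blast
    then show "is_nonempty_set V y \<and> countable_in V y \<and> el y \<subseteq> el X"
      using f(2) Xy rel_of_V[OF fV] el_V unfolding countable_in_def by metis
  qed
qed

lemma not_countable_MC: "\<not> countable_MC V"
proof
  assume cmc: "countable_MC V"
  \<comment> \<open>The family is indexed by itself, through the identity function on
    \<open>cofin\<close>.\<close>
  let ?R = "{(x, y). x \<in> el cofin \<and> y \<in> el cofin \<and> x = y}"
  have D0: "Df {cofin} (\<lambda>e. e 0 = e 1)" by (rule Df_logic Dt_var)+
  have cU: "cofin \<in> U" using cofin by simp
  have R: "irel ?R" by (rule irel_sep2[OF _ _ D0]) (use cU in simp_all)
  have D: "Df {cofin} (\<lambda>e. e 0 \<in> el cofin \<and> e 1 \<in> el cofin \<and> e 0 = e 1)"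
    by (rule Df_logic Dt_var Dt_const insertI1 cU)+
  let ?a = "mkr ?R"
  have aV: "?a \<in> VU"
  proof (rule rel_V_definable(1)[OF R])
    show "Df {cofin} (\<lambda>e. (e 0, e 1) \<in> ?R)" using D by simp
    show "act g k = k" if "g \<in> G" "k \<in> {cofin}" for g k
      using that fsupp_cofin unfolding fsupp_def by auto
    show "\<exists>E F. x \<in> VU \<and> y \<in> VU \<and> fsupp E x \<and> fsupp F y" if "(x, y) \<in> ?R" for x y
      using that fsupp_cofin_el V_trans[OF cofin(2)] by blast
  qed
  have ra: "rel_of V ?a = ?R" using rel_of_V[OF aV] rel_of_mkr[OF R] by simp
  have "is_function_on V ?a cofin"
    unfolding is_function_on_V[OF aV cofin(2)] is_function_on_iff rel_of_mkr[OF R] using is_rel_mkr[OF R] by auto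
  moreover have "is_set V cofin" using cofin by (simp add: is_set_V)
  moreover have "\<forall>i x. (i, x) \<in> rel_of V ?a \<longrightarrow> is_nonempty_set V x"
    unfolding ra using cofin_nonempty by blast
  ultimately obtain f where f: "is_function_on V f cofin"
    "\<forall>i x y. (i, x) \<in> rel_of V ?a \<and> (i, y) \<in> rel_of V f \<longrightarrow>
       is_nonempty_set V y \<and> countable_in V y \<and> elems V y \<subseteq> elems V x"
    using cmc unfolding countable_MC_def by blast
  have fV: "f \<in> VU" using is_function_on_V_in[OF f(1)] .
  have f_fun: "is_function_on M f cofin" using f(1) is_function_on_V[OF fV cofin(2)] by blast
  show False
  proof (rule no_countable_choice[OF fV f_fun])
    fix X y assume Xy: "(X, y) \<in> rel_of M f" "y \<in> VU"
    have X: "X \<in> el cofin" using Xy(1) f_fun unfolding is_function_on_iff by blast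
    have "(X, X) \<in> rel_of V ?a" unfolding ra using X by blast
    moreover have "(X, y) \<in> rel_of V f" using Xy(1) rel_of_V[OF fV] by simp
    ultimately have "is_nonempty_set V y \<and> countable_in V y \<and> elems V y \<subseteq> elems V X"
      using f(2) by blast
    then show "is_nonempty_set V y \<and> countable_in V y \<and> el y \<subseteq> el X"
      using el_V[OF Xy(2)] el_V[OF V_trans[OF cofin(2) X]] by simp
  qed
qed

text \<open>The two membership assumptions say that \<open>n\<close> is at least 2; they give two
  distinct points in any set of size \<open>n\<close>.\<close>

lemma not_AC_n:
  assumes n: "n \<in> el om" "emp \<in> el n" "sc emp \<in> el n" shows "\<not> AC_n V n"
proof
  assume ac: "AC_n V n"
  have nU: "n \<in> U" using n by simp
  let ?S = "{x. is_set M x \<and> el x \<subseteq> el A \<and> equipotent M x n}"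
  have "Df {A, n} (\<lambda>e. is_set M (e 0) \<and> el (e 0) \<subseteq> el A \<and> equipotent M (e 0) n)"
    by (rule Df_funs Df_logic Dt_var Dt_const insertI1 insertI2 A_simps(2) nU)+
  then have D: "Df {A, n} (\<lambda>e. e 0 \<in> ?S)" by simp
  have S: "internal ?S"
    by (rule internal_sepI[OF D internal_Pow[OF internal_el[OF A_simps(2)]]]) blast
  have x_props: "Fin (el x)" "fsupp (el x) x" "x \<in> VU" if x: "x \<in> ?S" for x
  proof -
    show F: "Fin (el x)" using x n(1) unfolding Fin_def equipotent_iff by auto
    show s: "fsupp (el x) x"
      unfolding fsupp_def using x F act_elementwise by blast
    show "x \<in> VU" using x subset_A_V[OF _ _ s] by blast
  qed
  have SV: "mk ?S \<in> VU"
    by (rule V_definable(1)[OF S _ D]) (use x_props act_A act_nat n(1) in auto)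
  have "equipotent V x n" if x: "x \<in> ?S" for x
  proof -
    obtain f where f: "is_bijection M f x n" using x unfolding equipotent_def by blast
    \<comment> \<open>The set \<open>x\<close> must have size \<open>n\<close> in the sense of the
      model. Its finitely many atoms form a common support for all entries of the bijection, the
      numbers having empty support.\<close>
    have "f \<in> VU"
    proof (rule fsupp_rel_V[OF _ x_props(1)[OF x]])
      show "is_rel f" using f by (simp add: is_bijection_iff)
      show "el x \<subseteq> el A" using x by blast
      fix a i assume "(a, i) \<in> rel_of M f"
      then have ai: "a \<in> el x" "i \<in> el n" using f unfolding is_bijection_iff bijrel_def by blast+
      have "i \<in> el om" using ai(2) om_el_subset[OF n(1)] by blast
      then show "a \<in> VU \<and> i \<in> VU \<and> fsupp (el x) a \<and> fsupp (el x) i"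
        using ai(1) x atom_V nat_V fsupp_mono[OF fsupp_nat, of i "el x"] x_props(1)[OF x]
          fsupp_mono[of "{a}" a "el x"] by blast
    qed
    then show ?thesis using equipotent_V_I[OF f _ x_props(3)[OF x] nat_V[OF n(1)]] by blast
  qed
  then have "\<forall>x \<in> elems V (mk ?S). is_set V x \<and> equipotent V x n"
    unfolding el_V[OF SV] el_mk[OF S] using x_props(3) is_set_V by blast
  moreover have "is_set V (mk ?S)" using SV S by (simp add: is_set_V)
  ultimately obtain f where f: "is_choice_function V f (mk ?S)"
    using ac unfolding AC_n_def by blast
  have fV: "f \<in> VU" using f is_function_on_V_in unfolding is_choice_function_def by blast
  have f_fun: "is_function_on M f (mk ?S)" and
    f_el: "\<And>x y. (x, y) \<in> rel_of M f \<Longrightarrow> y \<in> elems V x"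
    using f is_function_on_V[OF fV SV] rel_of_V[OF fV] unfolding is_choice_function_def by blast+
  obtain Q where Q: "fin_part Q" "supports Q f" using V_support[OF fV] by blast
  obtain B where B: "B \<in> el Q" "\<not> Fin (el B)" using infinite_block[OF Q(1)] by blast
  have BU: "internal (el B)" "el B \<subseteq> el A" using fin_part_blocks(4)[OF Q(1) B(1)] B(1) by simp_all
  obtain T where T: "T \<subseteq> el B" "internal T" "eqp T (el n)"
    using infinite_has_subset[OF BU(1) B(2) n(1)] by blast
  have x: "mk T \<in> ?S" using T BU by (auto simp: equipotent_iff)
  obtain R where R: "bijrel R T (el n)" using T(3) unfolding eqp_def by blast
  have "emp \<noteq> sc emp" using sc(2)[of emp] by (metis emp(2,3) empty_iff insertI1)
  then obtain p q where pq: "p \<in> T" "q \<in> T" "p \<noteq> q"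
    using bijrelD(1)[OF R] bijrelD(3)[OF R n(2)] bijrelD(3)[OF R n(3)] bijrelD(4)[OF R] by blast
  obtain c where c: "(mk T, c) \<in> rel_of M f"
    using f_fun x el_mk[OF S] unfolding is_function_on_iff by blast
  have cT: "c \<in> T" using f_el[OF c] el_V[OF x_props(3)[OF x]] T(2) by simp
  obtain d where d: "d \<in> T" "d \<noteq> c" using pq by blast
  have cd: "c \<in> el A" "d \<in> el A" using cT d T(1) BU by blast+
  \<comment> \<open>Exchanging the chosen \<open>c\<close> with another element \<open>d\<close> of
    \<open>T\<close> preserves \<open>T\<close> as a set and fixes \<open>f\<close>, so
    \<open>d\<close> would be chosen as well.\<close>
  have "act (swap c d) (mk T) = mk T"
    by (rule act_swap_set[OF cd]) (use T BU cT d in auto)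
  then have "(mk T, d) \<in> rel_of M f"
    using block_cases[OF Q V_in_U[OF fV] B(1) _ _ c, of c d] act_swap(1)[OF cd] T(1) cT d by auto
  then show False using c f_fun d(2) unfolding is_function_on_iff by blast
qed

lemma at_least_two_V:
  assumes "n \<in> el om" "at_least_two V n" shows "emp \<in> el n" "sc emp \<in> el n"
proof -
  obtain t e i where t: "n = t \<or> t \<in> elems V n" "is_empty V e" "is_succ V e i" "is_upair V e i t"
    using assms(2) unfolding at_least_two_def is_two_def by blast
  have e: "e = emp" using t(2) is_empty_V by blast
  have i: "i = sc emp" using t(3) is_succ_V[of emp i] nat_V[of emp] e by simp
  have "t \<in> VU" "elems V t = {emp, sc emp}" using t(4) e i by (simp_all add: is_upair_def is_set_V)
  then have "el t = {emp, sc emp}" using el_V by simp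
  moreover have "el t \<subseteq> el n" using t(1) om_trans[OF assms(1)] el_V[OF nat_V[OF assms(1)]] by auto
  ultimately show "emp \<in> el n" "sc emp \<in> el n" by auto
qed

section \<open>Failure of Martin's axiom\<close>


text \<open>
  The conditions are the reflexive tournaments on finite sets \<open>E\<close> of atoms. Such a tournament is
  incompatible with its image under a transposition of two points of \<open>E\<close>, but compatible with
  its image under a transposition of a point of \<open>E\<close> and an atom outside of \<open>E\<close>.
\<close>

definition tour :: "'a \<Rightarrow> 'a set \<Rightarrow> bool" where
  "tour p E \<longleftrightarrow> is_rel p \<and> rel_of M p \<subseteq> E \<times> E \<and>
     (\<forall>x \<in> E. \<forall>y \<in> E. (x, y) \<in> rel_of M p \<or> (y, x) \<in> rel_of M p) \<and> antisym (rel_of M p)"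

lemma tourD:
  assumes "tour p E"
  shows "is_rel p" "(x, y) \<in> rel_of M p \<Longrightarrow> x \<in> E \<and> y \<in> E"
    "x \<in> E \<Longrightarrow> y \<in> E \<Longrightarrow> (x, y) \<in> rel_of M p \<or> (y, x) \<in> rel_of M p"
    "(x, y) \<in> rel_of M p \<Longrightarrow> (y, x) \<in> rel_of M p \<Longrightarrow> x = y"
  using assms unfolding tour_def antisym_def by blast+

text \<open>Totality for \<open>x = y\<close> puts all loops into the tournament, so its vertex set
  can be recovered even if it has a single point.\<close>

lemma tour_field: "tour p E \<Longrightarrow> tour p F \<Longrightarrow> E = F"
  using tourD(2,3)[of p] by blast

lemma tour_mkr:
  assumes "irel R" "R \<subseteq> E \<times> E" "\<And>x y. x \<in> E \<Longrightarrow> y \<in> E \<Longrightarrow> (x, y) \<in> R \<or> (y, x) \<in> R"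
    "\<And>x y. (x, y) \<in> R \<Longrightarrow> (y, x) \<in> R \<Longrightarrow> x = y"
  shows "tour (mkr R) E"
  unfolding tour_def rel_of_mkr[OF assms(1)] antisym_def using assms is_rel_mkr by blast

lemma Df_tour:
  assumes "Dt K t" "Dt K u" shows "Df K (\<lambda>e. tour (t e) (el (u e)))"
proof (rule Df_cong)
  show "Df K (\<lambda>e. is_rel (t e) \<and> (\<forall>x \<in> U. \<forall>y \<in> U. (x, y) \<in> rel_of M (t e) \<longrightarrow> x \<in> el (u e) \<and> y \<in> el (u e)) \<and>
     (\<forall>x \<in> el (u e). \<forall>y \<in> el (u e). (x, y) \<in> rel_of M (t e) \<or> (y, x) \<in> rel_of M (t e)) \<and>
     (\<forall>x \<in> U. \<forall>y \<in> U. (x, y) \<in> rel_of M (t e) \<longrightarrow> (y, x) \<in> rel_of M (t e) \<longrightarrow> x = y))"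
    by (rule assms Df_is_rel Df_rel_of Df_logic Dt_var Dt_shift)+
  show "tour (t e) (el (u e)) \<longleftrightarrow> is_rel (t e) \<and> (\<forall>x \<in> U. \<forall>y \<in> U. (x, y) \<in> rel_of M (t e) \<longrightarrow> x \<in> el (u e) \<and> y \<in> el (u e)) \<and>
     (\<forall>x \<in> el (u e). \<forall>y \<in> el (u e). (x, y) \<in> rel_of M (t e) \<or> (y, x) \<in> rel_of M (t e)) \<and>
     (\<forall>x \<in> U. \<forall>y \<in> U. (x, y) \<in> rel_of M (t e) \<longrightarrow> (y, x) \<in> rel_of M (t e) \<longrightarrow> x = y)" for e
    unfolding tour_def antisym_def all_rel_of by (simp only: subset_iff mem_Sigma_iff split_paired_All all_rel_of)
qed

definition cond :: "'a \<Rightarrow> 'a set \<Rightarrow> bool" where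
  "cond p E \<longleftrightarrow> Fin E \<and> E \<subseteq> el A \<and> tour p E"

definition conds :: "'a set" where
  "conds = {p. \<exists>E. cond p E}"

text \<open>The quantifier over HOL sets is traded for one over elements of \<open>M\<close>, as
  needed for definability.\<close>

lemma conds_iff: "p \<in> conds \<longleftrightarrow> (\<exists>X \<in> U. cond p (el X))"
  unfolding conds_def mem_Collect_eq cond_def by (metis Fin_internal el_mk mk_in_U)

lemma cond_rel_in_A: "cond p E \<Longrightarrow> rel_of M p \<subseteq> el A \<times> el A"
  unfolding cond_def tour_def by blast

lemma cond_V:
  assumes "cond p E" shows "p \<in> VU" "fsupp E p"
proof -
  have E: "Fin E" "E \<subseteq> el A" "tour p E" using assms unfolding cond_def by blast+
  have pair: "x \<in> VU \<and> y \<in> VU \<and> fsupp E x \<and> fsupp E y" if "(x, y) \<in> rel_of M p" for x y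
  proof -
    have "x \<in> E" "y \<in> E" using tourD(2)[OF E(3) that] by blast+
    then show ?thesis using atom_V E(1,2) fsupp_mono[OF _ E(1) _ E(2)] by blast
  qed
  show "p \<in> VU" using fsupp_rel_V[OF tourD(1)[OF E(3)] E(1,2) pair] .
  show "fsupp E p"
    unfolding fsupp_def
  proof (intro conjI E ballI impI)
    fix g assume g: "g \<in> G" "\<forall>a \<in> E. act g a = a"
    have s: "is_set M p" "is_rel p" using tourD(1)[OF E(3)] by (simp_all add: is_rel_def)
    show "act g p = p"
    proof (rule act_elementwise[OF g(1) s(1)])
      fix z assume z: "z \<in> el p"
      then obtain x y where xy: "x \<in> U" "y \<in> U" "z = Pr x y" using s(2) unfolding is_rel_def by blast
      then have "x \<in> E" "y \<in> E" using tourD(2)[OF E(3), of x y] z by (simp_all add: rel_of_iff)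
      then show "act g z = z" using xy act_Pr[OF g(1)] g(2) by simp
    qed
  qed
qed

lemma conds_V: "conds \<subseteq> VU"
  unfolding conds_def using cond_V(1) by blast

lemma Df_cond:
  assumes "A \<in> K" "om \<in> K" "Dt K t" "Dt K u" shows "Df K (\<lambda>e. cond (t e) (el (u e)))"
  unfolding cond_def by (rule assms Df_Fin_om Df_tour Df_logic Dt_var Dt_const A_simps(2))+

lemma Df_conds: "Df {A, om} (\<lambda>e. e 0 \<in> conds)"
  unfolding conds_iff by (rule Df_cond Df_logic Dt_var insertI1 insertI2)+

lemma internal_conds: "internal conds"
proof (rule internal_sepI[OF Df_conds])
  have "internal (codes (el A \<times> el A))" using irel_Times[of "el A" "el A"] by (simp add: irel_def)
  then show "internal {z. is_set M z \<and> el z \<subseteq> codes (el A \<times> el A)}" by (rule internal_Pow)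
  show "conds \<subseteq> {z. is_set M z \<and> el z \<subseteq> codes (el A \<times> el A)}"
  proof
    fix p assume "p \<in> conds"
    then obtain E where p: "cond p E" unfolding conds_def by blast
    then have "is_rel p" unfolding cond_def tour_def by blast
    then show "p \<in> {z. is_set M z \<and> el z \<subseteq> codes (el A \<times> el A)}"
      using cond_rel_in_A[OF p] is_rel_codes[of p] unfolding codes_def is_rel_def by blast
  qed
qed

definition Tour :: 'a where "Tour = mk conds"

lemma Tour: "el Tour = conds" "is_set M Tour" "Tour \<in> VU" "fsupp {} Tour" "Tour \<in> U"
  unfolding Tour_def using internal_conds V_definable[OF internal_conds conds_V Df_conds] act_A act_om by auto

text \<open>The order of \<open>om\<close> is pulled back along an enumeration of the atoms in
  \<open>M\<close>. It serves to orient edges; only finite parts of it enter conditions, so it need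
  not belong to the model.\<close>

lemma linear_order_A:
  obtains L where "irel L" "L \<subseteq> el A \<times> el A" "\<And>x y. x \<in> el A \<Longrightarrow> y \<in> el A \<Longrightarrow> (x, y) \<in> L \<or> (y, x) \<in> L"
    "\<And>x y. (x, y) \<in> L \<Longrightarrow> (y, x) \<in> L \<Longrightarrow> x = y"
proof -
  obtain R where R: "irel R" "bijrel R (el A) (el om)" using A_eqp_om unfolding eqp_def by blast
  note r = bijrelD[OF R(2)]
  let ?P = "\<lambda>x y. \<exists>n \<in> U. \<exists>m \<in> U. (x, n) \<in> R \<and> (y, m) \<in> R \<and> (n \<in> el m \<or> n = m)"
  have D: "Df U (\<lambda>e. ?P (e 0) (e 1))"
    by (rule Df_irel_mem R(1) Df_logic Dt_var)+
  let ?L = "{(x, y). x \<in> el A \<and> y \<in> el A \<and> ?P x y}"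
  have L: "irel ?L" by (rule irel_sep2[OF _ _ D]) simp_all
  show thesis
  proof (rule that[OF L])
    show "?L \<subseteq> el A \<times> el A" by blast
    show "(x, y) \<in> ?L \<or> (y, x) \<in> ?L" if xy: "x \<in> el A" "y \<in> el A" for x y
    proof -
      obtain n m where nm: "(x, n) \<in> R" "(y, m) \<in> R" using r(2) xy by blast
      then have "n \<in> el om" "m \<in> el om" using r(1) by blast+
      then have "n \<in> el m \<or> n = m \<or> m \<in> el n" "n \<in> U" "m \<in> U" using om_linear by auto
      then show ?thesis using nm xy by blast
    qed
    show "x = y" if xy: "(x, y) \<in> ?L" "(y, x) \<in> ?L" for x y
    proof -
      obtain n m where nm: "(x, n) \<in> R" "(y, m) \<in> R" "n \<in> el m \<or> n = m" using xy(1) by blast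
      obtain n' m' where nm': "(x, n') \<in> R" "(y, m') \<in> R" "m' \<in> el n' \<or> m' = n'" using xy(2) by blast
      have eq: "n' = n" "m' = m" using r(4) nm nm' by blast+
      have om: "n \<in> el om" "m \<in> el om" using r(1) nm by blast+
      have "n = m"
        using nm(3) nm'(3) om_trans[OF om(2), of n] om_irrefl[OF om(2)] unfolding eq by blast
      then show ?thesis using r(5) nm by blast
    qed
  qed
qed

text \<open>Edges inside \<open>E\<close> are kept, all other edges on \<open>F\<close> are oriented
  by the linear order.\<close>

lemma cond_extend:
  assumes p: "cond p E" and F: "Fin F" "E \<subseteq> F" "F \<subseteq> el A"
  obtains q where "cond q F" "rel_of M p \<subseteq> rel_of M q"
proof -
  obtain L where L: "irel L" "L \<subseteq> el A \<times> el A" "\<And>x y. x \<in> el A \<Longrightarrow> y \<in> el A \<Longrightarrow> (x, y) \<in> L \<or> (y, x) \<in> L"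
    "\<And>x y. (x, y) \<in> L \<Longrightarrow> (y, x) \<in> L \<Longrightarrow> x = y"
    using linear_order_A by blast
  have E: "internal E" "tour p E" using p Fin_internal unfolding cond_def by blast+
  note t = tourD[OF E(2)]
  have FI: "internal F" using Fin_internal[OF F(1)] .
  have D: "Df U (\<lambda>e. (e 0, e 1) \<in> L \<and> \<not> (e 0 \<in> E \<and> e 1 \<in> E))"
    by (rule Df_irel_mem Df_internal_mem L(1) E(1) Df_logic Dt_var)+
  have "irel {(x, y). x \<in> F \<and> y \<in> F \<and> (x, y) \<in> L \<and> \<not> (x \<in> E \<and> y \<in> E)}" (is "irel ?N")
    by (rule irel_sep2[OF FI FI D])
  then have R: "irel (rel_of M p \<union> ?N)" using irel_rel_of[OF t(1)] by (intro irel_Un)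
  have pE: "rel_of M p \<subseteq> E \<times> E" using t(2) by auto
  have "tour (mkr (rel_of M p \<union> ?N)) F"
  proof (rule tour_mkr[OF R])
    show "rel_of M p \<union> ?N \<subseteq> F \<times> F" using pE F(2) by blast
    show "(x, y) \<in> rel_of M p \<union> ?N \<or> (y, x) \<in> rel_of M p \<union> ?N" if "x \<in> F" "y \<in> F" for x y
      using that t(3)[of x y] L(3)[of x y] F(3) by blast
    show "x = y" if "(x, y) \<in> rel_of M p \<union> ?N" "(y, x) \<in> rel_of M p \<union> ?N" for x y
      using that pE t(4)[of x y] L(4)[of x y] by blast
  qed
  then have "cond (mkr (rel_of M p \<union> ?N)) F" using F unfolding cond_def by blast
  moreover have "rel_of M p \<subseteq> rel_of M (mkr (rel_of M p \<union> ?N))" unfolding rel_of_mkr[OF R] by blast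
  ultimately show thesis using that by blast
qed

lemma cond_empty: "cond emp {}"
  unfolding cond_def tour_def is_rel_def antisym_def by (auto simp: rel_of_iff)

text \<open>The image of \<open>p\<close> lives on \<open>E\<close> with \<open>a\<close> replaced
  by \<open>c\<close> and agrees with \<open>p\<close> away from these two points. In the union of
  both, only the pair of \<open>a\<close> and \<open>c\<close> is undecided, and the edge
  \<open>(a, c)\<close> settles it arbitrarily.\<close>

lemma cond_swap:
  assumes p: "cond p E" and ac: "a \<in> E" "c \<in> el A" "c \<notin> E"
  obtains s where "cond s (insert c E)" "rel_of M p \<subseteq> rel_of M s" "rel_of M (act (swap a c) p) \<subseteq> rel_of M s"
proof -
  have E: "Fin E" "E \<subseteq> el A" "tour p E" using p unfolding cond_def by blast+
  note t = tourD[OF E(3)]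
  have aA: "a \<in> el A" using ac(1) E(2) by blast
  let ?g = "swap a c"
  have g: "?g \<in> G" using swap_in_G[OF aA ac(2)] .
  note sw = act_swap[OF aA ac(2)]
  let ?R = "rel_of M p" and ?S = "rel_of M (act ?g p)"
  have pU: "is_set M p" "p \<in> U" using t(1) by (simp_all add: is_rel_def)
  have sp: "is_set M (act ?g p)" "el (act ?g p) = act ?g ` el p" using act_set[OF g pU(1)] by blast+
  have S_iff: "(x, y) \<in> ?S \<longleftrightarrow> (\<exists>u v. (u, v) \<in> ?R \<and> x = act ?g u \<and> y = act ?g v)" (is "?l \<longleftrightarrow> ?r") for x y
  proof
    assume ?l
    then have xy: "x \<in> U" "y \<in> U" "Pr x y \<in> act ?g ` el p" using sp by (simp_all add: rel_of_iff)
    then obtain z where z: "z \<in> el p" "Pr x y = act ?g z" by blast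
    then obtain u v where uv: "u \<in> U" "v \<in> U" "z = Pr u v" using t(1) unfolding is_rel_def by blast
    then have "Pr x y = Pr (act ?g u) (act ?g v)" using z(2) act_Pr[OF g] by simp
    then have "x = act ?g u \<and> y = act ?g v" using Pr_inj xy(1,2) uv g by simp
    then show ?r using z(1) uv by (auto simp: rel_of_iff)
  next
    assume ?r
    then show ?l using act_rel_of[OF g _ _ pU(2)] rel_of_in_U by blast
  qed
  have "is_rel (act ?g p)"
    unfolding is_rel_def
  proof (intro conjI ballI sp(1))
    fix z assume "z \<in> el (act ?g p)"
    then obtain w where w: "w \<in> el p" "z = act ?g w" using sp by blast
    then obtain u v where "u \<in> U" "v \<in> U" "w = Pr u v" using t(1) unfolding is_rel_def by blast
    then show "\<exists>x \<in> U. \<exists>y \<in> U. z = Pr x y"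
      using w act_Pr[OF g] g by (intro bexI[of _ "act ?g u"] bexI[of _ "act ?g v"]) simp_all
  qed
  then have R: "irel (insert (a, c) (?R \<union> ?S))"
    using irel_rel_of t(1) aA ac(2) by (intro irel_insert irel_Un) simp_all
  have actE: "act ?g u = (if u = a then c else u)" if "u \<in> E" for u
    using sw that E(2) ac(3) by auto
  have S_iff': "(x, y) \<in> ?S \<longleftrightarrow> (\<exists>u v. (u, v) \<in> ?R \<and> x = (if u = a then c else u) \<and> y = (if v = a then c else v))" for x y
    unfolding S_iff using t(2) actE by metis
  \<comment> \<open>Facts about the image: it avoids \<open>a\<close>, agrees with \<open>p\<close>
    off \<open>c\<close>, lives on \<open>insert c E\<close>, is antisymmetric, and relates
    \<open>c\<close> to every point of \<open>insert c E\<close> except \<open>a\<close>.\<close>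
  have S1: "x \<noteq> a \<and> y \<noteq> a" if "(x, y) \<in> ?S" for x y
    using that t(2) ac unfolding S_iff' by (metis (full_types))
  have S2: "(x, y) \<in> ?R" if "(x, y) \<in> ?S" "x \<noteq> c" "y \<noteq> c" for x y
    using that unfolding S_iff' by (metis (full_types))
  have S3: "x \<in> insert c E \<and> y \<in> insert c E" if "(x, y) \<in> ?S" for x y
    using that t(2) unfolding S_iff' by (metis (full_types) insertCI)
  have S4: "x = y" if xy: "(x, y) \<in> ?S" "(y, x) \<in> ?S" for x y
  proof -
    obtain u v where uv: "(u, v) \<in> ?R" "x = (if u = a then c else u)" "y = (if v = a then c else v)"
      using xy(1) unfolding S_iff' by blast
    obtain u' v' where uv': "(v', u') \<in> ?R" "y = (if v' = a then c else v')" "x = (if u' = a then c else u')"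
      using xy(2) unfolding S_iff' by blast
    have "u' = u" "v' = v" using uv uv' t(2) ac by (metis (full_types))+
    then show ?thesis using t(4) uv uv' by metis
  qed
  have S5: "(x, c) \<in> ?S \<or> (c, x) \<in> ?S" if x: "x \<in> insert c E" "x \<noteq> a" for x
  proof (cases "x = c")
    case True
    have "(a, a) \<in> ?R" using t(3) ac by blast
    then have "(c, c) \<in> ?S" unfolding S_iff' by (intro exI[of _ a]) simp
    then show ?thesis using True by blast
  next
    case False
    then have "(x, a) \<in> ?R \<or> (a, x) \<in> ?R" using t(3) ac x by blast
    then show ?thesis unfolding S_iff' using x(2) by metis
  qed
  have "tour (mkr (insert (a, c) (?R \<union> ?S))) (insert c E)"
  proof (rule tour_mkr[OF R])
    have "?R \<subseteq> E \<times> E" using t(2) by auto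
    moreover have "?S \<subseteq> insert c E \<times> insert c E" using S3 by auto
    ultimately show "insert (a, c) (?R \<union> ?S) \<subseteq> insert c E \<times> insert c E" using ac by blast
    show "(x, y) \<in> insert (a, c) (?R \<union> ?S) \<or> (y, x) \<in> insert (a, c) (?R \<union> ?S)"
      if xy: "x \<in> insert c E" "y \<in> insert c E" for x y
    proof -
      consider "x \<in> E" "y \<in> E" | "x = c" "y \<noteq> a" | "y = c" "x \<noteq> a" | "x = c" "y = a" | "x = a" "y = c"
        using xy by blast
      then show ?thesis
        using t(3)[of x y] S5[of x] S5[of y] xy by cases blast+
    qed
    have R1: "x \<noteq> c \<and> y \<noteq> c" if "(x, y) \<in> ?R" for x y using t(2)[OF that] ac(3) by blast
    have RS: "x = y" if "(x, y) \<in> ?R" "(y, x) \<in> ?S" for x y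
      using S2[OF that(2)] R1[OF that(1)] t(4) that(1) by blast
    show "x = y" if "(x, y) \<in> insert (a, c) (?R \<union> ?S)" "(y, x) \<in> insert (a, c) (?R \<union> ?S)" for x y
      using that RS[of x y] RS[of y x] t(4)[of x y] S4[of x y] R1[of x y] R1[of y x] S1[of x y] S1[of y x] by blast
  qed
  then have "cond (mkr (insert (a, c) (?R \<union> ?S))) (insert c E)"
    using E ac unfolding cond_def by simp
  then show thesis using that rel_of_mkr[OF R] by blast
qed

definition ext_rel :: "('a \<times> 'a) set" where
  "ext_rel = {(q, p). q \<in> conds \<and> p \<in> conds \<and> el p \<subseteq> el q}"

lemma ext_rel_iff:
  assumes "q \<in> conds" "p \<in> conds" shows "(q, p) \<in> ext_rel \<longleftrightarrow> rel_of M p \<subseteq> rel_of M q"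
proof -
  have "is_rel p" "is_rel q" using assms unfolding conds_def cond_def tour_def by blast+
  then have "codes (rel_of M p) = el p" "codes (rel_of M q) = el q" by (simp_all add: is_rel_codes)
  moreover have "codes (rel_of M p) \<subseteq> codes (rel_of M q)" if "rel_of M p \<subseteq> rel_of M q"
    using that unfolding codes_def by (rule image_mono)
  moreover have "rel_of M p \<subseteq> rel_of M q" if "el p \<subseteq> el q"
    using that by (auto simp: rel_of_iff)
  ultimately have "el p \<subseteq> el q \<longleftrightarrow> rel_of M p \<subseteq> rel_of M q" by metis
  then show ?thesis using assms unfolding ext_rel_def by blast
qed

lemma irel_ext_rel: "irel ext_rel"
proof -
  have "Df U (\<lambda>e. el (e 1) \<subseteq> el (e 0))" by (rule Df_logic Dt_var)+
  from irel_sep2[OF internal_conds internal_conds this] show ?thesis unfolding ext_rel_def .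
qed

definition ext_code :: 'a where "ext_code = mkr ext_rel"

lemma ext_code_V: "ext_code \<in> VU"
  unfolding ext_code_def
proof (rule rel_V_definable(1)[OF irel_ext_rel])
  have "Df {Tour} (\<lambda>e. e 0 \<in> el Tour \<and> e 1 \<in> el Tour \<and> el (e 1) \<subseteq> el (e 0))"
    by (rule Df_logic Dt_var Dt_const insertI1 Tour(5))+
  then show "Df {Tour} (\<lambda>e. (e 0, e 1) \<in> ext_rel)" by (simp add: ext_rel_def Tour(1))
  show "act g k = k" if "g \<in> G" "k \<in> {Tour}" for g k
    using that Tour(4) unfolding fsupp_def by auto
  show "\<exists>E F. x \<in> VU \<and> y \<in> VU \<and> fsupp E x \<and> fsupp F y" if "(x, y) \<in> ext_rel" for x y
    using that cond_V unfolding ext_rel_def conds_def by blast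
qed

lemma rel_of_ext_code: "rel_of V ext_code = ext_rel"
  using rel_of_V[OF ext_code_V] rel_of_mkr[OF irel_ext_rel] by (simp add: ext_code_def)

lemma quasi_order_Tour: "is_quasi_order V Tour ext_code"
proof -
  have "is_relation_on V ext_code Tour"
    unfolding is_relation_on_def el_V[OF ext_code_V] el_V[OF Tour(3)] is_set_V
  proof (intro conjI ext_code_V ballI)
    show "is_set M ext_code" unfolding ext_code_def using irel_ext_rel by simp
    fix p assume p: "p \<in> el ext_code"
    then obtain x y where "(x, y) \<in> ext_rel" "p = Pr x y"
      unfolding ext_code_def el_mkr[OF irel_ext_rel] mem_codes by blast
    moreover from this have "x \<in> el Tour" "y \<in> el Tour" unfolding ext_rel_def Tour(1) by blast+
    ultimately show "\<exists>x \<in> el Tour. \<exists>y \<in> el Tour. is_opair V x y p"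
      using is_opair_V[OF V_trans[OF ext_code_V p]] unfolding is_opair_iff by (blast intro: el_in_U)
  qed
  moreover have "trans ext_rel" unfolding trans_def ext_rel_def by blast
  moreover have "\<forall>p \<in> el Tour. (p, p) \<in> ext_rel" unfolding ext_rel_def Tour(1) by blast
  ultimately show ?thesis
    unfolding is_quasi_order_def rel_of_ext_code el_V[OF Tour(3)] is_set_V using Tour by blast
qed

lemma ccc_Tour: "is_ccc V Tour ext_code"
  unfolding is_ccc_def
proof (intro allI impI)
  fix C assume "is_antichain V Tour ext_code C"
  then have C: "C \<in> VU" "is_set M C" "el C \<subseteq> conds"
    and anti: "\<And>p q. p \<in> el C \<Longrightarrow> q \<in> el C \<Longrightarrow> p \<noteq> q \<Longrightarrow> \<not> compatible V Tour ext_code p q"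
    unfolding is_antichain_def is_set_V using el_V Tour(1,3) by auto
  obtain Q where Q: "fin_part Q" "supports Q C" using V_support[OF C(1)] by blast
  let ?E = "\<Union>B \<in> {B \<in> el Q. Fin (el B)}. el B"
  have EF: "Fin ?E" using Fin_small_blocks[OF Q(1)] .
  have EA: "?E \<subseteq> el A" using fin_part_blocks(4)[OF Q(1)] by blast
  have sub: "E \<subseteq> ?E" if p: "p \<in> el C" "cond p E" for p E
  proof
    fix a assume a: "a \<in> E"
    have E: "Fin E" "E \<subseteq> el A" "tour p E" using p(2) unfolding cond_def by blast+
    have aA: "a \<in> el A" using a E(2) by blast
    obtain B where B: "B \<in> el Q" "a \<in> el B" using fin_part_blocks(5)[OF Q(1) aA] by blast
    have "Fin (el B)"
    proof (rule ccontr)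
      assume inf: "\<not> Fin (el B)"
      \<comment> \<open>An infinite block offers a point \<open>c\<close> outside the finite set
        \<open>E\<close>. The image of \<open>p\<close> under the transposition of \<open>a\<close>
        and \<open>c\<close> stays in the antichain and is compatible with \<open>p\<close>, hence
        equal to \<open>p\<close>.\<close>
      obtain c where c: "c \<in> el B" "c \<notin> E"
        using infinite_pick[OF inf _ E(1)] B(1) by auto
      have cA: "c \<in> el A" using c fin_part_blocks(4)[OF Q(1) B(1)] by blast
      let ?g = "swap a c"
      have g: "?g \<in> G" using swap_in_G[OF aA cA] .
      have "act ?g C = C" using supports_swap[OF Q B c(1)] .
      then have gC: "act ?g p \<in> el C" using act_mem[OF g, of p C] p(1) C(1) by simp
      obtain s where s: "cond s (insert c E)" "rel_of M p \<subseteq> rel_of M s" "rel_of M (act ?g p) \<subseteq> rel_of M s"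
        using cond_swap[OF p(2) a cA c(2)] by blast
      have sc: "s \<in> conds" using s(1) unfolding conds_def by blast
      have "(s, p) \<in> ext_rel" "(s, act ?g p) \<in> ext_rel"
        using ext_rel_iff[OF sc] s(2,3) C(3) p(1) gC by blast+
      then have "compatible V Tour ext_code p (act ?g p)"
        unfolding compatible_def rel_of_ext_code el_V[OF Tour(3)] Tour(1) using sc by blast
      then have eq: "act ?g p = p" using anti p(1) gC by metis
      \<comment> \<open>Equality is absurd: the loop at \<open>a\<close> would be carried to a loop
        at \<open>c\<close>, which is not a vertex of \<open>p\<close>.\<close>
      have "(a, a) \<in> rel_of M p" using tourD(3)[OF E(3) a a] by blast
      then have "(act ?g a, act ?g a) \<in> rel_of M p"
        using fixed_rel_of[OF g eq] p(1) by simp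
      then have "(c, c) \<in> rel_of M p" using act_swap(1)[OF aA cA] by simp
      then show False using tourD(2)[OF E(3)] c(2) by blast
    qed
    then show "a \<in> ?E" using B by blast
  qed
  \<comment> \<open>Kuratowski pairs over \<open>?E\<close> lie in its double power set, so
    relations on \<open>?E\<close> lie in the triple power set, which is finite.\<close>
  let ?PP = "{z. is_set M z \<and> el z \<subseteq> {z. is_set M z \<and> el z \<subseteq> {z. is_set M z \<and> el z \<subseteq> ?E}}}"
  have "el C \<subseteq> ?PP"
  proof
    fix p assume p: "p \<in> el C"
    then obtain E where E: "cond p E" using C(3) unfolding conds_def by blast
    have t: "tour p E" using E unfolding cond_def by blast
    have "z \<in> {z. is_set M z \<and> el z \<subseteq> {z. is_set M z \<and> el z \<subseteq> ?E}}" if z: "z \<in> el p" for z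
    proof -
      obtain x y where xy: "x \<in> U" "y \<in> U" "z = Pr x y"
        using tourD(1)[OF t] z unfolding is_rel_def by blast
      then have "(x, y) \<in> rel_of M p" using z by (simp add: rel_of_iff)
      then have "x \<in> ?E" "y \<in> ?E" using tourD(2)[OF t] sub[OF p E] by blast+
      then show ?thesis using xy by (simp add: el_Pr)
    qed
    then show "p \<in> ?PP" using tourD(1)[OF t] unfolding is_rel_def by blast
  qed
  from Fin_subset[OF Fin_Pow[OF Fin_Pow[OF Fin_Pow[OF EF]]] this internal_el[OF V_in_U[OF C(1)]]]
  have "Fin (el C)" .
  then obtain n where n: "n \<in> el om" "eqp (el C) (el n)" unfolding Fin_def by blast
  then obtain f where f: "is_bijection M f C n" using equipotent_iff equipotent_def by metis
  \<comment> \<open>Finiteness in \<open>M\<close> must be carried to the model: all conditions in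
    the antichain have their vertices in \<open>?E\<close>, so \<open>?E\<close> supports every
    entry of the bijection.\<close>
  have "f \<in> VU"
  proof (rule fsupp_rel_V[OF _ EF EA])
    show "is_rel f" using f by (simp add: is_bijection_iff)
    fix p i assume "(p, i) \<in> rel_of M f"
    then have pi: "p \<in> el C" "i \<in> el n" using f unfolding is_bijection_iff bijrel_def by blast+
    have i: "i \<in> el om" using pi(2) om_el_subset[OF n(1)] by blast
    obtain E where E: "cond p E" using C(3) pi(1) unfolding conds_def by blast
    show "p \<in> VU \<and> i \<in> VU \<and> fsupp ?E p \<and> fsupp ?E i"
      using cond_V[OF E] nat_V[OF i] fsupp_mono[OF _ EF _ EA] sub[OF pi(1) E] fsupp_nat[OF i] by blast
  qed
  then have "equipotent V C n" using equipotent_V_I[OF f _ C(1) nat_V[OF n(1)]] by blast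
  then show "countable_in V C"
    unfolding countable_in_def finite_in_def is_natural_V is_set_V using C n(1) by blast
qed

text \<open>\<open>p\<close> has at least \<open>n\<close> vertices. A subset of size exactly
  \<open>n\<close> expresses this without defining the size of the vertex set.\<close>

definition large :: "'a \<Rightarrow> 'a \<Rightarrow> bool" where
  "large p n \<longleftrightarrow> p \<in> el Tour \<and> (\<exists>X \<in> U. \<exists>Y \<in> U. cond p (el X) \<and> el Y \<subseteq> el X \<and> equipotent M Y n)"

lemma largeE:
  assumes "large p n" obtains E T where "cond p E" "T \<subseteq> E" "internal T" "eqp T (el n)"
  using assms unfolding large_def equipotent_iff by (metis internal_el)

lemma largeI: "cond p E \<Longrightarrow> T \<subseteq> E \<Longrightarrow> internal T \<Longrightarrow> eqp T (el n) \<Longrightarrow> large p n"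
  unfolding large_def equipotent_iff Tour(1) conds_def
  by (intro conjI CollectI exI[of _ E] bexI[of _ "mk E"] bexI[of _ "mk T"])
    (simp_all add: Fin_internal cond_def)

lemma Df_large:
  assumes "A \<in> K" "om \<in> K" "Tour \<in> K" "Dt K t" "Dt K u" shows "Df K (\<lambda>e. large (t e) (u e))"
  unfolding large_def by (rule assms Df_cond Df_funs Df_logic Dt_var Dt_const Dt_shift Tour(5))+

definition dense_set :: "'a \<Rightarrow> 'a" where
  "dense_set n = mk {p \<in> el Tour. large p n}"

lemma fixed_params: "g \<in> G \<Longrightarrow> k \<in> {A, om, Tour} \<Longrightarrow> act g k = k"
  using act_A act_om Tour(4) unfolding fsupp_def by auto

lemma dense_set:
  assumes n: "n \<in> el om"
  shows "el (dense_set n) = {p \<in> el Tour. large p n}" "dense_set n \<in> VU" "fsupp {} (dense_set n)"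
    "is_set M (dense_set n)"
proof -
  have nU: "n \<in> U" using n by simp
  have D: "Df {n, A, om, Tour} (\<lambda>e. large (e 0) n)"
    by (rule Df_large Dt_var Dt_const insertI1 insertI2 nU)+
  have I: "internal {p \<in> el Tour. large p n}"
    by (rule internal_sep[OF D internal_el[OF Tour(5)]])
  have D': "Df {n, A, om, Tour} (\<lambda>e. e 0 \<in> {p \<in> el Tour. large p n})"
    by (rule Df_cong[OF D]) (auto simp: large_def)
  have sub: "{p \<in> el Tour. large p n} \<subseteq> VU" using conds_V Tour(1) by blast
  have "act g k = k" if "g \<in> G" "k \<in> {n, A, om, Tour}" for g k
    using that fixed_params act_nat n by blast
  from V_definable[OF I sub D' this]
  show "dense_set n \<in> VU" "fsupp {} (dense_set n)" unfolding dense_set_def by blast+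
  show "el (dense_set n) = {p \<in> el Tour. large p n}" "is_set M (dense_set n)"
    unfolding dense_set_def using I by simp_all
qed

lemma dense_set_dense:
  assumes n: "n \<in> el om" shows "is_dense V Tour ext_code (dense_set n)"
  unfolding is_dense_def rel_of_ext_code el_V[OF Tour(3)] el_V[OF dense_set(2)[OF n]] is_set_V dense_set(1)[OF n]
proof (intro conjI ballI dense_set n)
  show "{p \<in> el Tour. large p n} \<subseteq> el Tour" by blast
  fix p assume p: "p \<in> el Tour"
  then obtain E where E: "cond p E" unfolding Tour(1) conds_def by blast
  have EF: "Fin E" "E \<subseteq> el A" using E unfolding cond_def by blast+
  obtain T where T: "T \<subseteq> el A" "internal T" "eqp T (el n)"
    using infinite_has_subset[OF _ A_infinite n] by auto
  have "Fin T" using T n unfolding Fin_def by blast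
  then have F: "Fin (E \<union> T)" "E \<union> T \<subseteq> el A" using EF T(1) by auto
  obtain q where q: "cond q (E \<union> T)" "rel_of M p \<subseteq> rel_of M q"
    using cond_extend[OF E F(1) _ F(2)] by blast
  have qP: "q \<in> conds" using q(1) unfolding conds_def by blast
  have "large q n" using largeI[OF q(1) _ T(2,3)] by blast
  moreover have "(q, p) \<in> ext_rel" using ext_rel_iff[OF qP] q(2) p Tour(1) by blast
  ultimately show "\<exists>d \<in> {p \<in> el Tour. large p n}. (d, p) \<in> ext_rel" using qP Tour(1) by blast
qed

text \<open>A tournament on exactly \<open>n\<close> points separates the two sets. Distinctness is
  used for the bijection of the family of dense sets with \<open>om\<close>, which countability in
  the model demands.\<close>

lemma dense_set_inj_less:
  assumes "n \<in> el om" "m \<in> el om" "n \<in> el m" shows "dense_set n \<noteq> dense_set m"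
proof
  assume eq: "dense_set n = dense_set m"
  obtain T where T: "T \<subseteq> el A" "internal T" "eqp T (el n)"
    using infinite_has_subset[OF _ A_infinite assms(1)] by auto
  have F: "Fin T" using T assms(1) unfolding Fin_def by blast
  obtain p where p: "cond p T" using cond_extend[OF cond_empty F _ T(1)] by blast
  have "large p n" using largeI[OF p _ T(2,3)] by blast
  then have "p \<in> el (dense_set n)" using dense_set(1)[OF assms(1)] unfolding large_def by blast
  then have "large p m" using eq dense_set(1)[OF assms(2)] by simp
  then obtain E T' where T': "cond p E" "T' \<subseteq> E" "internal T'" "eqp T' (el m)" by (rule largeE)
  have "E = T" using tour_field T'(1) p unfolding cond_def by blast
  then show False using not_eqp_larger[OF assms _ T'(3) T(3)] T'(2,4) by blast
qed

lemma dense_set_inj: "n \<in> el om \<Longrightarrow> m \<in> el om \<Longrightarrow> dense_set n = dense_set m \<Longrightarrow> n = m"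
  using om_linear dense_set_inj_less by metis

lemma Df_dense_set:
  assumes "A \<in> K" "om \<in> K" "Tour \<in> K" "Dt K t" "Dt K u"
  shows "Df K (\<lambda>e. is_set M (t e) \<and> (\<forall>p \<in> U. p \<in> el (t e) \<longleftrightarrow> p \<in> el Tour \<and> large p (u e)))"
  by (rule assms Df_large Df_logic Dt_var Dt_const Dt_shift Tour(5))+

lemma eq_dense_set:
  assumes "n \<in> el om"
  shows "D = dense_set n \<longleftrightarrow> is_set M D \<and> (\<forall>p \<in> U. p \<in> el D \<longleftrightarrow> p \<in> el Tour \<and> large p n)"
proof
  assume "is_set M D \<and> (\<forall>p \<in> U. p \<in> el D \<longleftrightarrow> p \<in> el Tour \<and> large p n)"
  then show "D = dense_set n"
    using ext_set[of D "dense_set n"] dense_set[OF assms] el_subset_U[of D] el_subset_U[of Tour] by blast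
qed (use dense_set[OF assms] in blast)

definition DD :: 'a where "DD = mk (dense_set ` el om)"

lemma DD: "el DD = dense_set ` el om" "DD \<in> VU" "is_set M DD"
  and countable_DD: "countable_in V DD"
proof -
  let ?K = "{A, om, Tour}"
  let ?R = "\<lambda>n D. is_set M D \<and> (\<forall>p \<in> U. p \<in> el D \<longleftrightarrow> p \<in> el Tour \<and> large p n)"
  have D: "Df ?K (\<lambda>e. ?R (e 0) (e 1))"
    by (rule Df_dense_set Dt_var insertI1 insertI2)+
  have "internal {D \<in> U. \<exists>n \<in> el om. ?R n D}"
    by (rule internal_repl[OF D]) (use eq_dense_set[THEN iffD2] in \<open>simp_all, metis\<close>)
  moreover have im: "{D \<in> U. \<exists>n \<in> el om. ?R n D} = dense_set ` el om"
  proof -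
    have "{D \<in> U. \<exists>n \<in> el om. ?R n D} = {D \<in> U. \<exists>n \<in> el om. D = dense_set n}"
      using eq_dense_set by blast
    also have "\<dots> = dense_set ` el om" using dense_set(2) V_in_U by blast
    finally show ?thesis .
  qed
  ultimately have I: "internal (dense_set ` el om)" by simp
  have "Df ?K (\<lambda>e. \<exists>n \<in> el om. ?R n (e 0))"
    by (rule Df_dense_set Df_ex_el Dt_var Dt_const insertI1 insertI2 om_simps(2))+
  then have D': "Df ?K (\<lambda>e. e 0 \<in> dense_set ` el om)"
    by (rule Df_cong) (use eq_dense_set in blast)
  show el: "el DD = dense_set ` el om" and DDs: "is_set M DD" unfolding DD_def using I by simp_all
  have sub: "dense_set ` el om \<subseteq> VU" using dense_set(2) by blast
  note DDV = V_definable[OF I sub D' fixed_params, folded DD_def]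
  show V: "DD \<in> VU" using DDV by blast
  \<comment> \<open>The inverse of the enumeration \<open>dense_set\<close>. It belongs to the model
    because it is definable from \<open>DD\<close>, \<open>A\<close>, \<open>om\<close> and
    \<open>Tour\<close>, all invariant.\<close>
  let ?F = "{(D, n). D \<in> el DD \<and> n \<in> el om \<and> ?R n D}"
  have D2: "Df {DD, A, om, Tour} (\<lambda>e. e 0 \<in> el DD \<and> e 1 \<in> el om \<and> ?R (e 1) (e 0))"
    by (rule Df_conj Df_in_el Df_dense_set Dt_var Dt_const insertI1 insertI2 om_simps(2) V_in_U[OF V])+
  have D3: "Df ?K (\<lambda>e. ?R (e 1) (e 0))"
    by (rule Df_dense_set Dt_var insertI1 insertI2)+
  have F: "irel ?F"
    by (rule irel_sep2[OF _ _ D3]) (use V in simp_all)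
  have F_iff: "(D, n) \<in> ?F \<longleftrightarrow> n \<in> el om \<and> D = dense_set n" for D n
    using eq_dense_set el by blast
  have FV: "mkr ?F \<in> VU"
  proof (rule rel_V_definable(1)[OF F])
    show "Df {DD, A, om, Tour} (\<lambda>e. (e 0, e 1) \<in> ?F)" using D2 by simp
    show "act g k = k" if "g \<in> G" "k \<in> {DD, A, om, Tour}" for g k
      using that fixed_params DDV(2) unfolding fsupp_def by blast
    show "\<exists>E F. x \<in> VU \<and> y \<in> VU \<and> fsupp E x \<and> fsupp F y" if "(x, y) \<in> ?F" for x y
    proof -
      have y: "y \<in> el om" and x: "x = dense_set y" using that F_iff by blast+
      show ?thesis unfolding x using dense_set(2,3)[OF y] nat_V[OF y] fsupp_nat[OF y] by blast
    qed
  qed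
  have bij: "bijrel Q (el DD) (el om)"
    if Q: "\<And>D n. (D, n) \<in> Q \<longleftrightarrow> n \<in> el om \<and> D = dense_set n" for Q
  proof (rule bijrelI)
    show "Q \<subseteq> el DD \<times> el om" using Q el by auto
    show "\<exists>y. (x, y) \<in> Q" if "x \<in> el DD" for x using that el Q by auto
    show "\<exists>x. (x, y) \<in> Q" if "y \<in> el om" for y using that Q by blast
    show "y = y'" if "(x, y) \<in> Q" "(x, y') \<in> Q" for x y y'
      using that Q dense_set_inj by simp
    show "x = x'" if "(x, y) \<in> Q" "(x', y) \<in> Q" for x x' y
      using that Q by simp
  qed
  have "bijrel ?F (el DD) (el om)" by (rule bij) (rule F_iff)
  then have "is_bijection M (mkr ?F) DD om" unfolding is_bijection_iff rel_of_mkr[OF F] using F by simp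
  then have "equipotent V DD om" using equipotent_V_I FV V om_V by blast
  then show "countable_in V DD"
    unfolding countable_in_def countably_infinite_in_def is_omega_V is_set_V using V DDs by blast
qed

lemma not_MA: "\<not> MA_aleph0 V"
proof
  assume ma: "MA_aleph0 V"
  have "is_nonempty_set V Tour"
    unfolding is_nonempty_V Tour(1) using Tour cond_empty unfolding conds_def by blast
  moreover have "is_set V DD" using DD by (simp add: is_set_V)
  moreover have "\<forall>D \<in> elems V DD. is_dense V Tour ext_code D"
    unfolding el_V[OF DD(2)] DD(1) using dense_set_dense by blast
  ultimately obtain H where H: "is_filter V Tour ext_code H" "\<forall>D \<in> elems V DD. elems V H \<inter> elems V D \<noteq> {}"
    using ma quasi_order_Tour ccc_Tour countable_DD unfolding MA_aleph0_def by blast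
  have HV: "H \<in> VU" using H(1) unfolding is_filter_def is_nonempty_V by blast
  have HP: "el H \<subseteq> conds" and dir: "\<And>p q. p \<in> el H \<Longrightarrow> q \<in> el H \<Longrightarrow> \<exists>s \<in> el H. (s, p) \<in> ext_rel \<and> (s, q) \<in> ext_rel"
    using H(1) unfolding is_filter_def rel_of_ext_code el_V[OF HV] el_V[OF Tour(3)] Tour(1) by blast+
  have meet: "el H \<inter> el (dense_set n) \<noteq> {}" if "n \<in> el om" for n
    using H(2) that unfolding el_V[OF DD(2)] DD(1) el_V[OF HV, symmetric] el_V[OF dense_set(2)[OF that], symmetric] by blast
  obtain Q where Q: "fin_part Q" "supports Q H" using V_support[OF HV] by blast
  \<comment> \<open>\<open>k\<close> is the number of blocks. A tournament on \<open>k + 1\<close>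
    points must have two of them in one block, which is why the dense set for \<open>sc k\<close> is
    used.\<close>
  obtain k where k: "k \<in> el om" "eqp (el Q) (el k)" using fin_part_blocks(2)[OF Q(1)] unfolding Fin_def by blast
  have sk: "sc k \<in> el om" using k by simp
  obtain p where p: "p \<in> el H" "p \<in> el (dense_set (sc k))" using meet[OF sk] by blast
  then have "large p (sc k)" using dense_set(1)[OF sk] by blast
  then obtain E T where ET: "cond p E" "T \<subseteq> E" "internal T" "eqp T (el (sc k))" by (rule largeE)
  have E: "Fin E" "E \<subseteq> el A" "tour p E" using ET unfolding cond_def by blast+
  have no_pair: "(a, b) \<notin> rel_of M p" if B: "B \<in> el Q" "a \<in> el B" "b \<in> el B" "a \<noteq> b" for a b B
  proof
    assume ab: "(a, b) \<in> rel_of M p"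
    have A: "a \<in> el A" "b \<in> el A" using fin_part_blocks(4)[OF Q(1) B(1)] B by blast+
    let ?g = "swap a b"
    have g: "?g \<in> G" using swap_in_G[OF A] .
    have pU: "p \<in> U" using p(1) by simp
    have "act ?g H = H" using supports_swap[OF Q B(1-3)] .
    then have "act ?g p \<in> el H" using act_mem[OF g pU, of H] p(1) HV by simp
    \<comment> \<open>A common extension of \<open>p\<close> and its image in the filter would
      contain the edge between \<open>a\<close> and \<open>b\<close> in both directions.\<close>
    then obtain s where s: "s \<in> el H" "(s, p) \<in> ext_rel" "(s, act ?g p) \<in> ext_rel" using dir p(1) by blast
    have "(act ?g a, act ?g b) \<in> rel_of M (act ?g p)"
      using act_rel_of[OF g _ _ pU] ab rel_of_in_U by blast
    then have "(b, a) \<in> rel_of M (act ?g p)" using act_swap(1,2)[OF A] by simp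
    then have "(a, b) \<in> rel_of M s" "(b, a) \<in> rel_of M s"
      using s(2,3) ab ext_rel_iff unfolding ext_rel_def by blast+
    moreover obtain F where "tour s F" using s(1) HP unfolding conds_def cond_def by blast
    ultimately show False using tourD(4) B(4) by blast
  qed
  let ?P = "\<lambda>a B. a \<in> el B"
  have D: "Df U (\<lambda>e. ?P (e 0) (e 1))" by (rule Df_logic Dt_var)+
  \<comment> \<open>Sending a point of \<open>T\<close> to its block is injective by
    \<open>no_pair\<close>, as any two points of \<open>T\<close> are joined by an edge of
    \<open>p\<close>. This embeds \<open>sc k\<close> into \<open>k\<close>.\<close>
  let ?R = "{(a, B). a \<in> T \<and> B \<in> el Q \<and> ?P a B}"
  have R: "irel ?R" by (rule irel_sep2[OF ET(3) internal_el[OF fin_part_blocks(1)[OF Q(1)]] D])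
  have "bijrel ?R T (Range ?R)"
  proof (rule bijrelI)
    show "\<exists>B. (a, B) \<in> ?R" if "a \<in> T" for a
      using that fin_part_blocks(5)[OF Q(1), of a] ET(2) E(2) by blast
    show "B = B'" if "(a, B) \<in> ?R" "(a, B') \<in> ?R" for a B B'
      using that fin_part_blocks(6)[OF Q(1)] by blast
    show "a = a'" if "(a, B) \<in> ?R" "(a', B) \<in> ?R" for a a' B
      using that no_pair[of B a a'] no_pair[of B a' a] tourD(3)[OF E(3), of a a'] ET(2) by blast
  qed blast+
  then have "eqp T (Range ?R)" using R unfolding eqp_def by blast
  moreover have "Range ?R \<subseteq> el Q" by blast
  ultimately obtain T'' where T'': "T'' \<subseteq> el k" "internal T''" "eqp (Range ?R) T''"
    using eqp_subset[OF k(2) internal_Domain_Range(2)[OF R]] by blast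
  have "eqp T'' (el (sc k))"
    using eqp_trans[OF eqp_sym[OF T''(3)] eqp_trans[OF eqp_sym[OF \<open>eqp T (Range ?R)\<close>] ET(4)]] .
  then show False using pigeonhole[OF k(1) T''(1,2)] by blast
qed

end

theorem theorem4p5:
  fixes M :: "'a set_structure" and A :: 'a and V :: "'a set_structure"
  assumes "zfa_model M" and "AC M"
    and "is_set_of_atoms M A" and "countably_infinite_in M A"
    and "V = finite_partition_model M A"
  shows "(\<not> Form3 V \<and> \<not> ISAE V \<and> \<not> EPWFP V) \<and>
    (\<forall>n. is_natural V n \<and> at_least_two V n \<longrightarrow> \<not> AC_n V n) \<and>
    \<not> MA_aleph0 V \<and>
    (\<not> MC V \<and> \<not> countable_MC V)"
proof -
  interpret zfa M using assms(1) by unfold_locales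
  interpret zfa_atoms M A using assms(3) by unfold_locales
  interpret zfa_countable_atoms M A using assms(4) by unfold_locales
  show ?thesis
    unfolding assms(5)
    using not_Form3 not_ISAE not_EPWFP not_MA not_MC not_countable_MC not_AC_n at_least_two_V
    unfolding is_natural_V by blast
qed

end
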